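(* Let $\lambda>n\ge1$, let $H$ be any maximal abelian subgroup of $\mathrm{SU}(n,1)$, and let $\widetilde H$ be the subgroup of the universal covering group $\widetilde{\mathrm{SU}(n,1)}$ which covers $H$ (the inverse image of $H$). Then: (i) the restriction $\pi_\lambda|_{\widetilde H}$ of the holomorphic discrete series representation $\pi_\lambda$ on $\mathcal{H}^2_\lambda(\mathbb{B}^n)$ is multiplicity-free; (ii) the Toeplitz operators on $\mathcal{H}^2_\lambda(\mathbb{B}^n)$ with $H$-invariant symbols pairwise commute: $T^{(\lambda)}_\varphi T^{(\lambda)}_\psi=T^{(\lambda)}_\psi T^{(\lambda)}_\varphi$ for all $H$-invariant $\varphi,\psi\in L^\infty(\mathbb{B}^n)$.
   Context: $\mathbb{B}^n$ is the unit ball of $\mathbb{C}^n$. $\mathrm{SU}(n,1)$ is the group of determinant-one complex $(n+1)\times(n+1)$ matrices preserving $-z_1\bar w_1-\dots-z_n\bar w_n+z_{n+1}\bar w_{n+1}$; it acts on $\mathbb{B}^n$ by $\begin{pmatrix}a&v\\ w^t&d\end{pmatrix}\cdot z=\frac{az+v}{w^tz+d}$, and its universal cover $\widetilde{\mathrm{SU}(n,1)}$ acts through the covering map. $j_\lambda$ is the lift of $(w^tz+d)^{-\lambda}$ to $\widetilde{\mathrm{SU}(n,1)}\times\mathbb{B}^n$. For $\lambda>n$, $d\mu_\lambda=c_\lambda(1-|z|^2)^{\lambda-n-1}dv$ with $dv$ normalized Lebesgue measure and $c_\lambda=\frac{\Gamma(\lambda)}{n!\,\Gamma(\lambda-n)}$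 (a probability measure), $\mathcal{H}^2_\lambda(\mathbb{B}^n)$ is the space of holomorphic functions in $L^2(\mathbb{B}^n,\mu_\lambda)$, and $\pi_\lambda(g)f(z)=j_\lambda(g^{-1},z)f(g^{-1}\cdot z)$ is the irreducible unitary representation of $\widetilde{\mathrm{SU}(n,1)}$ on it. Multiplicity-free means that in the direct integral decomposition of $\pi_\lambda|_{\widetilde H}$ into irreducible unitary representations of $\widetilde H$ all multiplicities are $0$ or $1$; equivalently (for type I groups), the algebra of bounded operators commuting with $\pi_\lambda(h)$ for all $h\in\widetilde H$ is commutative. $T^{(\lambda)}_\varphi f=P_\lambda(\varphi f)$, where $P_\lambda$ is the orthogonal projection of $L^2(\mathbb{B}^n,\mu_\lambda)$ onto $\mathcal{H}^2_\lambda(\mathbb{B}^n)$. A symbol $\varphi$ is $H$-invariant if $\varphi(h\cdot z)=\varphi(z)$ for all $h\in H$. *)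

theory Defs
  imports "HOL-Analysis.Analysis" "HOL-Algebra.Group"
begin

section \<open>The group SU(n,1) and its action on the unit ball\<close>

text \<open>
  The dimension is n = CARD('n). The coordinates of an (n+1)-vector are indexed by
  \<^typ>\<open>'n option\<close>: Some i stands for the i-th coordinate, None for the (n+1)-st one.
\<close>

definition herm_form :: "complex^('n::finite option) \<Rightarrow> complex^('n option) \<Rightarrow> complex" where
  "herm_form z w = - (\<Sum>i\<in>UNIV. z $ Some i * cnj (w $ Some i)) + z $ None * cnj (w $ None)"

definition SU_n1 :: "(complex^('n::finite option)^('n option)) monoid" where
  "SU_n1 = \<lparr> carrier = {A. det A = 1 \<and> (\<forall>z w. herm_form (A *v z) (A *v w) = herm_form z w)},
             monoid.mult = (**), one = mat 1 \<rparr>"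

definition aut_denom :: "complex^('n::finite option)^('n option) \<Rightarrow> complex^'n \<Rightarrow> complex" where
  "aut_denom A z = (\<Sum>j\<in>UNIV. A $ None $ Some j * z $ j) + A $ None $ None"

definition ball_action :: "complex^('n::finite option)^('n option) \<Rightarrow> complex^'n \<Rightarrow> complex^'n" where
  "ball_action A z =
     (\<chi> i. ((\<Sum>j\<in>UNIV. A $ Some i $ Some j * z $ j) + A $ Some i $ None) / aut_denom A z)"

definition abelian_subgroup :: "'a set \<Rightarrow> ('a, 'b) monoid_scheme \<Rightarrow> bool" where
  "abelian_subgroup H G \<longleftrightarrow> subgroup H G \<and> (\<forall>x\<in>H. \<forall>y\<in>H. x \<otimes>\<^bsub>G\<^esub> y = y \<otimes>\<^bsub>G\<^esub> x)"

definition maximal_abelian_subgroup :: "'a set \<Rightarrow> ('a, 'b) monoid_scheme \<Rightarrow> bool" where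
  "maximal_abelian_subgroup H G \<longleftrightarrow>
     abelian_subgroup H G \<and> (\<forall>K. abelian_subgroup K G \<and> H \<subseteq> K \<longrightarrow> K = H)"


section \<open>The universal covering group\<close>

definition topological_group_on :: "('a::topological_space, 'b) monoid_scheme \<Rightarrow> bool" where
  "topological_group_on G \<longleftrightarrow> group G \<and>
     continuous_on (carrier G \<times> carrier G) (\<lambda>(x, y). x \<otimes>\<^bsub>G\<^esub> y) \<and>
     continuous_on (carrier G) (\<lambda>x. inv\<^bsub>G\<^esub> x)"

text \<open>
  \<^const>\<open>simply_connected\<close> includes path-connectedness, since it makes any two loops
  (in particular, any two constant ones) freely homotopic.
\<close>

definition universal_covering_group ::
    "('g::topological_space, 'c) monoid_scheme \<Rightarrow> ('g \<Rightarrow> 'a::topological_space) \<Rightarrow>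
     ('a, 'b) monoid_scheme \<Rightarrow> bool" where
  "universal_covering_group G p K \<longleftrightarrow>
     topological_group_on G \<and> p \<in> hom G K \<and>
     covering_space (carrier G) p (carrier K) \<and> simply_connected (carrier G)"

definition covering_preimage ::
    "('g, 'c) monoid_scheme \<Rightarrow> ('g \<Rightarrow> 'a) \<Rightarrow> 'a set \<Rightarrow> 'g set" where
  "covering_preimage G p H = {g \<in> carrier G. p g \<in> H}"

text \<open>
  The lift of the multivalued function (w z + d) to the power -lambda: the branch is given by the
  continuous logarithm L of w z + d on the product of the covering group and the ball that
  vanishes at the base point. As this product is connected, there is only one such L.
\<close>

definition is_automorphy_lift ::
    "real \<Rightarrow> ('g::topological_space, 'c) monoid_scheme \<Rightarrow>
     ('g \<Rightarrow> complex^('n::finite option)^('n option)) \<Rightarrow> ('g \<Rightarrow> complex^'n \<Rightarrow> complex) \<Rightarrow> bool" where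
  "is_automorphy_lift lam G p j \<longleftrightarrow>
     (\<exists>L :: 'g \<times> (complex^'n) \<Rightarrow> complex.
        continuous_on (carrier G \<times> ball 0 1) L \<and>
        L (\<one>\<^bsub>G\<^esub>, 0) = 0 \<and>
        (\<forall>g\<in>carrier G. \<forall>z\<in>ball 0 1. exp (L (g, z)) = aut_denom (p g) z) \<and>
        (\<forall>g\<in>carrier G. \<forall>z\<in>ball 0 1. j g z = exp (- of_real lam * L (g, z))))"


section \<open>Weighted Bergman spaces\<close>

definition ball_volume :: "(complex^'n::finite) measure" where
  "ball_volume = uniform_measure (lebesgue_on (ball 0 1)) (ball 0 1)"

definition bergman_measure :: "real \<Rightarrow> (complex^'n::finite) measure" where
  "bergman_measure lam = density ball_volume
     (\<lambda>z. ennreal (Gamma lam / (fact CARD('n) * Gamma (lam - real CARD('n)))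
                     * (1 - (norm z)\<^sup>2) powr (lam - real CARD('n) - 1)))"

definition square_integrable :: "'a measure \<Rightarrow> ('a \<Rightarrow> complex) \<Rightarrow> bool" where
  "square_integrable M f \<longleftrightarrow> f \<in> borel_measurable M \<and> integrable M (\<lambda>z. (norm (f z))\<^sup>2)"

definition holomorphic_in :: "(complex^'n::finite \<Rightarrow> complex) \<Rightarrow> (complex^'n) set \<Rightarrow> bool" where
  "holomorphic_in f S \<longleftrightarrow>
     (\<forall>z\<in>S. \<exists>D. (f has_derivative D) (at z) \<and> (\<forall>c v. D (c *s v) = c * D v))"

text \<open>
  A function on the ball is represented by its extension by 0, so that elements of the Bergman
  space are equal as HOL functions iff they agree on the ball.
\<close>

definition bergman_space :: "real \<Rightarrow> (complex^'n::finite \<Rightarrow> complex) set" where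
  "bergman_space lam =
     {f. holomorphic_in f (ball 0 1) \<and> square_integrable (bergman_measure lam) f \<and>
         (\<forall>z. z \<notin> ball 0 1 \<longrightarrow> f z = 0)}"

definition bergman_inner ::
    "real \<Rightarrow> (complex^'n::finite \<Rightarrow> complex) \<Rightarrow> (complex^'n \<Rightarrow> complex) \<Rightarrow> complex" where
  "bergman_inner lam f g = (\<integral>z. f z * cnj (g z) \<partial>bergman_measure lam)"

definition bergman_norm :: "real \<Rightarrow> (complex^'n::finite \<Rightarrow> complex) \<Rightarrow> real" where
  "bergman_norm lam f = sqrt (\<integral>z. (norm (f z))\<^sup>2 \<partial>bergman_measure lam)"

text \<open>
  The orthogonal projection from L2 onto the Bergman space; it is meaningful for square-integrable
  arguments, and depends only on their restriction to the ball.
\<close>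

definition bergman_projection ::
    "real \<Rightarrow> (complex^'n::finite \<Rightarrow> complex) \<Rightarrow> (complex^'n \<Rightarrow> complex)" where
  "bergman_projection lam f =
     (THE h. h \<in> bergman_space lam \<and>
             (\<forall>g\<in>bergman_space lam. bergman_inner lam (\<lambda>z. f z - h z) g = 0))"


section \<open>Toeplitz operators\<close>

definition toeplitz ::
    "real \<Rightarrow> (complex^'n::finite \<Rightarrow> complex) \<Rightarrow> (complex^'n \<Rightarrow> complex) \<Rightarrow> (complex^'n \<Rightarrow> complex)" where
  "toeplitz lam \<phi> f = bergman_projection lam (\<lambda>z. \<phi> z * f z)"

definition Linfty_ball :: "(complex^'n::finite \<Rightarrow> complex) set" where
  "Linfty_ball =
     {\<phi>. \<phi> \<in> borel_measurable ball_volume \<and> (\<exists>C. AE z in ball_volume. norm (\<phi> z) \<le> C)}"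

text \<open>
  Elements of L-infinity are classes modulo null sets, so invariance is required almost everywhere
  for each group element separately; pointwise invariant symbols are a special case.
\<close>

definition invariant_symbol ::
    "(complex^('n::finite option)^('n option)) set \<Rightarrow> (complex^'n \<Rightarrow> complex) \<Rightarrow> bool" where
  "invariant_symbol H \<phi> \<longleftrightarrow> (\<forall>h\<in>H. AE z in ball_volume. \<phi> (ball_action h z) = \<phi> z)"


section \<open>The holomorphic discrete series and multiplicity-freeness\<close>

definition hol_discrete_series ::
    "('g, 'c) monoid_scheme \<Rightarrow> ('g \<Rightarrow> complex^('n::finite option)^('n option)) \<Rightarrow>
     ('g \<Rightarrow> complex^'n \<Rightarrow> complex) \<Rightarrow> 'g \<Rightarrow> (complex^'n \<Rightarrow> complex) \<Rightarrow> (complex^'n \<Rightarrow> complex)" where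
  "hol_discrete_series G p j g f =
     (\<lambda>z. if z \<in> ball 0 1
          then j (inv\<^bsub>G\<^esub> g) z * f (ball_action (p (inv\<^bsub>G\<^esub> g)) z)
          else 0)"

definition bergman_bounded_operator ::
    "real \<Rightarrow> ((complex^'n::finite \<Rightarrow> complex) \<Rightarrow> (complex^'n \<Rightarrow> complex)) \<Rightarrow> bool" where
  "bergman_bounded_operator lam T \<longleftrightarrow>
     (\<forall>f\<in>bergman_space lam. T f \<in> bergman_space lam) \<and>
     (\<forall>f\<in>bergman_space lam. \<forall>g\<in>bergman_space lam. T (\<lambda>z. f z + g z) = (\<lambda>z. T f z + T g z)) \<and>
     (\<forall>c. \<forall>f\<in>bergman_space lam. T (\<lambda>z. c * f z) = (\<lambda>z. c * T f z)) \<and>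
     (\<exists>C. \<forall>f\<in>bergman_space lam. bergman_norm lam (T f) \<le> C * bergman_norm lam f)"

definition bergman_commutant ::
    "real \<Rightarrow> 'g set \<Rightarrow> ('g \<Rightarrow> (complex^'n::finite \<Rightarrow> complex) \<Rightarrow> (complex^'n \<Rightarrow> complex)) \<Rightarrow>
     ((complex^'n \<Rightarrow> complex) \<Rightarrow> (complex^'n \<Rightarrow> complex)) set" where
  "bergman_commutant lam K \<pi> =
     {T. bergman_bounded_operator lam T \<and>
         (\<forall>h\<in>K. \<forall>f\<in>bergman_space lam. T (\<pi> h f) = \<pi> h (T f))}"

text \<open>
  Multiplicity-freeness of the restriction of the unitary representation to K, in the form
  "the algebra of bounded intertwining operators is commutative". For type I groups this says
  that all multiplicities in the direct integral decomposition are 0 or 1.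
\<close>

definition bergman_multiplicity_free ::
    "real \<Rightarrow> 'g set \<Rightarrow> ('g \<Rightarrow> (complex^'n::finite \<Rightarrow> complex) \<Rightarrow> (complex^'n \<Rightarrow> complex)) \<Rightarrow> bool" where
  "bergman_multiplicity_free lam K \<pi> \<longleftrightarrow>
     (\<forall>S\<in>bergman_commutant lam K \<pi>. \<forall>T\<in>bergman_commutant lam K \<pi>.
        \<forall>f\<in>bergman_space lam. S (T f) = T (S f))"

end

theory Submission
  imports Defs "HOL-Complex_Analysis.Conformal_Mappings"
begin

text \<open>
  All operators which commute with \<open>H\<close> are symmetric for one complex symmetric bilinear form, so they
  commute with each other. The form is \<open>\<langle>f, J g\<rangle>\<close>, where \<open>J f = cnj (\<nu> \<cdot> f \<circ> \<sigma>)\<close> is an antiunitary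
  involution and \<open>\<sigma>\<close> is an antiholomorphic involution of the ball which, near one point, moves every
  point along its \<open>H\<close>-orbit. For \<open>S\<close> in the commutant and \<open>k\<^sub>w\<close> the reproducing kernel, the required
  symmetry \<open>J S k\<^sub>w (z) = J S k\<^sub>z (w)\<close> holds for \<open>w = \<sigma> z\<close> because \<open>\<sigma> z\<close> and \<open>z\<close> are related by an element
  of \<open>H\<close>, and it extends to all \<open>z\<close> and \<open>w\<close> by polarization.

  No classification of the maximal abelian subgroups enters the construction of \<open>\<sigma>\<close>. By maximality
  there is a positive vector \<open>v\<close> whose \<open>H\<close>-orbit spans the whole space; as \<open>H\<close> is abelian, \<open>h v \<mapsto> h\<^sup>-\<^sup>1 v\<close>
  extends to an antilinear involution which inverts \<open>H\<close>. It maps a cyclic vector \<open>x\<close> to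
  \<open>c h x\<close> with \<open>h \<in> H\<close> and \<open>\<bar>c\<bar> = 1\<close>, again by maximality.
\<close>

subsection \<open>Linear images of Lebesgue measure\<close>

text \<open>Operators commuting with \<open>H\<close> are closed under products, so
  \<open>T S\<close> is symmetric as well; moving \<open>S\<close> and then \<open>T\<close> across
  the form therefore turns \<open>S T\<close> into \<open>T S\<close>. For a pair
  \<open>(z, \<sigma> z)\<close> the symmetry concerns a single \<open>h \<in> H\<close>: the
  covariance of the reproducing kernel leaves only the factor
  \<open>\<bar>m z\<bar>\<^sup>2\<close>, so the phases of the multipliers drop out, and with them
  the choice of lifts to the covering group. As \<open>J\<close> is antilinear,
  \<open>J S k\<^sub>w (z)\<close> is holomorphic in both \<open>z\<close> and \<open>w\<close>, and
  the graph of \<open>\<sigma>\<close> is totally real of maximal dimension; this is why agreement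
  there is enough. Maximality always enters in one form: a form-preserving matrix commuting with
  \<open>H\<close> becomes an element of \<open>H\<close> once a root of its determinant is divided
  out, and scalars act trivially on the ball. The point \<open>z0\<close> is fixed by
  \<open>\<sigma>\<close>, which makes \<open>J\<close> an involution exactly and not only up to a
  phase, in spite of the real exponent. A Toeplitz operator with invariant symbol commutes with the
  same weighted compositions, so both claims are instances of one theorem.\<close>

lemma emeasure_unit_ball:
  "emeasure lborel (ball (0::'a::euclidean_space) 1) \<noteq> 0"
  "emeasure lborel (ball (0::'a::euclidean_space) 1) \<noteq> \<infinity>"
proof -
  obtain v where "v = unit_ball_vol (real DIM('a))" "v > 0" using unit_ball_vol_pos[of "real DIM('a)"] by simp
  then show "emeasure lborel (ball (0::'a::euclidean_space) 1) \<noteq> 0"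
    "emeasure lborel (ball (0::'a::euclidean_space) 1) \<noteq> \<infinity>"
    by (simp_all add: emeasure_ball flip: \<open>v = _\<close>)
qed

text \<open>The preimage of a ball lies in the image of that ball under the bounded inverse, so it
  is bounded. Tonelli's theorem below relies on the resulting sigma-finiteness.\<close>

lemma sigma_finite_distr_linear:
  fixes A :: "'a::euclidean_space \<Rightarrow> 'b::euclidean_space"
  assumes "linear A" "bij A"
  shows "sigma_finite_measure (distr lborel borel A)"
    and "emeasure (distr lborel borel A) (ball 0 r) < \<infinity>"
proof -
  have meas[measurable]: "A \<in> borel_measurable borel"
    using assms(1) by (simp add: linear_continuous_on linear_conv_bounded_linear borel_measurable_continuous_onI)
  obtain B where B: "linear B" "B \<circ> A = id"
    using linear_injective_left_inverse[OF assms(1) bij_is_inj[OF assms(2)]] by auto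
  have fin: "emeasure (distr lborel borel A) (ball 0 r) < \<infinity>" for r
  proof -
    have "A -` ball 0 r \<subseteq> B ` ball 0 r"
      using B(2) by (metis (no_types, lifting) comp_apply id_apply image_iff subsetI vimageD)
    then have "bounded (A -` ball 0 r)"
      using B(1) by (meson bounded_ball bounded_linear_image bounded_subset linear_conv_bounded_linear)
    then show ?thesis
      using emeasure_bounded_finite by (simp add: emeasure_distr)
  qed
  then show "emeasure (distr lborel borel A) (ball 0 r) < \<infinity>" .
  show "sigma_finite_measure (distr lborel borel A)"
  proof
    show "\<exists>S. countable S \<and> S \<subseteq> sets (distr lborel borel A) \<and>
      \<Union>S = space (distr lborel borel A) \<and> (\<forall>a\<in>S. emeasure (distr lborel borel A) a \<noteq> \<infinity>)"
    proof (intro exI[of _ "range (\<lambda>n::nat. ball (0::'b) (real n))"] conjI)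
      show "\<Union> (range (\<lambda>n::nat. ball (0::'b) (real n))) = space (distr lborel borel A)"
        by (auto simp: real_arch_simple reals_Archimedean2)
    qed (use fin in \<open>auto simp: less_top\<close>)
  qed
qed

text \<open>Uniqueness of Haar measure, by Tonelli's theorem applied to the indicator of
  the pairs \<open>y \<in> E\<close>, \<open>x - y \<in> ball 0 1\<close>.\<close>

lemma distr_lborel_linear:
  fixes A :: "'a::euclidean_space \<Rightarrow> 'b::euclidean_space"
  assumes "linear A" "bij A"
  shows "distr lborel borel A =
    density lborel (\<lambda>_. emeasure (distr lborel borel A) (ball 0 1) / emeasure lborel (ball (0::'b) 1))"
proof -
  define \<nu> where "\<nu> = distr lborel borel A"
  have meas[measurable]: "A \<in> borel_measurable borel"
    using assms(1) by (simp add: linear_continuous_on linear_conv_bounded_linear borel_measurable_continuous_onI)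
  have sets_nu[measurable_cong, simp]: "sets \<nu> = sets borel" and [simp]: "space \<nu> = UNIV"
    by (auto simp: \<nu>_def)
  interpret nu: sigma_finite_measure \<nu>
    using sigma_finite_distr_linear(1)[OF assms] by (simp add: \<nu>_def)
  interpret P: pair_sigma_finite "lborel :: 'b measure" \<nu> ..
  have trans_nu: "(\<integral>\<^sup>+ y. g (y + a) \<partial>\<nu>) = (\<integral>\<^sup>+ y. g y \<partial>\<nu>)" if [measurable]: "g \<in> borel_measurable borel" for g a
  proof -
    obtain a' where a': "A a' = a" using assms(2) by (metis bij_is_surj surjD)
    have "(\<integral>\<^sup>+ y. g (y + a) \<partial>\<nu>) = (\<integral>\<^sup>+ y. g (A (a' + y)) \<partial>lborel)"
      using assms(1) a' by (simp add: \<nu>_def nn_integral_distr linear_add add.commute)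
    also have "\<dots> = (\<integral>\<^sup>+ y. g (A y) \<partial>distr lborel borel ((+) a'))"
      by (simp add: nn_integral_distr)
    also have "\<dots> = (\<integral>\<^sup>+ y. g y \<partial>\<nu>)"
      by (simp add: lborel_distr_plus \<nu>_def nn_integral_distr)
    finally show ?thesis .
  qed
  have trans_l: "(\<integral>\<^sup>+ x. g (x + a) \<partial>lborel) = (\<integral>\<^sup>+ x. g x \<partial>lborel)" if [measurable]: "g \<in> borel_measurable borel" for g and a :: 'b
  proof -
    have "(\<integral>\<^sup>+ x. g (x + a) \<partial>lborel) = (\<integral>\<^sup>+ x. g x \<partial>distr lborel borel ((+) a))"
      by (simp add: nn_integral_distr add.commute)
    then show ?thesis by (simp add: lborel_distr_plus)
  qed
  let ?B = "ball (0::'b) 1"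
  have [measurable]: "?B \<in> sets borel" by simp
  note Bpos = emeasure_unit_ball[where 'a='b]
  have key: "emeasure \<nu> E * emeasure lborel ?B = emeasure lborel E * emeasure \<nu> ?B"
    if [measurable]: "E \<in> sets borel" for E
  proof -
    have "emeasure \<nu> E * emeasure lborel ?B
        = (\<integral>\<^sup>+ y. indicator E y * (\<integral>\<^sup>+ x. indicator ?B x \<partial>lborel) \<partial>\<nu>)"
      by (simp add: nn_integral_multc)
    also have "\<dots> = (\<integral>\<^sup>+ y. \<integral>\<^sup>+ x. indicator E y * indicator ?B (x - y) \<partial>lborel \<partial>\<nu>)"
    proof (rule nn_integral_cong)
      fix y
      have "(\<integral>\<^sup>+ x. indicator ?B (x - y) \<partial>lborel) = (\<integral>\<^sup>+ x. indicator ?B x \<partial>lborel)"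
        using trans_l[OF borel_measurable_indicator, of ?B "- y"] by simp
      then show "indicator E y * (\<integral>\<^sup>+ x. indicator ?B x \<partial>lborel) =
        (\<integral>\<^sup>+ x. indicator E y * indicator ?B (x - y) \<partial>lborel)"
      proof -
        have "(\<lambda>x. indicator ?B (x - y) :: ennreal) \<in> borel_measurable lborel" by measurable
        from nn_integral_cmult[OF this, of "indicator E y"] show ?thesis
          using \<open>(\<integral>\<^sup>+ x. indicator ?B (x - y) \<partial>lborel) = _\<close> by simp
      qed
    qed
    also have "\<dots> = (\<integral>\<^sup>+ x. \<integral>\<^sup>+ y. indicator E y * indicator ?B (x - y) \<partial>\<nu> \<partial>lborel)"
      by (rule P.Fubini') measurable
    \<comment> \<open>Translating \<open>y\<close> by \<open>x\<close> turns \<open>x - y\<close>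
      into \<open>- y\<close>, and the ball is symmetric.\<close>
    also have "\<dots> = (\<integral>\<^sup>+ x. \<integral>\<^sup>+ y. indicator E (y + x) * indicator ?B y \<partial>\<nu> \<partial>lborel)"
    proof (rule nn_integral_cong)
      fix x
      show "(\<integral>\<^sup>+ y. indicator E y * indicator ?B (x - y) \<partial>\<nu>) =
          (\<integral>\<^sup>+ y. indicator E (y + x) * indicator ?B y \<partial>\<nu>)"
        using trans_nu[of "\<lambda>y. indicator E y * indicator ?B (x - y)" x]
        by (simp add: indicator_def if_distrib cong: if_cong)
    qed
    also have "\<dots> = (\<integral>\<^sup>+ y. \<integral>\<^sup>+ x. indicator E (y + x) * indicator ?B y \<partial>lborel \<partial>\<nu>)"
      by (rule P.Fubini'[symmetric]) measurable
    also have "\<dots> = (\<integral>\<^sup>+ y. emeasure lborel E * indicator ?B y \<partial>\<nu>)"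
    proof (rule nn_integral_cong)
      fix y
      have "(\<integral>\<^sup>+ x. indicator E (y + x) \<partial>lborel) = emeasure lborel E"
        using trans_l[OF borel_measurable_indicator, of E y] by (simp add: add.commute)
      then show "(\<integral>\<^sup>+ x. indicator E (y + x) * indicator ?B y \<partial>lborel) = emeasure lborel E * indicator ?B y"
        by (subst nn_integral_multc) auto
    qed
    also have "\<dots> = emeasure lborel E * emeasure \<nu> ?B"
      by (simp add: nn_integral_cmult)
    finally show ?thesis .
  qed
  have "\<nu> = density lborel (\<lambda>_. emeasure \<nu> ?B / emeasure lborel ?B)"
  proof (rule measure_eqI)
    fix E assume "E \<in> sets \<nu>"
    then have [measurable]: "E \<in> sets borel" by simp
    have "emeasure \<nu> E = emeasure \<nu> E * emeasure lborel ?B / emeasure lborel ?B"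
      using Bpos by (simp add: ennreal_mult_divide_eq)
    also have "\<dots> = emeasure \<nu> ?B / emeasure lborel ?B * emeasure lborel E"
      unfolding key[OF \<open>E \<in> sets borel\<close>] by (simp add: ennreal_times_divide mult.commute)
    finally show "emeasure \<nu> E = emeasure (density lborel (\<lambda>_. emeasure \<nu> ?B / emeasure lborel ?B)) E"
      by (simp add: emeasure_density_const)
  qed simp
  then show ?thesis by (simp add: \<nu>_def)
qed

text \<open>The image of Lebesgue measure is a multiple of it, and the unit ball, whose preimage is
  the ball of radius \<open>1 / k\<close>, determines the multiple. No determinant has to be
  computed.\<close>

lemma nn_integral_similarity:
  fixes A :: "'a::euclidean_space \<Rightarrow> 'a"
  assumes A: "linear A" "\<And>x. norm (A x) = k * norm x" and k: "k > 0"
    and [measurable]: "g \<in> borel_measurable borel"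
  shows "(\<integral>\<^sup>+ x. g x \<partial>lborel) = ennreal (k ^ DIM('a)) * (\<integral>\<^sup>+ x. g (A x) \<partial>lborel)"
proof -
  have inj: "inj A"
  proof (subst linear_injective_0[OF A(1)], intro allI impI)
    fix x assume "A x = 0" then show "x = 0" using A(2)[of x] k by auto
  qed
  then have bij: "bij A" using A(1) by (simp add: bij_def linear_injective_imp_surjective)
  have [measurable]: "A \<in> borel_measurable borel"
    using A(1) by (simp add: linear_continuous_on linear_conv_bounded_linear borel_measurable_continuous_onI)
  let ?v = "unit_ball_vol (real DIM('a))"
  have "A -` ball 0 1 = ball 0 (1 / k)"
    using k by (auto simp: A(2) field_simps)
  then have "emeasure (distr lborel borel A) (ball 0 1) / emeasure lborel (ball (0::'a) 1)
     = ennreal (?v * (1 / k) ^ DIM('a)) / ennreal ?v"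
    using k by (simp add: emeasure_distr emeasure_ball)
  also have "\<dots> = ennreal ((1 / k) ^ DIM('a))"
  proof -
    obtain v where "v = ?v" "v > 0" using unit_ball_vol_pos[of "real DIM('a)"] by simp
    then show ?thesis using k by (simp add: divide_ennreal flip: \<open>v = _\<close>)
  qed
  finally have "distr lborel borel A = density lborel (\<lambda>_. ennreal ((1 / k) ^ DIM('a)))"
    using distr_lborel_linear[OF A(1) bij] by simp
  then have "(\<integral>\<^sup>+ x. g (A x) \<partial>lborel) = ennreal ((1 / k) ^ DIM('a)) * (\<integral>\<^sup>+ x. g x \<partial>lborel)"
    by (simp add: nn_integral_distr[of A lborel borel g, symmetric] nn_integral_density nn_integral_cmult)
  then have "ennreal (k ^ DIM('a)) * (\<integral>\<^sup>+ x. g (A x) \<partial>lborel)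
     = ennreal (k ^ DIM('a) * (1 / k) ^ DIM('a)) * (\<integral>\<^sup>+ x. g x \<partial>lborel)"
    using k by (simp add: mult.assoc[symmetric] ennreal_mult[symmetric])
  then show ?thesis using k by (simp add: power_mult_distrib[symmetric])
qed

corollary distr_lborel_isometry:
  fixes A :: "'a::euclidean_space \<Rightarrow> 'a"
  assumes A: "linear A" "\<And>x. norm (A x) = norm x"
  shows "distr lborel borel A = lborel"
proof -
  have [measurable]: "A \<in> borel_measurable borel"
    using A(1) by (simp add: linear_continuous_on linear_conv_bounded_linear borel_measurable_continuous_onI)
  show ?thesis
  proof (rule measure_eqI)
    fix E assume "E \<in> sets (distr lborel borel A)"
    then have [measurable]: "E \<in> sets borel" by simp
    have "emeasure (distr lborel borel A) E = (\<integral>\<^sup>+ x. indicator E (A x) \<partial>lborel)"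
      by (subst nn_integral_distr[of A lborel borel "indicator E", symmetric]) auto
    also have "\<dots> = emeasure lborel E"
      using nn_integral_similarity[OF A(1), of 1 "indicator E"] A(2) by simp
    finally show "emeasure (distr lborel borel A) E = emeasure lborel E" .
  qed simp
qed

text \<open>Transporting the measure twice gives it back, so the constant satisfies
  \<open>c * c = 1\<close>. This serves reflections of an indefinite form, which are not Euclidean
  isometries in general.\<close>

lemma distr_lborel_involution:
  fixes A :: "'a::euclidean_space \<Rightarrow> 'a"
  assumes A: "linear A" "\<And>x. A (A x) = x"
  shows "distr lborel borel A = lborel"
proof -
  have [measurable]: "A \<in> borel_measurable borel"
    using A(1) by (simp add: linear_continuous_on linear_conv_bounded_linear borel_measurable_continuous_onI)
  have bij: "bij A" using A(2) by (rule involuntory_imp_bij)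
  define c where "c = emeasure (distr lborel borel A) (ball 0 1) / emeasure lborel (ball (0::'a) 1)"
  have d: "distr lborel borel A = density lborel (\<lambda>_. c)"
    unfolding c_def by (rule distr_lborel_linear[OF A(1) bij])
  have "distr (distr lborel borel A) borel A = lborel"
    by (simp add: distr_distr o_def A(2) distr_id2)
  then have "emeasure lborel (ball (0::'a) 1) = emeasure (distr (density lborel (\<lambda>_. c)) borel A) (ball 0 1)"
    by (simp add: d)
  also have "\<dots> = c * emeasure (distr lborel borel A) (ball 0 1)"
  proof -
    have [simp]: "A -` ball 0 1 \<in> sets borel"
      using measurable_sets_borel[of A borel "ball 0 1"] by simp
    have "emeasure (distr (density lborel (\<lambda>_. c)) borel A) (ball 0 1) = emeasure (density lborel (\<lambda>_. c)) (A -` ball 0 1)"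
      by (subst emeasure_distr) auto
    also have "\<dots> = c * emeasure lborel (A -` ball 0 1)"
      by (subst emeasure_density_const) auto
    finally show ?thesis by (subst (2) emeasure_distr) auto
  qed
  also have "\<dots> = c * c * emeasure lborel (ball (0::'a) 1)"
    by (simp add: d emeasure_density_const mult.assoc)
  finally have "c * c = 1"
  proof -
    assume e: "emeasure lborel (ball (0::'a) 1) = c * c * emeasure lborel (ball (0::'a) 1)"
    have "emeasure lborel (ball (0::'a) 1) / emeasure lborel (ball (0::'a) 1) =
      c * c * emeasure lborel (ball (0::'a) 1) / emeasure lborel (ball (0::'a) 1)"
      using arg_cong[OF e, of "\<lambda>t. t / emeasure lborel (ball (0::'a) 1)"] .
    then show ?thesis
      using emeasure_unit_ball[where 'a='a] by (simp add: ennreal_mult_divide_eq ennreal_divide_self less_top)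
  qed
  then have "c = 1"
  proof (cases c)
    case (real r)
    with \<open>c * c = 1\<close> have "ennreal (r * r) = ennreal 1" by (simp add: ennreal_mult)
    then have "r * r = 1" using real by (subst (asm) ennreal_inj) auto
    then have "r = 1" using real by (metis abs_of_nonneg real_sqrt_abs2 real_sqrt_one)
    then show ?thesis using real by simp
  qed (auto simp: ennreal_top_mult)
  then show ?thesis using d by (simp add: density_1)
qed

subsection \<open>The form and the action on the ball\<close>

lemma sum_UNIV_option:
  fixes f :: "'n::finite option \<Rightarrow> 'a::comm_monoid_add"
  shows "sum f UNIV = f None + (\<Sum>i\<in>UNIV. f (Some i))"
  by (simp add: UNIV_option_conv sum.insert sum.reindex)

lemma norm_sq_vec: "(norm (z :: complex^'k::finite))\<^sup>2 = (\<Sum>i\<in>UNIV. (cmod (z $ i))\<^sup>2)"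
  by (simp add: norm_vec_def L2_set_def sum_nonneg)

lemma norm_vec_smult: "norm (c *s (z :: complex^'k::finite)) = cmod c * norm z"
proof -
  have "(norm (c *s z))\<^sup>2 = (cmod c * norm z)\<^sup>2"
    by (simp add: norm_sq_vec norm_mult power_mult_distrib sum_distrib_left)
  then show ?thesis by (simp add: power2_eq_iff_nonneg)
qed

lemma scaleR_eq_smult: "r *\<^sub>R (z :: complex^'k::finite) = of_real r *s z"
  by (vector scaleR_conv_of_real)

lemma herm_form_add_left: "herm_form (x + y) z = herm_form x z + herm_form y z"
  by (simp add: herm_form_def algebra_simps sum.distrib)

lemma herm_form_add_right: "herm_form z (x + y) = herm_form z x + herm_form z y"
  by (simp add: herm_form_def algebra_simps sum.distrib)

lemma herm_form_diff_left: "herm_form (x - y) z = herm_form x z - herm_form y z"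
  by (simp add: herm_form_def algebra_simps sum_subtractf)

lemma herm_form_diff_right: "herm_form z (x - y) = herm_form z x - herm_form z y"
  by (simp add: herm_form_def algebra_simps sum_subtractf)

lemma herm_form_smult_left: "herm_form (c *s x) y = c * herm_form x y"
  by (simp add: herm_form_def algebra_simps sum_distrib_left)

lemma herm_form_smult_right: "herm_form x (c *s y) = cnj c * herm_form x y"
  by (simp add: herm_form_def algebra_simps sum_distrib_left)

lemma herm_form_cnj: "cnj (herm_form x y) = herm_form y x"
  by (simp add: herm_form_def algebra_simps)

lemma herm_form_zero [simp]: "herm_form 0 x = 0" "herm_form x 0 = 0"
  by (simp_all add: herm_form_def)

lemmas herm_form_simps = herm_form_add_left herm_form_add_right herm_form_diff_left herm_form_diff_right
  herm_form_smult_left herm_form_smult_right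

definition hquad :: "complex^('n::finite option) \<Rightarrow> real" where
  "hquad x = (cmod (x $ None))\<^sup>2 - (\<Sum>i\<in>UNIV. (cmod (x $ Some i))\<^sup>2)"

lemma herm_form_self: "herm_form x x = of_real (hquad x)"
  by (simp add: herm_form_def hquad_def complex_norm_square del: of_real_power)

lemma hquad_smult: "hquad (c *s x) = (cmod c)\<^sup>2 * hquad x"
  by (simp add: hquad_def norm_mult power_mult_distrib sum_distrib_left right_diff_distrib)

lemma herm_form_nondegenerate:
  assumes "\<And>y. herm_form x y = 0"
  shows "x = 0"
proof -
  have "x $ k = 0" for k
    using assms[of "axis k 1"]
    by (cases k) (auto simp: herm_form_def axis_def if_distrib cong: if_cong)
  then show ?thesis by (simp add: vec_eq_iff)
qed

text \<open>Consequently a map which preserves the form and the modulus of the last coordinate is a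
  Euclidean isometry.\<close>

lemma norm_sq_option: "(norm (x :: complex^('n::finite option)))\<^sup>2 = 2 * (cmod (x $ None))\<^sup>2 - hquad x"
  by (simp add: norm_sq_vec hquad_def sum_UNIV_option)

text \<open>The group \<open>U(n,1)\<close>. The matrices constructed later come from Gram matrix
  arguments, which leave the determinant open; they reach \<open>SU_n1\<close> only after
  multiplication by a scalar.\<close>

definition form_unitary :: "complex^('n::finite option)^('n option) \<Rightarrow> bool" where
  "form_unitary A \<longleftrightarrow> (\<forall>z w. herm_form (A *v z) (A *v w) = herm_form z w)"

lemma form_unitary_hquad: "form_unitary A \<Longrightarrow> hquad (A *v x) = hquad x"
  using herm_form_self[of "A *v x"] herm_form_self[of x] by (simp add: form_unitary_def)

lemma form_unitary_inverse:
  assumes "form_unitary A"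
  obtains B where "A ** B = mat 1" "B ** A = mat 1" "form_unitary B"
proof -
  have "inj ((*v) A)"
  proof (rule injI)
    fix x y assume "A *v x = A *v y"
    then have "herm_form (x - y) z = 0" for z
      using assms unfolding form_unitary_def
      by (metis herm_form_zero(1) matrix_vector_mult_diff_distrib right_minus_eq)
    then show "x = y" using herm_form_nondegenerate by (metis right_minus_eq)
  qed
  then obtain B where B: "B ** A = mat 1"
    using matrix_left_invertible_injective by blast
  then have B': "A ** B = mat 1" by (simp add: matrix_left_right_inverse)
  have "form_unitary B"
    unfolding form_unitary_def
  proof (intro allI)
    fix z w
    have "herm_form (A *v (B *v z)) (A *v (B *v w)) = herm_form (B *v z) (B *v w)"
      using assms by (simp add: form_unitary_def)
    then show "herm_form (B *v z) (B *v w) = herm_form z w"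
      by (simp add: matrix_vector_mul_assoc B')
  qed
  with B B' show ?thesis using that by blast
qed

lemma form_unitary_mult: "form_unitary A \<Longrightarrow> form_unitary B \<Longrightarrow> form_unitary (A ** B)"
  by (simp add: form_unitary_def matrix_vector_mul_assoc[symmetric])

lemma form_unitary_one: "form_unitary (mat 1)"
  by (simp add: form_unitary_def)

text \<open>Homogeneous coordinates: the ball is the set of complex lines on which the form is
  positive, and the fractional linear action is the action of matrices on these lines.\<close>

definition hlift :: "complex^'n::finite \<Rightarrow> complex^('n option)" where
  "hlift z = (\<chi> k. case k of None \<Rightarrow> 1 | Some i \<Rightarrow> z $ i)"

definition hproj :: "complex^('n::finite option) \<Rightarrow> complex^'n" where
  "hproj x = (\<chi> i. x $ Some i / x $ None)"

lemma hlift_nth [simp]: "hlift z $ None = 1" "hlift z $ Some i = z $ i"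
  by (simp_all add: hlift_def)

lemma hproj_hlift [simp]: "hproj (hlift z) = z"
  by (simp add: hproj_def vec_eq_iff)

lemma hlift_hproj: "x $ None \<noteq> 0 \<Longrightarrow> x = (x $ None) *s hlift (hproj x)"
  by (auto simp: vec_eq_iff hproj_def hlift_def split: option.splits)

lemma hproj_smult: "c \<noteq> 0 \<Longrightarrow> hproj (c *s x) = hproj x"
  by (simp add: hproj_def vec_eq_iff)

lemma hquad_hlift: "hquad (hlift z) = 1 - (norm z)\<^sup>2"
  by (simp add: hquad_def norm_sq_vec)

lemma hquad_hlift_pos: "hquad (hlift z) > 0 \<longleftrightarrow> z \<in> ball 0 1"
  by (simp add: hquad_hlift power_less_one_iff abs_square_less_1)

lemma hquad_pos_nonzero: "hquad x > 0 \<Longrightarrow> x $ None \<noteq> 0"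
  using sum_nonneg[of UNIV "\<lambda>i. (cmod (x $ Some i))\<^sup>2"] by (auto simp: hquad_def)

lemma hquad_hproj: "hquad x > 0 \<Longrightarrow> hproj x \<in> ball 0 1"
  by (metis hlift_hproj hquad_hlift_pos hquad_pos_nonzero hquad_smult norm_eq_zero
      zero_less_mult_pos zero_less_norm_iff zero_less_power)

lemma aut_denom_hlift: "aut_denom A z = (A *v hlift z) $ None"
  by (simp add: aut_denom_def matrix_vector_mult_def sum_UNIV_option add.commute)

lemma ball_action_hlift: "ball_action A z = hproj (A *v hlift z)"
  unfolding ball_action_def hproj_def aut_denom_hlift
  by (simp add: matrix_vector_mult_def sum_UNIV_option add.commute)

lemma aut_denom_nonzero: "form_unitary A \<Longrightarrow> z \<in> ball 0 1 \<Longrightarrow> aut_denom A z \<noteq> 0"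
  by (metis aut_denom_hlift form_unitary_hquad hquad_hlift_pos hquad_pos_nonzero)

lemma ball_action_in_ball: "form_unitary A \<Longrightarrow> z \<in> ball 0 1 \<Longrightarrow> ball_action A z \<in> ball 0 1"
  by (metis ball_action_hlift form_unitary_hquad hquad_hlift_pos hquad_hproj)

lemma hlift_ball_action:
  "aut_denom A z \<noteq> 0 \<Longrightarrow> A *v hlift z = aut_denom A z *s hlift (ball_action A z)"
  unfolding aut_denom_hlift ball_action_hlift by (rule hlift_hproj)

text \<open>The cocycle identity and the action law are the last coordinate and the line of one
  vector, the product applied to \<open>hlift z\<close>.\<close>

lemma
  assumes "aut_denom B z \<noteq> 0"
  shows aut_denom_mult: "aut_denom (A ** B) z = aut_denom A (ball_action B z) * aut_denom B z"
    and ball_action_mult: "ball_action (A ** B) z = ball_action A (ball_action B z)"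
proof -
  have eq: "(A ** B) *v hlift z = aut_denom B z *s (A *v hlift (ball_action B z))"
    using hlift_ball_action[OF assms]
    by (metis matrix_vector_mul_assoc vector_scalar_commute)
  show "aut_denom (A ** B) z = aut_denom A (ball_action B z) * aut_denom B z"
    by (simp add: aut_denom_hlift[of "A ** B"] aut_denom_hlift[of A] eq)
  show "ball_action (A ** B) z = ball_action A (ball_action B z)"
    by (simp add: ball_action_hlift[of "A ** B"] ball_action_hlift[of A] eq hproj_smult assms)
qed

lemma aut_denom_one [simp]: "aut_denom (mat 1) z = 1"
  by (simp add: aut_denom_hlift)

lemma ball_action_one [simp]: "ball_action (mat 1) z = z"
  by (simp add: ball_action_hlift)

text \<open>A form-preserving matrix is the composition of a form reflection and a map which fixes the
  line of the last basis vector, and hence preserves the Euclidean norm.\<close>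

lemma distr_lborel_form_unitary:
  assumes "form_unitary (A :: complex^('n::finite option)^('n option))"
  shows "distr lborel borel ((*v) A) = lborel"
proof -
  define e where "e = (axis None 1 :: complex^('n option))"
  define w where "w = A *v e"
  have e_None: "e $ None = 1" and form_e: "herm_form x e = x $ None" for x
    by (simp_all add: e_def herm_form_def axis_def)
  have qw: "herm_form w w = 1"
    using assms form_e[of e] e_None by (simp add: w_def form_unitary_def)
  then have "(cmod (w $ None))\<^sup>2 - (\<Sum>i\<in>UNIV. (cmod (w $ Some i))\<^sup>2) = 1"
    by (metis herm_form_self hquad_def of_real_eq_1_iff)
  moreover have "(\<Sum>i\<in>UNIV. (cmod (w $ Some i))\<^sup>2) \<ge> 0" by (simp add: sum_nonneg)
  ultimately have "(cmod (w $ None))\<^sup>2 > 0" by linarith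
  then have w0: "cmod (w $ None) > 0" by simp
  \<comment> \<open>The vectors \<open>w\<close> and \<open>\<theta> *s e\<close> both have form
    value 1 and a real product, so the reflection along their difference \<open>u\<close> exchanges
    them. This phase gives \<open>herm_form u u = 2 + 2 * r\<close>, which is never zero; the
    opposite phase would give \<open>2 - 2 * r\<close>, which vanishes for
    \<open>r = 1\<close>.\<close>
  define \<theta> where "\<theta> = - (w $ None / of_real (cmod (w $ None)))"
  have cmod_th: "cmod \<theta> = 1" using w0 by (simp add: \<theta>_def norm_divide)
  then have th1: "\<theta> * cnj \<theta> = 1" by (simp add: complex_norm_square[symmetric])
  define r where "r = complex_of_real (cmod (w $ None))"
  have r0: "r \<noteq> 0" and rr: "cnj r = r" using w0 by (auto simp: r_def)
  have wth: "w $ None = - r * \<theta>" using r0 by (simp add: \<theta>_def r_def)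
  define u where "u = w - \<theta> *s e"
  have we: "herm_form w e = - r * \<theta>" "herm_form e w = - r * cnj \<theta>" "herm_form e e = 1"
    using wth form_e[of w] form_e[of e] e_None herm_form_cnj[of w e] by (simp_all add: rr)
  have uu: "herm_form u u = 2 + 2 * r"
    using th1 by (simp add: u_def herm_form_simps qw we algebra_simps)
  have wu: "herm_form w u = 1 + r"
    using th1 by (simp add: u_def herm_form_simps qw we algebra_simps)
  have r1: "1 + r \<noteq> 0"
  proof
    assume "1 + r = 0"
    then have "1 + cmod (w $ None) = 0"
      unfolding r_def by (metis of_real_1 of_real_add of_real_eq_0_iff)
    with w0 show False by linarith
  qed
  define R where "R x = x - (herm_form x u / (1 + r)) *s u" for x
  have uu': "herm_form u u = 2 * (1 + r)" using uu by (simp add: algebra_simps)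
  have Ru: "herm_form (R x) u = - herm_form x u" for x
    unfolding R_def herm_form_simps uu' using r1 by (simp add: field_simps)
  have RR: "R (R x) = x" for x
    unfolding R_def[of "R x"] Ru by (simp add: R_def)
  have Rform: "herm_form (R x) (R y) = herm_form x y" for x y
  proof -
    have "herm_form (R x) (R y) = herm_form (R x) y - cnj (herm_form y u / (1 + r)) * herm_form (R x) u"
      by (simp add: R_def[of y] herm_form_simps)
    also have "\<dots> = herm_form x y - herm_form x u / (1 + r) * herm_form u y + herm_form u y / (1 + r) * herm_form x u"
      unfolding Ru by (simp add: R_def herm_form_simps rr herm_form_cnj)
    finally show ?thesis by simp
  qed
  have Rw: "R w = \<theta> *s e"
    unfolding R_def wu using r1 by (simp add: u_def)
  have Rlin: "linear R"
    by (rule linearI) (simp_all add: R_def herm_form_simps scaleR_eq_smult vec_eq_iff algebra_simps add_divide_distrib)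
  define B where "B x = R (A *v x)" for x
  have Blin: "linear B"
    unfolding B_def using linear_compose[OF matrix_vector_mul_linear Rlin, of A] by (simp add: o_def)
  have Bform: "herm_form (B x) (B y) = herm_form x y" for x y
    using assms by (simp add: B_def Rform form_unitary_def)
  have Be: "B e = \<theta> *s e" by (simp add: B_def Rw flip: w_def)
  have Bnorm: "norm (B x) = norm x" for x
  proof -
    have "herm_form (B x) (\<theta> *s e) = x $ None" using Bform[of x e] by (simp add: Be form_e)
    then have "cnj \<theta> * B x $ None = x $ None" by (simp add: herm_form_simps form_e)
    then have "cmod (B x $ None) = cmod (x $ None)" using cmod_th by (metis complex_mod_cnj mult_1 norm_mult)
    moreover have "hquad (B x) = hquad x"
      using Bform[of x x] by (simp add: herm_form_self)
    ultimately have "(norm (B x))\<^sup>2 = (norm x)\<^sup>2" by (simp add: norm_sq_option)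
    then show ?thesis by simp
  qed
  have [measurable]: "R \<in> borel_measurable borel" "B \<in> borel_measurable borel"
    using Rlin Blin by (simp_all add: linear_continuous_on linear_conv_bounded_linear borel_measurable_continuous_onI)
  have "(*v) A = R \<circ> B" by (simp add: fun_eq_iff B_def RR)
  then have "distr lborel borel ((*v) A) = distr (distr lborel borel B) borel R"
    by (simp add: distr_distr)
  then show ?thesis
    by (simp add: distr_lborel_isometry[OF Blin Bnorm] distr_lborel_involution[OF Rlin RR])
qed

subsection \<open>The weighted measures as measures on the Borel sets\<close>

lemma borel_measurable_vecI:
  fixes f :: "'a \<Rightarrow> complex^'k::finite"
  assumes "\<And>i. (\<lambda>x. f x $ i) \<in> borel_measurable M"
  shows "f \<in> borel_measurable M"
proof (rule borel_measurable_euclidean_space[THEN iffD2], rule ballI)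
  fix b :: "complex^'k" assume "b \<in> Basis"
  then obtain i u where "b = axis i u" by (auto simp: Basis_vec_def)
  then show "(\<lambda>x. f x \<bullet> b) \<in> borel_measurable M"
    using assms[of i] by (simp add: inner_axis borel_measurable_inner)
qed

lemma borel_measurable_vec_nth [measurable]:
  "(\<lambda>x::complex^'k::finite. x $ i) \<in> borel_measurable borel"
  by (intro borel_measurable_continuous_onI continuous_intros)

lemma ball_in_borel [measurable]: "ball (x::'a::metric_space) r \<in> sets borel"
  by simp

lemma borel_measurable_smult [measurable]: "(\<lambda>y::complex^'k::finite. c *s y) \<in> borel_measurable borel"
  by (rule borel_measurable_vecI) simp

lemma borel_measurable_hquad [measurable]: "hquad \<in> borel_measurable borel"
  unfolding hquad_def by measurable

lemma borel_measurable_hproj [measurable]: "hproj \<in> borel_measurable borel"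
  by (rule borel_measurable_vecI) (simp add: hproj_def)

lemma borel_measurable_hlift [measurable]: "hlift \<in> borel_measurable borel"
proof (rule borel_measurable_vecI)
  fix i show "(\<lambda>x::complex^'n. hlift x $ i) \<in> borel_measurable borel"
    by (cases i) simp_all
qed

lemma borel_measurable_mult_vec [measurable]: "(*v) (A :: complex^'k::finite^'m::finite) \<in> borel_measurable borel"
  by (intro borel_measurable_continuous_onI matrix_vector_mult_linear_continuous_on)

lemma borel_measurable_aut_denom [measurable]: "aut_denom A \<in> borel_measurable borel"
  unfolding aut_denom_hlift by measurable

lemma borel_measurable_ball_action [measurable]: "ball_action A \<in> borel_measurable borel"
  unfolding ball_action_hlift by measurable

definition bweight :: "real \<Rightarrow> complex^'n::finite \<Rightarrow> real" where
  "bweight lam z = indicator (ball 0 1) z * (1 - (norm z)\<^sup>2) powr (lam - real CARD('n) - 1)"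

lemma bweight_nonneg [simp]: "bweight lam z \<ge> 0"
  by (simp add: bweight_def)

lemma borel_measurable_bweight [measurable]: "(bweight lam :: complex^'n::finite \<Rightarrow> real) \<in> borel_measurable borel"
proof -
  have [measurable]: "ball (0::complex^'n) 1 \<in> sets borel" by simp
  show ?thesis unfolding bweight_def[abs_def] by measurable
qed

text \<open>\<open>bergman_measure\<close> lives on the Lebesgue measurable subsets of the ball. Its
  image under the identity is a Borel measure on the whole space with the same integrals of Borel
  functions, so the completion and the restriction disappear from later arguments.\<close>

definition bmeas :: "real \<Rightarrow> (complex^'n::finite) measure" where
  "bmeas lam = distr (bergman_measure lam) borel (\<lambda>z. z)"

lemma sets_bmeas [simp, measurable_cong]: "sets (bmeas lam) = sets borel"
  and space_bmeas [simp]: "space (bmeas lam) = UNIV"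
  by (simp_all add: bmeas_def)

lemma sets_ball_volume: "sets ball_volume = sets (lebesgue_on (ball 0 1))"
  by (simp add: ball_volume_def)

lemma borel_measurable_ball_volume:
  "f \<in> borel_measurable borel \<Longrightarrow> f \<in> borel_measurable ball_volume"
  unfolding measurable_cong_sets[OF sets_ball_volume refl]
  by (intro measurable_restrict_space1) (simp add: measurable_completion)

lemma borel_measurable_bergman:
  "f \<in> borel_measurable borel \<Longrightarrow> f \<in> borel_measurable (bergman_measure lam)"
  unfolding bergman_measure_def using borel_measurable_ball_volume by simp

text \<open>The normalising constants are collected in \<open>\<kappa>\<close>; what later arguments
  use of them is at most that \<open>\<kappa>\<close> is positive and finite.\<close>

lemma nn_integral_bmeas_exists:
  assumes "lam > real CARD('n::finite)"
  obtains \<kappa> where "0 < \<kappa>" "\<And>f :: complex^'n \<Rightarrow> ennreal. f \<in> borel_measurable borel \<Longrightarrow>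
    (\<integral>\<^sup>+ z. f z \<partial>bmeas lam) = ennreal \<kappa> * (\<integral>\<^sup>+ z. ennreal (bweight lam z) * f z \<partial>lborel)"
proof -
  define c where "c = Gamma lam / (fact CARD('n) * Gamma (lam - real CARD('n)))"
  have "c > 0" using assms by (auto simp: c_def intro!: divide_pos_pos mult_pos_pos Gamma_real_pos)
  let ?B = "ball (0::complex^'n) 1"
  obtain v where v: "v > 0" "emeasure lborel ?B = ennreal v"
    using emeasure_unit_ball[where 'a="complex^'n"]
    by (metis ennreal_cases ennreal_0 infinity_ennreal_def le_less)
  show thesis
  proof (rule that[of "c / v"])
    show "0 < c / v" using v \<open>c > 0\<close> by simp
    fix f :: "complex^'n \<Rightarrow> ennreal" assume [measurable]: "f \<in> borel_measurable borel"
    let ?w = "\<lambda>z::complex^'n. (1 - (norm z)\<^sup>2) powr (lam - real CARD('n) - 1)"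
    have em: "emeasure (lebesgue_on ?B) ?B = ennreal v"
      using v by (simp add: emeasure_restrict_space)
    have "(\<integral>\<^sup>+ z. f z \<partial>bmeas lam) = (\<integral>\<^sup>+ z. f z \<partial>bergman_measure lam)"
      unfolding bmeas_def by (subst nn_integral_distr) (auto intro: borel_measurable_bergman)
    also have "\<dots> = (\<integral>\<^sup>+ z. ennreal (c * ?w z) * f z \<partial>ball_volume)"
      unfolding bergman_measure_def c_def
      by (rule nn_integral_density) (auto intro!: borel_measurable_ball_volume)
    also have "\<dots> = (\<integral>\<^sup>+ z. ennreal (c * ?w z) * f z * indicator ?B z \<partial>lebesgue_on ?B) / ennreal v"
      unfolding ball_volume_def em[symmetric]
      by (rule nn_integral_uniform_measure)
        (use v em in \<open>auto intro!: borel_measurable_ball_volume[unfolded measurable_cong_sets[OF sets_ball_volume refl]] simp: sets_restrict_space_iff\<close>)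
    also have "(\<integral>\<^sup>+ z. ennreal (c * ?w z) * f z * indicator ?B z \<partial>lebesgue_on ?B)
        = (\<integral>\<^sup>+ z. ennreal (c * ?w z) * f z * indicator ?B z * indicator ?B z \<partial>lborel)"
      by (subst nn_integral_restrict_space) (auto simp: nn_integral_completion)
    also have "\<dots> = (\<integral>\<^sup>+ z. ennreal c * (ennreal (bweight lam z) * f z) \<partial>lborel)"
      using \<open>c > 0\<close>
      by (intro nn_integral_cong) (auto simp: bweight_def indicator_def ennreal_mult mult.assoc)
    also have "\<dots> = ennreal c * (\<integral>\<^sup>+ z. ennreal (bweight lam z) * f z \<partial>lborel)"
      by (rule nn_integral_cmult) measurable
    also have "ennreal c * (\<integral>\<^sup>+ z. ennreal (bweight lam z) * f z \<partial>lborel) / ennreal v =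
       ennreal (c / v) * (\<integral>\<^sup>+ z. ennreal (bweight lam z) * f z \<partial>lborel)"
    proof -
      have "ennreal (c / v) = ennreal c / ennreal v" using v \<open>c > 0\<close> by (simp add: divide_ennreal)
      then show ?thesis by (metis ennreal_times_divide mult.commute)
    qed
    finally show "(\<integral>\<^sup>+ z. f z \<partial>bmeas lam) = ennreal (c / v) * (\<integral>\<^sup>+ z. ennreal (bweight lam z) * f z \<partial>lborel)" .
  qed
qed

text \<open>The cone over the ball carries the invariant Lebesgue measure; integrating functions which are
  homogeneous of degree \<open>- 2 lam\<close> over the shell where the form lies in \<open>[1, 2]\<close> gives the weighted
  measure on the ball. Thus only linear changes of variables are required.\<close>

definition shell_integral :: "real \<Rightarrow> (complex^'n::finite \<Rightarrow> ennreal) \<Rightarrow> ennreal" where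
  "shell_integral lam f = (\<integral>\<^sup>+ x. f (hproj x) * ennreal (cmod (x $ None) powr (- 2 * lam)) *
     indicator {1..2} (hquad x) \<partial>lborel)"

text \<open>Multiplication by \<open>A\<close> preserves Lebesgue measure and the shell, and it
  multiplies the last coordinate of \<open>x\<close> by \<open>aut_denom A (hproj x)\<close>. The
  homogeneous factor of the shell integral turns this into the automorphy factor.\<close>

lemma shell_integral_ball_action:
  assumes A: "form_unitary (A :: complex^('n::finite option)^('n option))"
    and [measurable]: "f \<in> borel_measurable borel"
  shows "shell_integral lam (\<lambda>z. f (ball_action A z) * ennreal (cmod (aut_denom A z) powr (- 2 * lam)))
    = shell_integral lam f"
proof -
  let ?F = "\<lambda>x::complex^('n option). f (hproj x) * ennreal (cmod (x $ None) powr (- 2 * lam)) * indicator {1..2} (hquad x)"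
  have "f (ball_action A (hproj x)) * ennreal (cmod (aut_denom A (hproj x)) powr (- 2 * lam)) *
      ennreal (cmod (x $ None) powr (- 2 * lam)) * indicator {1..2} (hquad x) = ?F (A *v x)" for x
  proof (cases "hquad x > 0")
    case True
    then have x0: "x $ None \<noteq> 0" by (rule hquad_pos_nonzero)
    have "A *v x = x $ None *s (A *v hlift (hproj x))"
      using hlift_hproj[OF x0] by (metis vector_scalar_commute)
    then have "hproj (A *v x) = ball_action A (hproj x)" "(A *v x) $ None = x $ None * aut_denom A (hproj x)"
      using x0 by (simp_all add: hproj_smult ball_action_hlift aut_denom_hlift)
    then show ?thesis
      by (simp add: form_unitary_hquad[OF A] norm_mult powr_mult ennreal_mult mult_ac)
  next
    case False
    then show ?thesis by (simp add: form_unitary_hquad[OF A] indicator_def)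
  qed
  then have "shell_integral lam (\<lambda>z. f (ball_action A z) * ennreal (cmod (aut_denom A z) powr (- 2 * lam)))
      = (\<integral>\<^sup>+ x. ?F (A *v x) \<partial>lborel)"
    by (simp add: shell_integral_def mult.assoc)
  also have "\<dots> = (\<integral>\<^sup>+ x. ?F x \<partial>distr lborel borel ((*v) A))"
    by (subst nn_integral_distr) measurable
  also have "\<dots> = shell_integral lam f"
    by (simp add: distr_lborel_form_unitary[OF A] shell_integral_def)
  finally show ?thesis .
qed

section \<open>Evaluation of the shell integral\<close>

lemma linear_smult_left: "linear (\<lambda>y::complex^'k::finite. c *s y)"
  by (rule linearI) (simp_all add: scaleR_eq_smult vec_eq_iff algebra_simps)

lemma annulus_integral:
  fixes a :: real
  assumes "a \<ge> 0"
  defines "K \<equiv> (\<integral>\<^sup>+ s. ennreal (cmod s powr (- a)) * indicator {1..2} ((cmod s)\<^sup>2) \<partial>lborel)"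
  shows "K \<noteq> 0" "K \<noteq> \<infinity>"
proof -
  have "K \<le> (\<integral>\<^sup>+ s. indicator (cball (0::complex) 2) s \<partial>lborel)"
    unfolding K_def
  proof (rule nn_integral_mono)
    fix s :: complex
    show "ennreal (cmod s powr (- a)) * indicator {1..2} ((cmod s)\<^sup>2) \<le> indicator (cball 0 2) s"
    proof (cases "(cmod s)\<^sup>2 \<in> {1..2}")
      case True
      then have "1 \<le> cmod s" "cmod s \<le> 2"
        using abs_le_square_iff[of 1 "cmod s"] power2_le_imp_le[of "cmod s" 2] by auto
      then show ?thesis
        using True assms(1) powr_mono[of "-a" 0 "cmod s"] by (auto simp: indicator_def split: if_splits)
    qed simp
  qed
  also have "\<dots> < \<infinity>" using emeasure_lborel_cball_finite[of "0::complex" 2] by simp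
  finally show "K \<noteq> \<infinity>" by simp
  \<comment> \<open>On this ball \<open>cmod s\<close> lies between 11/10 and 13/10, whose squares
    lie in \<open>{1..2}\<close>; there the integrand is at least \<open>2 powr (- a)\<close>
    because \<open>cmod s \<le> 2\<close>.\<close>
  have "0 < ennreal (2 powr (- a)) * emeasure lborel (ball (6/5::complex) (1/10))"
  proof -
    have "ennreal (2 powr (- a)) > 0" by simp
    moreover have "emeasure lborel (ball (6/5::complex) (1/10)) > 0"
      by (simp add: emeasure_ball ennreal_zero_less_mult_iff)
    ultimately show ?thesis by (simp add: ennreal_zero_less_mult_iff)
  qed
  also have "\<dots> = (\<integral>\<^sup>+ s. ennreal (2 powr (- a)) * indicator (ball (6/5::complex) (1/10)) s \<partial>lborel)"
    by (subst nn_integral_cmult[OF borel_measurable_indicator]) simp_all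
  also have "\<dots> \<le> K"
    unfolding K_def
  proof (rule nn_integral_mono)
    fix s :: complex
    show "ennreal (2 powr (- a)) * indicator (ball (6/5) (1/10)) s \<le> ennreal (cmod s powr (- a)) * indicator {1..2} ((cmod s)\<^sup>2)"
    proof (cases "s \<in> ball (6/5) (1/10)")
      case True
      have n: "cmod (6/5) = 6/5" by simp
      have "cmod (6/5 - s) < 1/10" using True by (simp add: dist_norm)
      then have "11/10 \<le> cmod s" "cmod s \<le> 13/10"
        using norm_triangle_ineq2[of "6/5" s] norm_triangle_ineq3[of "6/5" s] n
        by linarith+
      then have "(11/10)\<^sup>2 \<le> (cmod s)\<^sup>2" "(cmod s)\<^sup>2 \<le> (13/10)\<^sup>2"
        by (intro power_mono; simp)+
      then have "(cmod s)\<^sup>2 \<in> {1..2}" by (simp add: power2_eq_square)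
      moreover have "2 powr (- a) \<le> cmod s powr (- a)"
        using \<open>11/10 \<le> cmod s\<close> \<open>cmod s \<le> 13/10\<close> assms(1) by (intro powr_mono2') auto
      ultimately show ?thesis using True by (simp add: ennreal_leI)
    qed simp
  qed
  finally show "K \<noteq> 0" by simp
qed

text \<open>In the coordinates \<open>(s *s z, s)\<close> the Jacobian is
  \<open>cmod s ^ (2 * n)\<close>, which leaves the power \<open>- a\<close> of
  \<open>cmod s\<close> with \<open>a = 2 * lam - 2 * n\<close>. For fixed \<open>z\<close> in the
  ball put \<open>t = 1 - (norm z)\<^sup>2\<close>. Rescaling \<open>s\<close> by
  \<open>1 / sqrt t\<close> makes the shell condition independent of \<open>z\<close> and produces
  the factor \<open>t powr ((a - 2) / 2)\<close>, whose exponent \<open>lam - n - 1\<close> is that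
  of the weight.\<close>

lemma shell_integral_eq:
  assumes lam: "lam > real CARD('n::finite)"
  obtains k where "k \<noteq> 0" "k \<noteq> \<infinity>"
    "\<And>f :: complex^'n \<Rightarrow> ennreal. f \<in> borel_measurable borel \<Longrightarrow>
      shell_integral lam f = k * (\<integral>\<^sup>+ z. ennreal (bweight lam z) * f z \<partial>lborel)"
proof -
  define N where "N = CARD('n)"
  define T :: "(complex^'n) \<times> complex \<Rightarrow> complex^('n option)"
    where "T = (\<lambda>(y, s). (\<chi> k. case k of None \<Rightarrow> s | Some i \<Rightarrow> y $ i))"
  have T_nth [simp]: "T (y, s) $ None = s" "T (y, s) $ Some i = y $ i" for y s i
    by (simp_all add: T_def)
  have Tlin: "linear T"
    by (rule linearI) (auto simp: T_def vec_eq_iff split: option.splits)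
  have Tbij: "bij T"
  proof (rule bijI)
    show "inj T" by (rule injI) (auto simp: vec_eq_iff, metis T_nth, metis T_nth)
    show "surj T"
    proof (rule surjI)
      fix x show "T ((\<chi> i. x $ Some i), x $ None) = x"
        by (auto simp: T_def vec_eq_iff split: option.splits)
    qed
  qed
  have Tnorm: "norm (T x) = norm x" for x
  proof (cases x)
    case (Pair y s)
    have "(norm (T x))\<^sup>2 = (norm x)\<^sup>2"
      by (simp add: Pair norm_sq_vec sum_UNIV_option norm_Pair sum_nonneg)
    then show ?thesis by simp
  qed
  have Tmeas [measurable]: "T \<in> borel_measurable borel"
    using Tlin by (simp add: linear_continuous_on linear_conv_bounded_linear borel_measurable_continuous_onI)
  define c where "c = emeasure (distr lborel borel T) (ball 0 1) / emeasure lborel (ball (0::complex^('n option)) 1)"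
  have "T -` ball 0 1 = ball 0 1" by (auto simp: Tnorm)
  then have c: "c = emeasure lborel (ball (0::(complex^'n) \<times> complex) 1) / emeasure lborel (ball (0::complex^('n option)) 1)"
    by (simp add: c_def emeasure_distr)
  have c0: "c \<noteq> 0" "c \<noteq> \<infinity>"
    unfolding c using emeasure_unit_ball[where 'a="(complex^'n) \<times> complex"] emeasure_unit_ball[where 'a="complex^('n option)"]
    by (auto simp: ennreal_divide_eq_top_iff less_top[symmetric] ennreal_divide_eq_0_iff)
  have dT: "distr lborel borel T = density lborel (\<lambda>_. c)"
    unfolding c_def by (rule distr_lborel_linear[OF Tlin Tbij])
  define a where "a = 2 * lam - 2 * real N"
  have a: "a \<ge> 0" using lam by (simp add: a_def N_def)
  define K where "K = (\<integral>\<^sup>+ s. ennreal (cmod s powr (- a)) * indicator {1..2} ((cmod s)\<^sup>2) \<partial>lborel)"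
  note K = annulus_integral[OF a, folded K_def]
  show thesis
  proof (rule that[of "K / c"])
    show "K / c \<noteq> 0" "K / c \<noteq> \<infinity>"
      using K c0 by (auto simp: ennreal_divide_eq_top_iff ennreal_divide_eq_0_iff)
    fix f :: "complex^'n \<Rightarrow> ennreal" assume f[measurable]: "f \<in> borel_measurable borel"
    let ?F = "\<lambda>x. f (hproj x) * ennreal (cmod (x $ None) powr (- 2 * lam)) * indicator {1..2} (hquad x)"
    let ?G = "\<lambda>(z, s). ennreal (cmod s powr (- a)) * indicator {1..2} ((cmod s)\<^sup>2 * (1 - (norm z)\<^sup>2)) * f z"
    have hq: "hquad (T (y, s)) = (cmod s)\<^sup>2 - (norm y)\<^sup>2" for y s
      by (simp add: hquad_def norm_sq_vec)
    have "c * shell_integral lam f = (\<integral>\<^sup>+ x. ?F x \<partial>distr lborel borel T)"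
      unfolding dT shell_integral_def by (simp add: nn_integral_density nn_integral_cmult)
    also have "\<dots> = (\<integral>\<^sup>+ p. ?F (T p) \<partial>(lborel \<Otimes>\<^sub>M lborel))"
      by (subst nn_integral_distr) (auto simp: lborel_prod)
    also have "\<dots> = (\<integral>\<^sup>+ s. \<integral>\<^sup>+ y. ?F (T (y, s)) \<partial>lborel \<partial>lborel)"
      by (rule lborel_pair.nn_integral_snd[symmetric]) (simp add: lborel_prod)
    also have "\<dots> = (\<integral>\<^sup>+ s. \<integral>\<^sup>+ z. ?G (z, s) \<partial>lborel \<partial>lborel)"
    proof (rule nn_integral_cong_AE)
      have "AE s in lborel. s \<noteq> (0::complex)" by (rule AE_lborel_singleton)
      then show "AE s in lborel. (\<integral>\<^sup>+ y. ?F (T (y, s)) \<partial>lborel) = (\<integral>\<^sup>+ z. ?G (z, s) \<partial>lborel)"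
      proof eventually_elim
        case (elim s)
        have meas: "(\<lambda>y. ?F (T (y, s))) \<in> borel_measurable borel"
          by measurable
        have "(\<integral>\<^sup>+ y. ?F (T (y, s)) \<partial>lborel) =
          ennreal (cmod s ^ DIM(complex^'n)) * (\<integral>\<^sup>+ z. ?F (T (s *s z, s)) \<partial>lborel)"
          using nn_integral_similarity[OF linear_smult_left norm_vec_smult _ meas, of s] elim by simp
        also have "\<dots> = (\<integral>\<^sup>+ z. ennreal (cmod s ^ DIM(complex^'n)) * ?F (T (s *s z, s)) \<partial>lborel)"
          by (rule nn_integral_cmult[symmetric]) measurable
        also have "\<dots> = (\<integral>\<^sup>+ z. ?G (z, s) \<partial>lborel)"
        proof (rule nn_integral_cong)
          fix z
          have A: "hproj (T (s *s z, s)) = z" using elim by (simp add: hproj_def vec_eq_iff)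
          have B: "hquad (T (s *s z, s)) = (cmod s)\<^sup>2 * (1 - (norm z)\<^sup>2)"
            by (simp add: hq norm_vec_smult power_mult_distrib algebra_simps)
          have "cmod s ^ DIM(complex^'n) * cmod s powr (- 2 * lam) = cmod s powr (- a)"
            using elim by (simp add: a_def N_def powr_realpow[symmetric] powr_add[symmetric] mult.commute)
          then have C: "ennreal (cmod s ^ DIM(complex^'n)) * ennreal (cmod s powr (- 2 * lam)) = ennreal (cmod s powr (- a))"
            by (simp flip: ennreal_mult)
          have "ennreal (cmod s ^ DIM(complex^'n)) * ?F (T (s *s z, s)) =
            (ennreal (cmod s ^ DIM(complex^'n)) * ennreal (cmod s powr (- 2 * lam))) * indicator {1..2} ((cmod s)\<^sup>2 * (1 - (norm z)\<^sup>2)) * f z"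
            unfolding A B T_nth by (simp only: mult_ac)
          also have "\<dots> = ?G (z, s)" by (simp only: C prod.case)
          finally show "ennreal (cmod s ^ DIM(complex^'n)) * ?F (T (s *s z, s)) = ?G (z, s)" .
        qed
        finally show ?case .
      qed
    qed
    also have "\<dots> = (\<integral>\<^sup>+ z. \<integral>\<^sup>+ s. ?G (z, s) \<partial>lborel \<partial>lborel)"
      by (rule lborel_pair.Fubini') measurable
    also have "\<dots> = (\<integral>\<^sup>+ z. K * (ennreal (bweight lam z) * f z) \<partial>lborel)"
    proof (rule nn_integral_cong)
      fix z :: "complex^'n"
      show "(\<integral>\<^sup>+ s. ?G (z, s) \<partial>lborel) = K * (ennreal (bweight lam z) * f z)"
      proof (cases "z \<in> ball 0 1")
        case False
        then have "(cmod s)\<^sup>2 * (1 - (norm z)\<^sup>2) \<le> 0" for s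
          by (simp add: mult_nonneg_nonpos)
        then have "(cmod s)\<^sup>2 * (1 - (norm z)\<^sup>2) \<notin> {1..2}" for s
          by (metis atLeastAtMost_iff not_one_le_zero order_trans)
        then have "(\<integral>\<^sup>+ s. ?G (z, s) \<partial>lborel) = (\<integral>\<^sup>+ s. 0 \<partial>(lborel :: complex measure))"
          by (intro nn_integral_cong) (simp add: indicator_def)
        then show ?thesis using False by (simp add: bweight_def)
      next
        case True
        define t where "t = 1 - (norm z)\<^sup>2"
        have t: "t > 0" using True hquad_hlift_pos[of z] by (simp add: hquad_hlift t_def)
        define k where "k = 1 / sqrt t"
        have k: "k > 0" "k\<^sup>2 * t = 1" using t by (simp_all add: k_def power_divide)
        have "linear (\<lambda>s::complex. k *\<^sub>R s)" by (rule linearI) (simp_all add: algebra_simps)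
        then have "(\<integral>\<^sup>+ s. ?G (z, s) \<partial>lborel) = ennreal (k ^ DIM(complex)) * (\<integral>\<^sup>+ s. ?G (z, k *\<^sub>R s) \<partial>lborel)"
          by (rule nn_integral_similarity) (use k in auto)
        also have "(\<integral>\<^sup>+ s. ?G (z, k *\<^sub>R s) \<partial>lborel) =
           (\<integral>\<^sup>+ s. ennreal (k powr (- a)) * f z * (ennreal (cmod s powr (- a)) * indicator {1..2} ((cmod s)\<^sup>2)) \<partial>lborel)"
        proof (rule nn_integral_cong)
          fix s :: complex
          have "(k * cmod s)\<^sup>2 * t = (cmod s)\<^sup>2"
            using k(2) by (simp add: power_mult_distrib mult_ac)
          moreover have "(k * cmod s) powr (- a) = k powr (- a) * cmod s powr (- a)"
            using k by (simp add: powr_mult)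
          ultimately show "?G (z, k *\<^sub>R s) = ennreal (k powr (- a)) * f z * (ennreal (cmod s powr (- a)) * indicator {1..2} ((cmod s)\<^sup>2))"
            using k by (simp add: t_def[symmetric] mult_ac ennreal_mult)
        qed
        also have "\<dots> = ennreal (k powr (- a)) * f z * K"
          unfolding K_def by (rule nn_integral_cmult) measurable
        also have "ennreal (k ^ DIM(complex)) * (ennreal (k powr (- a)) * f z * K) =
          ennreal (k powr (2 - a)) * f z * K"
          using k by (simp add: mult.assoc[symmetric] powr_diff powr_minus divide_inverse flip: ennreal_mult)
        also have "k powr (2 - a) = bweight lam z"
        proof -
          have "k = t powr (- (1/2))" using t by (simp add: k_def powr_minus powr_half_sqrt inverse_eq_divide)
          then have "k powr (2 - a) = t powr (- (1/2) * (2 - a))" by (simp add: powr_powr)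
          also have "- (1/2) * (2 - a) = lam - real CARD('n) - 1" by (simp add: a_def N_def field_simps)
          finally show ?thesis using True by (simp add: bweight_def t_def)
        qed
        finally show ?thesis by (simp add: mult_ac)
      qed
    qed
    also have "\<dots> = K * (\<integral>\<^sup>+ z. ennreal (bweight lam z) * f z \<partial>lborel)"
      by (rule nn_integral_cmult) measurable
    finally have "c * shell_integral lam f / c = K * (\<integral>\<^sup>+ z. ennreal (bweight lam z) * f z \<partial>lborel) / c"
      by simp
    moreover have "c * shell_integral lam f / c = shell_integral lam f"
      using c0 by (metis ennreal_mult_divide_eq infinity_ennreal_def mult.commute)
    ultimately show "shell_integral lam f = K / c * (\<integral>\<^sup>+ z. ennreal (bweight lam z) * f z \<partial>lborel)"
      by (metis ennreal_times_divide mult.commute)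
  qed
qed

text \<open>Quasi-invariance of the weighted measure. Both sides are the same finite nonzero
  multiple of shell integrals, so the Jacobian of the fractional linear map never appears.\<close>

theorem nn_integral_ball_action:
  fixes A :: "complex^('n::finite option)^('n option)"
  assumes lam: "lam > real CARD('n)" and A: "form_unitary A"
    and [measurable]: "f \<in> borel_measurable borel"
  shows "(\<integral>\<^sup>+ z. f (ball_action A z) * ennreal (cmod (aut_denom A z) powr (- 2 * lam)) \<partial>bmeas lam)
    = (\<integral>\<^sup>+ z. f z \<partial>bmeas lam)"
proof -
  obtain \<kappa> where \<kappa>: "\<And>f :: complex^'n \<Rightarrow> ennreal. f \<in> borel_measurable borel \<Longrightarrow>
    (\<integral>\<^sup>+ z. f z \<partial>bmeas lam) = ennreal \<kappa> * (\<integral>\<^sup>+ z. ennreal (bweight lam z) * f z \<partial>lborel)"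
    using nn_integral_bmeas_exists[OF lam] by blast
  obtain k where k: "k \<noteq> 0" "k \<noteq> \<infinity>"
    "\<And>f :: complex^'n \<Rightarrow> ennreal. f \<in> borel_measurable borel \<Longrightarrow>
      shell_integral lam f = k * (\<integral>\<^sup>+ z. ennreal (bweight lam z) * f z \<partial>lborel)"
    using shell_integral_eq[OF lam] by blast
  let ?g = "\<lambda>z. f (ball_action A z) * ennreal (cmod (aut_denom A z) powr (- 2 * lam))"
  have g[measurable]: "?g \<in> borel_measurable borel" by measurable
  have "k * (\<integral>\<^sup>+ z. ennreal (bweight lam z) * ?g z \<partial>lborel) = k * (\<integral>\<^sup>+ z. ennreal (bweight lam z) * f z \<partial>lborel)"
    using shell_integral_ball_action[OF A, of f lam] k(3)[of f] k(3)[OF g] by simp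
  then have "(\<integral>\<^sup>+ z. ennreal (bweight lam z) * ?g z \<partial>lborel) = (\<integral>\<^sup>+ z. ennreal (bweight lam z) * f z \<partial>lborel)"
    using k(1,2) by (simp add: ennreal_mult_cancel_left)
  then show ?thesis using \<kappa>[OF g] \<kappa>[of f] by simp
qed

subsection \<open>Holomorphic functions of several variables\<close>

lemma has_derivative_axis_nth [derivative_intros]:
  "((\<lambda>z::complex^'k::finite. z $ i) has_derivative (\<lambda>v. v $ i)) F"
  by (intro bounded_linear_imp_has_derivative bounded_linear_vec_nth)

lemma bounded_linear_smult_left: "bounded_linear (\<lambda>t. t *s (v :: complex^'k::finite))"
proof
  show "\<exists>K. \<forall>t. norm (t *s v) \<le> norm t * K" by (auto simp: norm_vec_smult)
qed (simp_all add: vec_eq_iff algebra_simps)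

lemma has_derivative_line: "((\<lambda>t. a + t *s (v :: complex^'k::finite)) has_derivative (\<lambda>h. h *s v)) F"
  using has_derivative_add[OF has_derivative_const bounded_linear_imp_has_derivative[OF bounded_linear_smult_left]]
  by simp

lemma holomorphic_in_subset: "holomorphic_in f S \<Longrightarrow> T \<subseteq> S \<Longrightarrow> holomorphic_in f T"
  by (auto simp: holomorphic_in_def)

lemma holomorphic_in_cong:
  assumes "holomorphic_in f S" "open S" "\<And>z. z \<in> S \<Longrightarrow> f z = g z"
  shows "holomorphic_in g S"
  unfolding holomorphic_in_def
proof
  fix z assume z: "z \<in> S"
  then obtain D where "(f has_derivative D) (at z)" "\<forall>c v. D (c *s v) = c * D v"
    using assms(1) by (auto simp: holomorphic_in_def)
  then show "\<exists>D. (g has_derivative D) (at z) \<and> (\<forall>c v. D (c *s v) = c * D v)"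
    using has_derivative_transform_within_open[OF _ assms(2) z] assms(3) by blast
qed

lemma holomorphic_in_continuous_on: "holomorphic_in f S \<Longrightarrow> continuous_on S f"
  by (metis holomorphic_in_def continuous_at_imp_continuous_on has_derivative_continuous)

lemma holomorphic_in_const: "holomorphic_in (\<lambda>z. c) S"
  unfolding holomorphic_in_def by (intro ballI exI[of _ "\<lambda>v. 0"]) auto

lemma holomorphic_in_nth: "holomorphic_in (\<lambda>z. z $ i) S"
  unfolding holomorphic_in_def by (intro ballI exI[of _ "\<lambda>v. v $ i"]) (auto intro: has_derivative_axis_nth)

lemma holomorphic_in_add:
  assumes "holomorphic_in f S" "holomorphic_in g S"
  shows "holomorphic_in (\<lambda>z. f z + g z) S"
  unfolding holomorphic_in_def
proof
  fix z assume "z \<in> S"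
  then obtain D E where "(f has_derivative D) (at z)" "\<forall>c v. D (c *s v) = c * D v"
    "(g has_derivative E) (at z)" "\<forall>c v. E (c *s v) = c * E v"
    using assms unfolding holomorphic_in_def by meson
  then show "\<exists>D. ((\<lambda>z. f z + g z) has_derivative D) (at z) \<and> (\<forall>c v. D (c *s v) = c * D v)"
    by (intro exI[of _ "\<lambda>v. D v + E v"]) (auto intro: has_derivative_add simp: algebra_simps)
qed

lemma holomorphic_in_mult:
  assumes "holomorphic_in f S" "holomorphic_in g S"
  shows "holomorphic_in (\<lambda>z. f z * g z) S"
  unfolding holomorphic_in_def
proof
  fix z assume "z \<in> S"
  then obtain D E where "(f has_derivative D) (at z)" "\<forall>c v. D (c *s v) = c * D v"
    "(g has_derivative E) (at z)" "\<forall>c v. E (c *s v) = c * E v"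
    using assms unfolding holomorphic_in_def by meson
  then show "\<exists>D. ((\<lambda>z. f z * g z) has_derivative D) (at z) \<and> (\<forall>c v. D (c *s v) = c * D v)"
    by (intro exI[of _ "\<lambda>v. f z * E v + D v * g z"] conjI allI has_derivative_mult) ( simp_all add: distrib_left mult_ac)
qed

lemma holomorphic_in_diff:
  assumes "holomorphic_in f S" "holomorphic_in g S"
  shows "holomorphic_in (\<lambda>z. f z - g z) S"
  using holomorphic_in_add[OF assms(1) holomorphic_in_mult[OF holomorphic_in_const[of "-1"] assms(2)]]
  by simp

lemma holomorphic_in_sum:
  assumes "\<And>i. i \<in> I \<Longrightarrow> holomorphic_in (f i) S"
  shows "holomorphic_in (\<lambda>z. \<Sum>i\<in>I. f i z) S"
  using assms by (induction I rule: infinite_finite_induct) (auto intro: holomorphic_in_const holomorphic_in_add)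

lemma holomorphic_in_compose_field:
  assumes "holomorphic_in f S" "\<And>z. z \<in> S \<Longrightarrow> (g has_field_derivative g' (f z)) (at (f z))"
  shows "holomorphic_in (\<lambda>z. g (f z)) S"
  unfolding holomorphic_in_def
proof
  fix z assume z: "z \<in> S"
  then obtain D where D: "(f has_derivative D) (at z)" "\<forall>c v. D (c *s v) = c * D v"
    using assms unfolding holomorphic_in_def by meson
  have "((\<lambda>z. g (f z)) has_derivative (\<lambda>v. g' (f z) * D v)) (at z)"
    using has_derivative_compose[OF D(1), of g "\<lambda>v. g' (f z) * v"] assms(2)[OF z]
    by (simp add: has_field_derivative_def)
  with D(2) show "\<exists>D. ((\<lambda>z. g (f z)) has_derivative D) (at z) \<and> (\<forall>c v. D (c *s v) = c * D v)"
    by (intro exI[of _ "\<lambda>v. g' (f z) * D v"]) auto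
qed

lemma holomorphic_in_divide:
  assumes "holomorphic_in f S" "holomorphic_in g S" "\<And>z. z \<in> S \<Longrightarrow> g z \<noteq> 0"
  shows "holomorphic_in (\<lambda>z. f z / g z) S"
proof -
  have "holomorphic_in (\<lambda>z. inverse (g z)) S"
    using assms(3)
    by (intro holomorphic_in_compose_field[OF assms(2), of inverse "\<lambda>x. - (inverse x ^ Suc (Suc 0))"] DERIV_inverse) auto
  from holomorphic_in_mult[OF assms(1) this] show ?thesis by (simp add: divide_inverse)
qed

lemma holomorphic_in_exp: "holomorphic_in f S \<Longrightarrow> holomorphic_in (\<lambda>z. exp (f z)) S"
  by (erule holomorphic_in_compose_field[of f S exp exp]) (rule DERIV_exp)

lemma holomorphic_in_compose:
  fixes u :: "complex^'k::finite \<Rightarrow> complex^'m::finite"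
  assumes "holomorphic_in f T" "\<And>i. holomorphic_in (\<lambda>z. u z $ i) S" "u ` S \<subseteq> T"
  shows "holomorphic_in (\<lambda>z. f (u z)) S"
  unfolding holomorphic_in_def
proof
  fix z assume z: "z \<in> S"
  have "\<forall>i. \<exists>D. ((\<lambda>z. u z $ i) has_derivative D) (at z) \<and> (\<forall>c v. D (c *s v) = c * D v)"
    using assms(2) z unfolding holomorphic_in_def by blast
  then obtain U where U: "\<And>i. ((\<lambda>z. u z $ i) has_derivative U i) (at z)" "\<And>i c v. U i (c *s v) = c * U i v"
    by metis
  have u: "(u has_derivative (\<lambda>v. \<chi> i. U i v)) (at z)"
  proof (rule has_derivative_componentwise_within[THEN iffD2], rule ballI)
    fix b :: "complex^'m" assume "b \<in> Basis"
    then obtain i w where b: "b = axis i w" by (auto simp: Basis_vec_def)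
    show "((\<lambda>x. u x \<bullet> b) has_derivative (\<lambda>x. (\<chi> i. U i x) \<bullet> b)) (at z)"
      unfolding b inner_axis using has_derivative_inner_left[OF U(1)[of i]] by simp
  qed
  obtain D where D: "(f has_derivative D) (at (u z))" "\<forall>c v. D (c *s v) = c * D v"
    using assms(1,3) z unfolding holomorphic_in_def by blast
  have "D (\<chi> i. U i (c *s v)) = c * D (\<chi> i. U i v)" for c v
  proof -
    have "(\<chi> i. U i (c *s v)) = c *s (\<chi> i. U i v)" by (simp add: U(2) vec_eq_iff)
    then show ?thesis using D(2) by simp
  qed
  with has_derivative_compose[OF u D(1)]
  show "\<exists>D. ((\<lambda>z. f (u z)) has_derivative D) (at z) \<and> (\<forall>c v. D (c *s v) = c * D v)"
    by blast
qed

section \<open>Restriction to complex lines: Cauchy estimates, limits and the identity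
  theorem\<close>

lemma holomorphic_in_line:
  assumes "holomorphic_in f S"
  shows "(\<lambda>t. f (a + t *s v)) holomorphic_on {t. a + t *s v \<in> S}"
  unfolding holomorphic_on_def
proof
  fix t assume t: "t \<in> {t. a + t *s v \<in> S}"
  then obtain D where D: "(f has_derivative D) (at (a + t *s v))" "\<forall>c v. D (c *s v) = c * D v"
    using assms unfolding holomorphic_in_def by auto
  from has_derivative_compose[OF has_derivative_line D(1)]
  have "((\<lambda>t. f (a + t *s v)) has_derivative (\<lambda>h. D v * h)) (at t)"
    using D(2) by (simp add: mult.commute)
  then show "(\<lambda>t. f (a + t *s v)) field_differentiable at t within {t. a + t *s v \<in> S}"
    by (metis field_differentiable_at_within field_differentiable_def has_field_derivative_def)
qed

text \<open>The one-variable inequality on the disc of radius \<open>r / norm v\<close>, which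
  \<open>t \<mapsto> a + t *s v\<close> maps into the ball of radius \<open>r\<close>.\<close>

lemma holomorphic_in_Cauchy_estimate:
  assumes f: "holomorphic_in f S" and S: "cball a r \<subseteq> S" and r: "r > 0"
    and M: "\<And>z. z \<in> cball a r \<Longrightarrow> cmod (f z) \<le> M"
    and D: "(f has_derivative D) (at a)"
  shows "cmod (D v) \<le> M / r * norm v"
proof (cases "v = 0")
  case True
  then show ?thesis using linear_0[OF has_derivative_linear[OF D]] by simp
next
  case False
  define \<phi> where "\<phi> t = f (a + t *s v)" for t
  define \<rho> where "\<rho> = r / norm v"
  have \<rho>: "\<rho> > 0" using False r by (simp add: \<rho>_def)
  have mem: "a + t *s v \<in> cball a r" if "t \<in> cball 0 \<rho>" for t
    using that False by (simp add: \<rho>_def dist_norm norm_vec_smult pos_le_divide_eq)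
  have hol: "\<phi> holomorphic_on cball 0 \<rho>"
    unfolding \<phi>_def by (rule holomorphic_on_subset[OF holomorphic_in_line[OF f]]) (use mem S in auto)
  have "norm ((deriv ^^ 1) \<phi> 0) \<le> fact 1 * M / \<rho> ^ 1"
  proof (rule Cauchy_inequality)
    show "\<phi> holomorphic_on ball 0 \<rho>" using hol by (rule holomorphic_on_subset) auto
    show "continuous_on (cball 0 \<rho>) \<phi>" using hol by (rule holomorphic_on_imp_continuous_on)
    show "cmod (\<phi> t) \<le> M" if "cmod (0 - t) = \<rho>" for t
      unfolding \<phi>_def by (rule M[OF mem]) (use that in auto)
  qed (rule \<rho>)
  moreover have "(\<phi> has_derivative (\<lambda>h. D (h *s v))) (at 0)"
  proof -
    from has_derivative_compose[OF has_derivative_line[of a v "at 0"], of f D] D show ?thesis by (simp add: \<phi>_def[abs_def])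
  qed
  moreover have "(\<phi> has_field_derivative deriv \<phi> 0) (at 0)"
    using hol \<rho> by (meson DERIV_deriv_iff_field_differentiable ball_subset_cball centre_in_ball
        holomorphic_on_imp_differentiable_at holomorphic_on_subset open_ball)
  ultimately have "cmod (D v) \<le> M / \<rho>"
    using has_derivative_unique[of \<phi> "\<lambda>h. D (h *s v)" 0 "\<lambda>h. deriv \<phi> 0 * h"]
    by (simp add: has_field_derivative_def fun_eq_iff) (metis mult.right_neutral vector_smult_lid)
  then show ?thesis by (simp add: \<rho>_def)
qed

text \<open>The Weierstrass convergence theorem. Cauchy estimates for differences make the
  derivatives uniformly Cauchy near \<open>a\<close>, so the limit is differentiable, and complex
  homogeneity of the derivatives passes to the limit.\<close>

lemma holomorphic_in_sequence:
  fixes f :: "nat \<Rightarrow> complex^'n::finite \<Rightarrow> complex"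
  assumes f: "\<And>k. holomorphic_in (f k) (ball 0 1)"
    and lim: "\<And>\<rho>. \<rho> < 1 \<Longrightarrow> uniform_limit (cball 0 \<rho>) f g sequentially"
  shows "holomorphic_in g (ball 0 1)"
  unfolding holomorphic_in_def
proof
  fix a :: "complex^'n" assume a: "a \<in> ball 0 1"
  \<comment> \<open>With a third of the distance to the boundary, balls of radius \<open>r\<close>
    around points of \<open>ball a r\<close> stay within norm \<open>norm a + 2 * r\<close>, where
    the convergence is uniform.\<close>
  define r where "r = (1 - norm a) / 3"
  have r: "r > 0" "norm a + 2 * r < 1" using a by (auto simp: r_def field_simps)
  have sub: "cball x r \<subseteq> cball 0 (norm a + 2 * r)" if "x \<in> ball a r" for x
  proof
    fix y assume "y \<in> cball x r"
    then have "norm y \<le> norm a + norm (x - a) + norm (y - x)" "norm (x - a) < r" "norm (y - x) \<le> r"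
      using that norm_triangle_ineq[of "a + (x - a)" "y - x"] norm_triangle_ineq[of a "x - a"]
      by (auto simp: dist_norm norm_minus_commute)
    then show "y \<in> cball 0 (norm a + 2 * r)" by simp
  qed
  have in_ball: "x \<in> ball 0 1" if "x \<in> ball a r" for x
  proof -
    have "x \<in> cball x r" using r by simp
    then have "norm x \<le> norm a + 2 * r" using sub[OF that] by (auto simp: subset_iff)
    then show ?thesis using r by simp
  qed
  obtain D where D: "\<And>k x. x \<in> ball 0 1 \<Longrightarrow> (f k has_derivative D k x) (at x)"
    "\<And>k x c v. x \<in> ball 0 1 \<Longrightarrow> D k x (c *s v) = c * D k x v"
    using f unfolding holomorphic_in_def by metis
  have ev: "\<forall>\<^sub>F k in sequentially. \<forall>y\<in>cball 0 (norm a + 2 * r). cmod (f k y - g y) < e" if "e > 0" for e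
    using lim[OF r(2)] that by (simp add: uniform_limit_iff dist_norm)
  have diff: "cmod (D k x h - D l x h) \<le> e * norm h"
    if x: "x \<in> ball a r" and k: "\<forall>y\<in>cball 0 (norm a + 2 * r). cmod (f k y - g y) < e * r / 2"
      and l: "\<forall>y\<in>cball 0 (norm a + 2 * r). cmod (f l y - g y) < e * r / 2" for k l x h e
  proof -
    have "cmod ((\<lambda>h. D k x h - D l x h) h) \<le> (e * r) / r * norm h"
    proof (rule holomorphic_in_Cauchy_estimate)
      show "holomorphic_in (\<lambda>z. f k z - f l z) (ball 0 1)" by (intro holomorphic_in_diff f)
      show "cball x r \<subseteq> ball 0 1" using sub[OF x] r(2) by (force simp: subset_iff)
      show "((\<lambda>z. f k z - f l z) has_derivative (\<lambda>h. D k x h - D l x h)) (at x)"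
        by (intro has_derivative_diff D in_ball x)
      show "cmod (f k z - f l z) \<le> e * r" if "z \<in> cball x r" for z
      proof -
        have "cmod (f k z - g z) < e * r / 2" "cmod (f l z - g z) < e * r / 2"
          using sub[OF x] that k l by blast+
        then show ?thesis using norm_triangle_ineq4[of "f k z - g z" "f l z - g z"] by simp
      qed
    qed (rule r)
    then show ?thesis using r by simp
  qed
  have conv: "convergent (\<lambda>k. D k x h)" if x: "x \<in> ball a r" for x h
  proof -
    have "Cauchy (\<lambda>k. D k x h)"
    proof (rule metric_CauchyI)
      fix e :: real assume e: "e > 0"
      define d where "d = e / (2 * (norm h + 1))"
      have "norm h + 1 > 0" by (simp add: add_nonneg_pos)
      then have d: "d > 0" "d * norm h < e"
        using e by (simp_all add: d_def pos_divide_less_eq)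
      then obtain N where N: "\<And>k. k \<ge> N \<Longrightarrow> \<forall>y\<in>cball 0 (norm a + 2 * r). cmod (f k y - g y) < d * r / 2"
        using ev[of "d * r / 2"] r by (auto simp: eventually_sequentially)
      show "\<exists>M. \<forall>m\<ge>M. \<forall>n\<ge>M. dist (D m x h) (D n x h) < e"
        using diff[OF x N N] d(2) by (intro exI[of _ N]) (auto simp: dist_norm intro: le_less_trans)
    qed
    then show ?thesis by (rule Cauchy_convergent)
  qed
  define E where "E x h = lim (\<lambda>k. D k x h)" for x h
  have E: "(\<lambda>k. D k x h) \<longlonglongrightarrow> E x h" if "x \<in> ball a r" for x h
    using conv[OF that, of h] by (simp add: E_def convergent_LIMSEQ_iff)
  have "\<exists>G. \<forall>x\<in>ball a r. (\<lambda>k. f k x) \<longlonglongrightarrow> G x \<and> (G has_derivative E x) (at x within ball a r)"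
  proof (rule has_derivative_sequence)
    show "(f k has_derivative D k x) (at x within ball a r)" if "x \<in> ball a r" for k x
      using D(1)[OF in_ball[OF that]] by (rule has_derivative_at_withinI)
    show "\<forall>\<^sub>F k in sequentially. \<forall>x\<in>ball a r. \<forall>h. cmod (D k x h - E x h) \<le> e * norm h" if e: "e > 0" for e
    proof -
      obtain N where N: "\<And>k. k \<ge> N \<Longrightarrow> \<forall>y\<in>cball 0 (norm a + 2 * r). cmod (f k y - g y) < e * r / 2"
        using ev[of "e * r / 2"] r e by (auto simp: eventually_sequentially)
      have "cmod (D k x h - E x h) \<le> e * norm h" if "k \<ge> N" "x \<in> ball a r" for k x h
      proof (rule tendsto_upperbound)
        show "(\<lambda>l. cmod (D k x h - D l x h)) \<longlonglongrightarrow> cmod (D k x h - E x h)"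
          by (intro tendsto_intros E that)
        show "\<forall>\<^sub>F l in sequentially. cmod (D k x h - D l x h) \<le> e * norm h"
          using diff[OF that(2) N[OF that(1)] N] by (auto simp: eventually_sequentially)
      qed simp
      then show ?thesis unfolding eventually_sequentially by blast
    qed
    have "(\<lambda>k. f k a) \<longlonglongrightarrow> g a"
      using tendsto_uniform_limitI[OF lim[OF r(2)], of a] r(1) by simp
    then show "(\<lambda>k. f k a) \<longlonglongrightarrow> g a" .
  qed (use r in auto)
  then obtain G where G: "\<And>x. x \<in> ball a r \<Longrightarrow> (\<lambda>k. f k x) \<longlonglongrightarrow> G x"
    "\<And>x. x \<in> ball a r \<Longrightarrow> (G has_derivative E x) (at x within ball a r)"
    by blast
  have "(\<lambda>k. f k x) \<longlonglongrightarrow> g x" if "x \<in> ball a r" for x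
    using tendsto_uniform_limitI[OF lim[OF r(2)], of x] sub[OF that] r(1) by (auto simp: subset_iff)
  then have Gg: "G x = g x" if "x \<in> ball a r" for x
    using G(1) that LIMSEQ_unique by blast
  have "(G has_derivative E a) (at a)"
    using G(2)[of a] r by (simp add: at_within_open[of a "ball a r"])
  then have "(g has_derivative E a) (at a)"
    by (rule has_derivative_transform_within_open[OF _ open_ball[of a r]]) (use r Gg in auto)
  moreover have "E a (c *s v) = c * E a v" for c v
  proof -
    have "(\<lambda>k. c * D k a v) \<longlonglongrightarrow> c * E a v" using r by (intro tendsto_intros E) auto
    moreover have "(\<lambda>k. c * D k a v) \<longlonglongrightarrow> E a (c *s v)" using E[of a "c *s v"] r D(2)[OF a] by simp
    ultimately show ?thesis by (rule LIMSEQ_unique[symmetric])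
  qed
  ultimately show "\<exists>D. (g has_derivative D) (at a) \<and> (\<forall>c v. D (c *s v) = c * D v)" by blast
qed

text \<open>On the complex line through \<open>z0\<close> and \<open>z\<close> the part inside the
  ball is convex, hence connected, and the one-variable identity theorem starts from a small disc at
  \<open>z0\<close>.\<close>

lemma holomorphic_in_identity:
  assumes f: "holomorphic_in f (ball 0 1)" and r: "r > 0" "z0 \<in> ball 0 1"
    and zero: "\<And>z. z \<in> ball z0 r \<Longrightarrow> f z = 0" and z: "z \<in> ball 0 1"
  shows "f z = 0"
proof (cases "z = z0")
  case False
  define v where "v = z - z0"
  have v: "norm v > 0" using False by (simp add: v_def)
  define S where "S = {t. z0 + t *s v \<in> ball 0 1}"
  have bl: "linear (\<lambda>t. t *s v)" using bounded_linear_smult_left[of v] by (simp add: bounded_linear.linear)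
  have S: "S = (\<lambda>t. t *s v) -` ball (- z0) 1"
    by (auto simp: S_def dist_norm norm_minus_commute algebra_simps)
  have "open S" unfolding S
    using bounded_linear.isCont[OF bounded_linear_smult_left[of v] continuous_ident] by (intro continuous_open_vimage) auto
  have "convex S" unfolding S by (intro convex_linear_vimage bl convex_ball)
  have "f (z0 + 1 *s v) = 0"
  proof (rule analytic_continuation_open[where s="ball 0 (r / norm v) \<inter> S" and s'=S and f="\<lambda>t. f (z0 + t *s v)" and g="\<lambda>_. 0" and z=1])
    show "(\<lambda>t. f (z0 + t *s v)) holomorphic_on S" unfolding S_def by (rule holomorphic_in_line[OF f])
    show "open (ball 0 (r / norm v) \<inter> S)" using \<open>open S\<close> by auto
    have "0 \<in> ball 0 (r / norm v) \<inter> S" using r v by (auto simp: S_def)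
    then show "ball 0 (r / norm v) \<inter> S \<noteq> {}" by blast
    show "connected S" using \<open>convex S\<close> by (rule convex_connected)
    show "1 \<in> S" using z by (simp add: S_def v_def)
    fix t assume "t \<in> ball 0 (r / norm v) \<inter> S"
    then have "z0 + t *s v \<in> ball z0 r" using v by (simp add: dist_norm norm_vec_smult pos_less_divide_eq)
    then show "f (z0 + t *s v) = 0" by (rule zero)
  qed (use \<open>open S\<close> in auto)
  then show ?thesis by (simp add: v_def)
qed (use zero r in auto)

text \<open>Osgood's lemma, restricted to the diagonal.\<close>

lemma separately_holomorphic_diagonal:
  fixes g :: "complex \<Rightarrow> complex \<Rightarrow> complex"
  assumes bound: "\<And>s t. s \<in> ball 0 R \<Longrightarrow> t \<in> ball 0 R \<Longrightarrow> cmod (g s t) \<le> M"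
    and hol1: "\<And>t. t \<in> ball 0 R \<Longrightarrow> (\<lambda>s. g s t) holomorphic_on ball 0 R"
    and hol2: "\<And>s. s \<in> ball 0 R \<Longrightarrow> g s holomorphic_on ball 0 R"
  shows "(\<lambda>t. g t t) holomorphic_on ball 0 R"
  unfolding holomorphic_on_def
proof
  fix x :: complex assume x: "x \<in> ball 0 R"
  define r where "r = (R - norm x) / 3"
  have r: "r > 0" using x by (simp add: r_def)
  have sub: "cball y r \<subseteq> ball 0 R" if "y \<in> ball x r" for y
  proof
    fix w assume "w \<in> cball y r"
    then have "norm w \<le> norm x + norm (y - x) + norm (w - y)" "norm (y - x) < r" "norm (w - y) \<le> r"
      using that norm_triangle_ineq[of "x + (y - x)" "w - y"] norm_triangle_ineq[of x "y - x"]
      by (auto simp: dist_norm norm_minus_commute)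
    then show "w \<in> ball 0 R" using r by (simp add: r_def)
  qed
  have inR: "y \<in> ball 0 R" if "y \<in> ball x r" for y
    using sub[OF that] centre_in_cball[of y r] r by (meson less_imp_le subsetD)
  have cauchy: "cmod (deriv \<phi> y) \<le> B / r"
    if "\<phi> holomorphic_on ball 0 R" "y \<in> ball x r" "\<And>w. w \<in> cball y r \<Longrightarrow> cmod (\<phi> w) \<le> B" for \<phi> y B
  proof -
    have "norm ((deriv ^^ 1) \<phi> y) \<le> fact 1 * B / r ^ 1"
      using that sub[OF that(2)] r
      by (intro Cauchy_inequality)
        (auto intro!: holomorphic_on_imp_continuous_on intro: holomorphic_on_subset simp: dist_norm subset_iff)
    then show ?thesis by simp
  qed
  \<comment> \<open>Cauchy's estimate in \<open>s\<close> gives a Lipschitz bound that is uniform in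
    \<open>t\<close>. A second estimate in \<open>t\<close>, applied to
    \<open>g s t - g x t\<close>, bounds the variation of the partial derivative \<open>d\<close> in
    \<open>s\<close>; this yields the joint continuity which makes \<open>g\<close> totally
    differentiable at \<open>(x, x)\<close>.\<close>
  have lip: "cmod (g s t - g x t) \<le> M / r * cmod (s - x)" if s: "s \<in> ball x r" and t: "t \<in> ball 0 R" for s t
  proof (rule field_differentiable_bound[of "ball x r" "\<lambda>s. g s t" "deriv (\<lambda>s. g s t)"])
    fix y assume y: "y \<in> ball x r"
    show "((\<lambda>s. g s t) has_field_derivative deriv (\<lambda>s. g s t) y) (at y within ball x r)"
      using hol1[OF t] inR[OF y] by (meson holomorphic_derivI open_ball has_field_derivative_at_within)
    show "cmod (deriv (\<lambda>s. g s t) y) \<le> M / r"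
      using sub[OF y] by (intro cauchy hol1 t y bound) auto
  qed (use s r in auto)
  define d where "d s t = deriv (g s) t" for s t
  have d: "(g s has_field_derivative d s t) (at t)" if "s \<in> ball x r" "t \<in> ball x r" for s t
    unfolding d_def using hol2[OF inR[OF that(1)]] inR[OF that(2)] by (meson holomorphic_derivI open_ball)
  have dlip: "cmod (d s t - d x t) \<le> M / r * cmod (s - x) / r" if s: "s \<in> ball x r" and t: "t \<in> ball x r" for s t
  proof -
    have "d s t - d x t = deriv (\<lambda>t. g s t - g x t) t"
      using d[OF s t] d[of x t] t r by (intro DERIV_imp_deriv[symmetric] DERIV_diff) auto
    moreover have "cmod (deriv (\<lambda>t. g s t - g x t) t) \<le> M / r * cmod (s - x) / r"
      by (rule cauchy[OF holomorphic_on_diff[OF hol2[OF inR[OF s]] hol2[OF x]] t]) (use lip[OF s] sub[OF t] in blast)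
    ultimately show ?thesis by simp
  qed
  have cont: "((\<lambda>(s, t). d s t) \<longlongrightarrow> d x x) (at (x, x) within ball x r \<times> ball x r)"
  proof -
    have dx: "isCont (d x) x"
      using holomorphic_deriv[OF hol2[OF x] open_ball] x unfolding d_def[abs_def]
      by (meson holomorphic_on_imp_continuous_on continuous_on_eq_continuous_at open_ball)
    have st: "((\<lambda>p. fst p) \<longlongrightarrow> x) (at (x, x) within ball x r \<times> ball x r)"
      "((\<lambda>p. snd p) \<longlongrightarrow> x) (at (x, x) within ball x r \<times> ball x r)"
      using tendsto_fst[OF tendsto_ident_at] tendsto_snd[OF tendsto_ident_at] by fastforce+
    have "((\<lambda>p. M / r * cmod (fst p - x) / r + cmod (d x (snd p) - d x x)) \<longlongrightarrow> M / r * cmod (x - x) / r + cmod (d x x - d x x)) (at (x, x) within ball x r \<times> ball x r)"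
      by (intro tendsto_intros st isCont_tendsto_compose[OF dx]) (use r in auto)
    then have z: "((\<lambda>p. M / r * cmod (fst p - x) / r + cmod (d x (snd p) - d x x)) \<longlongrightarrow> 0) (at (x, x) within ball x r \<times> ball x r)"
      by simp
    have "((\<lambda>(s, t). d s t - d x x) \<longlongrightarrow> 0) (at (x, x) within ball x r \<times> ball x r)"
    proof (rule Lim_null_comparison[OF _ z])
      show "\<forall>\<^sub>F p in at (x, x) within ball x r \<times> ball x r.
        norm (case p of (s, t) \<Rightarrow> d s t - d x x) \<le> M / r * cmod (fst p - x) / r + cmod (d x (snd p) - d x x)"
        unfolding eventually_at_filter
      proof (intro always_eventually allI impI)
        fix p assume "p \<noteq> (x, x)" and p: "p \<in> ball x r \<times> ball x r"
        obtain s t where st: "p = (s, t)" by (cases p)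
        have "cmod (d s t - d x x) \<le> cmod (d s t - d x t) + cmod (d x t - d x x)"
          using norm_triangle_ineq[of "d s t - d x t" "d x t - d x x"] by simp
        then show "norm (case p of (s, t) \<Rightarrow> d s t - d x x) \<le> M / r * cmod (fst p - x) / r + cmod (d x (snd p) - d x x)"
          using dlip[of s t] p st by auto
      qed
    qed
    then show ?thesis by (simp add: Lim_null[of _ "d x x"] case_prod_unfold)
  qed
  have gx: "((\<lambda>s. g s x) has_derivative (\<lambda>h. deriv (\<lambda>s. g s x) x * h)) (at x within ball x r)"
    using hol1[OF x] x by (metis has_derivative_at_withinI has_field_derivative_def holomorphic_derivI open_ball)
  have "((\<lambda>(s, t). g s t) has_derivative
      (\<lambda>(h, k). deriv (\<lambda>s. g s x) x * h + blinfun_mult_right (d x x) k)) (at (x, x) within ball x r \<times> ball x r)"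
  proof (rule has_derivative_partialsI[where f=g and fx="\<lambda>h. deriv (\<lambda>s. g s x) x * h" and
        fy="\<lambda>s t. blinfun_mult_right (d s t)", OF gx])
    show "(g s has_derivative blinfun_apply (blinfun_mult_right (d s t))) (at t within ball x r)"
      if "s \<in> ball x r" "t \<in> ball x r" for s t
      using d[OF that] by (simp add: has_field_derivative_def has_derivative_at_withinI)
    have "((\<lambda>p. blinfun_mult_right (case p of (s, t) \<Rightarrow> d s t)) \<longlongrightarrow> blinfun_mult_right (d x x)) (at (x, x) within ball x r \<times> ball x r)"
      by (rule bounded_linear.tendsto[OF bounded_linear_blinfun_mult_right cont])
    then show "continuous (at (x, x) within ball x r \<times> ball x r) (\<lambda>(s, t). blinfun_mult_right (d s t))"
      by (simp add: continuous_within case_prod_unfold)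
  qed (use r in auto)
  then have D: "((\<lambda>(s, t). g s t) has_derivative
      (\<lambda>(h, k). deriv (\<lambda>s. g s x) x * h + d x x * k)) (at (x, x))"
    using r by (simp add: at_within_open[of "(x, x)" "ball x r \<times> ball x r"] open_Times)
  have "((\<lambda>t. (t, t)) has_derivative (\<lambda>h. (h, h))) (at x)"
    by (intro has_derivative_Pair has_derivative_ident)
  from has_derivative_compose[OF this D]
  have "((\<lambda>t. g t t) has_field_derivative (deriv (\<lambda>s. g s x) x + d x x)) (at x)"
    unfolding has_field_derivative_def
    by (simp add: distrib_right[abs_def])
  then show "(\<lambda>t. g t t) field_differentiable at x within ball 0 R"
    using field_differentiable_at_within field_differentiable_def by blast
qed

section \<open>Conjugate variables and polarization\<close>

definition cnjv :: "complex^'k::finite \<Rightarrow> complex^'k" where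
  "cnjv z = (\<chi> i. cnj (z $ i))"

lemma cnjv_nth [simp]: "cnjv z $ i = cnj (z $ i)"
  by (simp add: cnjv_def)

lemma cnjv_cnjv [simp]: "cnjv (cnjv z) = z"
  by (simp add: vec_eq_iff)

lemma cnjv_add: "cnjv (x + y) = cnjv x + cnjv y"
  and cnjv_diff: "cnjv (x - y) = cnjv x - cnjv y"
  and cnjv_smult: "cnjv (c *s x) = cnj c *s cnjv x"
  by (simp_all add: vec_eq_iff)

lemma norm_cnjv [simp]: "norm (cnjv z) = norm z"
  by (simp add: norm_vec_def)

lemma linear_cnjv: "linear cnjv"
  by (rule linearI) (simp_all add: vec_eq_iff)

text \<open>A sesquiholomorphic function vanishing on the diagonal vanishes: along
  \<open>t \<mapsto> (p + t q, cnj p + t cnj q)\<close> it is holomorphic in \<open>t\<close> and zero for real \<open>t\<close>, and every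
  point is of the form \<open>t = \<i>\<close>.\<close>

lemma polarization:
  fixes e :: "complex^'n::finite \<Rightarrow> complex^'n \<Rightarrow> complex"
  assumes bound: "\<And>x y. x \<in> ball z0 r \<Longrightarrow> y \<in> ball (cnjv z0) r \<Longrightarrow> cmod (e x y) \<le> M"
    and hol1: "\<And>y. y \<in> ball (cnjv z0) r \<Longrightarrow> holomorphic_in (\<lambda>x. e x y) (ball z0 r)"
    and hol2: "\<And>x. x \<in> ball z0 r \<Longrightarrow> holomorphic_in (e x) (ball (cnjv z0) r)"
    and diag: "\<And>x. x \<in> ball z0 r \<Longrightarrow> e x (cnjv x) = 0"
    and x: "x \<in> ball z0 (r / 3)" and y: "y \<in> ball (cnjv z0) (r / 3)"
  shows "e x y = 0"
proof -
  \<comment> \<open>\<open>p\<close> and \<open>q\<close> solve \<open>p + \<i> *s q = x\<close> and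
    \<open>cnjv p + \<i> *s cnjv q = y\<close>.\<close>
  define p where "p = (1 / 2) *s (x + cnjv y)"
  define q where "q = (- \<i> / 2) *s (x - cnjv y)"
  have nx: "norm (x - z0) < r / 3" using x by (simp add: dist_norm norm_minus_commute)
  have "norm (cnjv y - z0) = norm (cnjv (y - cnjv z0))" by (simp add: cnjv_diff)
  then have ny: "norm (cnjv y - z0) < r / 3" using y by (simp add: dist_norm norm_minus_commute)
  have "p - z0 = (1 / 2) *s ((x - z0) + (cnjv y - z0))" by (simp add: p_def vec_eq_iff field_simps)
  then have p: "norm (p - z0) < r / 3"
    unfolding \<open>p - z0 = _\<close> norm_vec_smult using nx ny norm_triangle_ineq[of "x - z0" "cnjv y - z0"]
    by (simp add: norm_divide)
  have "q = (- \<i> / 2) *s ((x - z0) - (cnjv y - z0))" by (simp add: q_def)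
  then have q: "norm q < r / 3"
    unfolding \<open>q = _ *s ((x - z0) - (cnjv y - z0))\<close> norm_vec_smult using nx ny norm_triangle_ineq4[of "x - z0" "cnjv y - z0"]
    by (simp add: norm_divide)
  \<comment> \<open>As \<open>p - z0\<close> and \<open>q\<close> have norm below
    \<open>r / 3\<close>, the parameter may range over the disc of radius 2, which contains
    \<open>\<i>\<close> in its interior.\<close>
  have mem: "p + s *s q \<in> ball z0 r" if "s \<in> ball 0 2" for s
  proof -
    have "norm (p + s *s q - z0) \<le> norm (p - z0) + cmod s * norm q"
      using norm_triangle_ineq[of "p - z0" "s *s q"] by (simp add: norm_vec_smult algebra_simps)
    also have "\<dots> \<le> norm (p - z0) + 2 * norm q" using that by (intro add_left_mono mult_right_mono) auto
    also have "\<dots> < r" using p q by simp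
    finally show ?thesis by (simp add: dist_norm norm_minus_commute)
  qed
  have mem': "cnjv p + t *s cnjv q \<in> ball (cnjv z0) r" if "t \<in> ball 0 2" for t
  proof -
    have "cnjv p + t *s cnjv q = cnjv (p + cnj t *s q)" by (simp add: cnjv_add cnjv_smult)
    moreover have "dist (cnjv z0) (cnjv w) = dist z0 w" for w :: "complex^'n"
      by (simp add: dist_norm flip: cnjv_diff)
    ultimately show ?thesis using mem[of "cnj t"] that by simp
  qed
  define g where "g s t = e (p + s *s q) (cnjv p + t *s cnjv q)" for s t
  have hol: "(\<lambda>t. g t t) holomorphic_on ball 0 2"
  proof (rule separately_holomorphic_diagonal[where M=M and g=g])
    show "cmod (g s t) \<le> M" if "s \<in> ball 0 2" "t \<in> ball 0 2" for s t
      unfolding g_def by (rule bound[OF mem[OF that(1)] mem'[OF that(2)]])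
    show "(\<lambda>s. g s t) holomorphic_on ball 0 2" if "t \<in> ball 0 2" for t
      unfolding g_def
      by (rule holomorphic_on_subset[OF holomorphic_in_line[OF hol1[OF mem'[OF that]]]]) (use mem in blast)
    show "g s holomorphic_on ball 0 2" if "s \<in> ball 0 2" for s
      unfolding g_def[abs_def]
      by (rule holomorphic_on_subset[OF holomorphic_in_line[OF hol2[OF mem[OF that]]]]) (use mem' in blast)
  qed
  have "g \<i> \<i> = 0"
  proof (rule analytic_continuation[OF hol, where U="of_real ` {-1<..<1}" and \<xi>=0 and w=\<i>])
    show "(0::complex) islimpt of_real ` {-1<..<1}"
      unfolding islimpt_approachable
    proof (intro allI impI)
      fix \<epsilon> :: real assume "\<epsilon> > 0"
      then show "\<exists>x'\<in>complex_of_real ` {-1<..<1}. x' \<noteq> 0 \<and> dist x' 0 < \<epsilon>"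
        by (intro bexI[of _ "of_real (min (1/2) (\<epsilon>/2))"]) (auto simp: min_def)
    qed
    show "g z z = 0" if "z \<in> of_real ` {-1<..<1}" for z
    proof -
      from that obtain t where t: "z = of_real t" "\<bar>t\<bar> < 1" by auto
      then have "cnjv p + z *s cnjv q = cnjv (p + z *s q)" by (simp add: cnjv_add cnjv_smult)
      moreover have "p + z *s q \<in> ball z0 r" by (rule mem) (use t in simp)
      ultimately show ?thesis unfolding g_def using diag by simp
    qed
  qed auto
  moreover have "p + \<i> *s q = x" "cnjv p + \<i> *s cnjv q = y"
    by (simp_all add: p_def q_def vec_eq_iff field_simps)
  ultimately show ?thesis by (simp add: g_def)
qed

lemma holomorphic_in_cnj:
  assumes "holomorphic_in f S"
  shows "holomorphic_in (\<lambda>z. cnj (f (cnjv z))) (cnjv -` S)"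
  unfolding holomorphic_in_def
proof
  fix z assume "z \<in> cnjv -` S"
  then obtain D where D: "(f has_derivative D) (at (cnjv z))" "\<forall>c v. D (c *s v) = c * D v"
    using assms unfolding holomorphic_in_def by auto
  have "(cnjv has_derivative cnjv) (at z)"
    by (rule bounded_linear_imp_has_derivative) (use linear_cnjv in \<open>simp add: linear_conv_bounded_linear\<close>)
  from has_derivative_cnj[OF has_derivative_compose[OF this D(1)]]
  have "((\<lambda>z. cnj (f (cnjv z))) has_derivative (\<lambda>v. cnj (D (cnjv v)))) (at z)" .
  then show "\<exists>D. ((\<lambda>z. cnj (f (cnjv z))) has_derivative D) (at z) \<and> (\<forall>c v. D (c *s v) = c * D v)"
    using D(2) by (intro exI[of _ "\<lambda>v. cnj (D (cnjv v))"]) (simp add: cnjv_smult)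
qed

section \<open>Holomorphy and logarithms of the automorphy factor\<close>

lemma holomorphic_in_aut_denom: "holomorphic_in (aut_denom A) S"
  unfolding aut_denom_def[abs_def]
  by (intro holomorphic_in_add holomorphic_in_sum holomorphic_in_mult holomorphic_in_const holomorphic_in_nth)

lemma holomorphic_in_ball_action:
  assumes "form_unitary A"
  shows "holomorphic_in (\<lambda>z. ball_action A z $ i) (ball 0 1)"
  unfolding ball_action_def vec_lambda_beta
  by (intro holomorphic_in_divide holomorphic_in_aut_denom aut_denom_nonzero assms holomorphic_in_add
      holomorphic_in_sum holomorphic_in_mult holomorphic_in_const holomorphic_in_nth)

text \<open>After division by its value \<open>d\<close> at 0 the denominator avoids the cut of the
  principal logarithm: it is affine in \<open>z\<close>, and a nonpositive value at \<open>z\<close>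
  would force a zero on the segment from 0 to \<open>z\<close>.\<close>

lemma aut_denom_log:
  assumes A: "form_unitary A"
  obtains L where "holomorphic_in L (ball 0 1)" "\<And>z. z \<in> ball 0 1 \<Longrightarrow> exp (L z) = aut_denom A z"
proof
  define d where "d = aut_denom A 0"
  have d: "d \<noteq> 0" using aut_denom_nonzero[OF A, of 0] by (simp add: d_def)
  define L where "L z = Ln d + Ln (aut_denom A z / d)" for z
  have nonpos: "aut_denom A z / d \<notin> \<real>\<^sub>\<le>\<^sub>0" if z: "z \<in> ball 0 1" for z
  proof
    assume "aut_denom A z / d \<in> \<real>\<^sub>\<le>\<^sub>0"
    then obtain s where s: "aut_denom A z / d = of_real s" "s \<le> 0" by (auto elim: nonpos_Reals_cases)
    \<comment> \<open>At \<open>of_real t *s z\<close> the denominator equals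
      \<open>d * (1 - t * (1 - s))\<close>, which is zero for this \<open>t\<close>.\<close>
    define t where "t = 1 / (1 - s)"
    have t: "0 < t" "t \<le> 1" using s(2) by (auto simp: t_def)
    have "aut_denom A (of_real t *s z) = d + of_real t * (aut_denom A z - d)"
      by (simp add: d_def aut_denom_def sum_distrib_left algebra_simps)
    also have "aut_denom A z = of_real s * d" using s(1) d by (simp add: field_simps)
    also have "d + of_real t * (of_real s * d - d) = d * of_real (1 - t * (1 - s))" by (simp add: algebra_simps)
    also have "1 - t * (1 - s) = 0" using s(2) by (simp add: t_def)
    finally have "aut_denom A (of_real t *s z) = 0" by simp
    moreover have "of_real t *s z \<in> ball 0 1"
      using t z mult_left_le_one_le[of "norm z" t] by (simp add: norm_vec_smult)
    ultimately show False using aut_denom_nonzero[OF A] by blast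
  qed
  show "holomorphic_in L (ball 0 1)"
    unfolding L_def
    by (intro holomorphic_in_add holomorphic_in_const has_field_derivative_Ln nonpos
        holomorphic_in_compose_field[OF holomorphic_in_divide[OF holomorphic_in_aut_denom holomorphic_in_const d], of _ Ln inverse])
  show "exp (L z) = aut_denom A z" if "z \<in> ball 0 1" for z
    using aut_denom_nonzero[OF A that] d by (simp add: L_def exp_add)
qed

text \<open>The values of \<open>f\<close> are integer multiples of \<open>2 * pi * \<i>\<close>,
  which form a discrete set. This fixes branches of logarithms up to a constant.\<close>

lemma exp_one_imp_constant:
  assumes "connected S" "continuous_on S f" "\<And>z. z \<in> S \<Longrightarrow> exp (f z) = (1::complex)" "x \<in> S" "y \<in> S"
  shows "f x = f y"
proof -
  have "f constant_on S"
  proof (rule continuous_discrete_range_constant[OF assms(1,2)])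
    fix a assume a: "a \<in> S"
    show "\<exists>e>0. \<forall>b. b \<in> S \<and> f b \<noteq> f a \<longrightarrow> e \<le> cmod (f b - f a)"
    proof (intro exI[of _ "2 * pi"] conjI allI impI)
      fix b assume b: "b \<in> S \<and> f b \<noteq> f a"
      obtain m n :: int where mn: "f a = 0 + (of_int (2 * m) * pi) * \<i>" "f b = 0 + (of_int (2 * n) * pi) * \<i>"
        using assms(3)[OF a] assms(3)[of b] b exp_eq[of "f a" 0] exp_eq[of "f b" 0] by auto
      then have "f b - f a = of_real (2 * pi * of_int (n - m)) * \<i>" by (simp add: algebra_simps)
      then have "cmod (f b - f a) = 2 * pi * \<bar>of_int (n - m)\<bar>" by (simp only: norm_mult norm_of_real norm_ii abs_mult) simp
      moreover have "\<bar>n - m\<bar> \<ge> 1" using b mn by auto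
      then have "\<bar>of_int (n - m)\<bar> \<ge> (1::real)" by linarith
      ultimately show "2 * pi \<le> cmod (f b - f a)" by simp
    qed simp
  qed
  then show ?thesis using assms(4,5) by (auto simp: constant_on_def)
qed

subsection \<open>Square-integrable functions\<close>

text \<open>These are Borel functions, not classes modulo null sets, so
  \<open>sqrt (bsq lam f)\<close> is a seminorm in general. It becomes a norm on holomorphic
  functions by \<open>bergman_bsq_zero\<close>.\<close>

definition bL2 :: "real \<Rightarrow> (complex^'n::finite \<Rightarrow> complex) set" where
  "bL2 lam = {f. f \<in> borel_measurable borel \<and> integrable (bmeas lam) (\<lambda>z. (cmod (f z))\<^sup>2)}"

definition bip :: "real \<Rightarrow> (complex^'n::finite \<Rightarrow> complex) \<Rightarrow> (complex^'n \<Rightarrow> complex) \<Rightarrow> complex" where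
  "bip lam f g = (\<integral>z. f z * cnj (g z) \<partial>bmeas lam)"

definition bsq :: "real \<Rightarrow> (complex^'n::finite \<Rightarrow> complex) \<Rightarrow> real" where
  "bsq lam f = (\<integral>z. (cmod (f z))\<^sup>2 \<partial>bmeas lam)"

lemma borel_measurable_cnj [measurable]: "cnj \<in> borel_measurable borel"
  by (intro borel_measurable_continuous_onI continuous_intros)

lemma bsq_nonneg [simp]: "bsq lam f \<ge> 0"
  by (simp add: bsq_def)

lemma bL2_measurable: "f \<in> bL2 lam \<Longrightarrow> f \<in> borel_measurable borel"
  by (simp add: bL2_def)

lemma bL2_integrable_mult:
  assumes "f \<in> bL2 lam" "g \<in> bL2 lam"
  shows "integrable (bmeas lam) (\<lambda>z. f z * cnj (g z))"
proof (rule Bochner_Integration.integrable_bound)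
  show "integrable (bmeas lam) (\<lambda>z. (cmod (f z))\<^sup>2 + (cmod (g z))\<^sup>2)"
    using assms by (auto simp: bL2_def)
  have [measurable]: "f \<in> borel_measurable borel" "g \<in> borel_measurable borel"
    using assms by (auto simp: bL2_def)
  show "(\<lambda>z. f z * cnj (g z)) \<in> borel_measurable (bmeas lam)" by measurable
  show "AE z in bmeas lam. norm (f z * cnj (g z)) \<le> norm ((cmod (f z))\<^sup>2 + (cmod (g z))\<^sup>2)"
  proof (rule AE_I2)
    fix z
    have "cmod (f z) * cmod (g z) \<le> (cmod (f z))\<^sup>2 + (cmod (g z))\<^sup>2"
    proof -
      have "0 \<le> cmod (f z) * cmod (g z)" by simp
      then show ?thesis using sum_squares_bound[of "cmod (f z)" "cmod (g z)"] by linarith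
    qed
    then show "norm (f z * cnj (g z)) \<le> norm ((cmod (f z))\<^sup>2 + (cmod (g z))\<^sup>2)" by (simp add: norm_mult)
  qed
qed

lemma bL2_add: "f \<in> bL2 lam \<Longrightarrow> g \<in> bL2 lam \<Longrightarrow> (\<lambda>z. f z + g z) \<in> bL2 lam"
proof -
  assume f: "f \<in> bL2 lam" and g: "g \<in> bL2 lam"
  have "integrable (bmeas lam) (\<lambda>z. (cmod (f z + g z))\<^sup>2)"
  proof (rule Bochner_Integration.integrable_bound)
    show "integrable (bmeas lam) (\<lambda>z. 2 * (cmod (f z))\<^sup>2 + 2 * (cmod (g z))\<^sup>2)"
      using f g by (auto simp: bL2_def)
    show "(\<lambda>z. (cmod (f z + g z))\<^sup>2) \<in> borel_measurable (bmeas lam)"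
      using f g by (auto simp: bL2_def)
    show "AE z in bmeas lam. norm ((cmod (f z + g z))\<^sup>2) \<le> norm (2 * (cmod (f z))\<^sup>2 + 2 * (cmod (g z))\<^sup>2)"
    proof (rule AE_I2)
      fix z
      have "(cmod (f z + g z))\<^sup>2 \<le> (cmod (f z) + cmod (g z))\<^sup>2"
        by (intro power_mono norm_triangle_ineq) simp
      also have "\<dots> \<le> 2 * (cmod (f z))\<^sup>2 + 2 * (cmod (g z))\<^sup>2"
        using sum_squares_bound[of "cmod (f z)" "cmod (g z)"] by (simp add: power2_sum)
      finally show "norm ((cmod (f z + g z))\<^sup>2) \<le> norm (2 * (cmod (f z))\<^sup>2 + 2 * (cmod (g z))\<^sup>2)"
        by simp
    qed
  qed
  then show ?thesis using f g by (auto simp: bL2_def)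
qed

lemma bL2_cmult: "f \<in> bL2 lam \<Longrightarrow> (\<lambda>z. c * f z) \<in> bL2 lam"
  by (auto simp: bL2_def norm_mult power_mult_distrib)

lemma bL2_diff: "f \<in> bL2 lam \<Longrightarrow> g \<in> bL2 lam \<Longrightarrow> (\<lambda>z. f z - g z) \<in> bL2 lam"
  using bL2_add[OF _ bL2_cmult[of g lam "-1"], of f] by simp

lemma bip_add_left:
  "f \<in> bL2 lam \<Longrightarrow> g \<in> bL2 lam \<Longrightarrow> h \<in> bL2 lam \<Longrightarrow> bip lam (\<lambda>z. f z + g z) h = bip lam f h + bip lam g h"
  unfolding bip_def by (simp add: distrib_right bL2_integrable_mult)

lemma bip_diff_left:
  "f \<in> bL2 lam \<Longrightarrow> g \<in> bL2 lam \<Longrightarrow> h \<in> bL2 lam \<Longrightarrow> bip lam (\<lambda>z. f z - g z) h = bip lam f h - bip lam g h"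
  unfolding bip_def by (simp add: left_diff_distrib bL2_integrable_mult)

lemma bip_cmult_left: "bip lam (\<lambda>z. c * f z) h = c * bip lam f h"
  unfolding bip_def by (simp add: mult.assoc)

lemma bip_cnj: "cnj (bip lam f g) = bip lam g f"
  unfolding bip_def
  by (subst integral_bounded_linear'[OF bounded_linear_cnj bounded_linear_cnj, symmetric]) (auto simp: mult.commute)

lemma bip_add_right:
  "f \<in> bL2 lam \<Longrightarrow> g \<in> bL2 lam \<Longrightarrow> h \<in> bL2 lam \<Longrightarrow> bip lam h (\<lambda>z. f z + g z) = bip lam h f + bip lam h g"
  using bip_add_left[of f lam g h] by (metis bip_cnj complex_cnj_add)

lemma bip_diff_right:
  "f \<in> bL2 lam \<Longrightarrow> g \<in> bL2 lam \<Longrightarrow> h \<in> bL2 lam \<Longrightarrow> bip lam h (\<lambda>z. f z - g z) = bip lam h f - bip lam h g"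
  using bip_diff_left[of f lam g h] by (metis bip_cnj complex_cnj_diff)

lemma bip_cmult_right: "bip lam h (\<lambda>z. c * f z) = cnj c * bip lam h f"
  using bip_cmult_left[of lam c f h] by (metis bip_cnj complex_cnj_mult)

lemma bip_self: "bip lam f f = of_real (bsq lam f)"
  by (simp add: bip_def bsq_def complex_norm_square[symmetric] del: of_real_power)

lemma bsq_cmult: "bsq lam (\<lambda>z. c * f z) = (cmod c)\<^sup>2 * bsq lam f"
  by (simp add: bsq_def norm_mult power_mult_distrib)

lemma bsq_add:
  assumes "f \<in> bL2 lam" "g \<in> bL2 lam"
  shows "bsq lam (\<lambda>z. f z + g z) = bsq lam f + bsq lam g + 2 * Re (bip lam f g)"
proof -
  have "complex_of_real (bsq lam (\<lambda>z. f z + g z)) = bip lam f f + bip lam g g + (bip lam f g + cnj (bip lam f g))"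
    using assms by (simp add: bip_self[symmetric] bip_add_left bip_add_right bL2_add bip_cnj)
  also have "\<dots> = complex_of_real (bsq lam f + bsq lam g + 2 * Re (bip lam f g))"
    by (simp add: bip_self complex_add_cnj)
  finally show ?thesis by (simp only: of_real_eq_iff)
qed

lemma bsq_diff:
  assumes "f \<in> bL2 lam" "g \<in> bL2 lam"
  shows "bsq lam (\<lambda>z. f z - g z) = bsq lam f + bsq lam g - 2 * Re (bip lam f g)"
  using bsq_add[OF assms(1) bL2_cmult[OF assms(2), of "-1"]] bsq_cmult[of lam "-1" g] bip_cmult_right[of lam f "-1" g]
  by simp

lemma bip_Cauchy_Schwarz:
  assumes "f \<in> bL2 lam" "g \<in> bL2 lam"
  shows "cmod (bip lam f g) \<le> sqrt (bsq lam f) * sqrt (bsq lam g)"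
proof -
  define p where "p = bip lam f g"
  have q: "0 \<le> bsq lam f + (cmod c)\<^sup>2 * bsq lam g + 2 * Re (cnj c * p)" for c
    using bsq_add[OF assms(1) bL2_cmult[OF assms(2), of c]] bsq_nonneg[of lam "\<lambda>z. f z + c * g z"]
    by (simp add: bsq_cmult bip_cmult_right p_def)
  have "(cmod p)\<^sup>2 \<le> bsq lam f * bsq lam g"
  proof (cases "bsq lam g = 0")
    case True
    have "p = 0"
    proof (rule ccontr)
      assume "p \<noteq> 0"
      \<comment> \<open>For this \<open>t\<close> the nonnegative quadratic expression would take
        the value \<open>- 1\<close>. The case needs its own argument since \<open>bsq\<close> is
        the square of a seminorm only.\<close>
      define t where "t = (bsq lam f + 1) / (2 * (cmod p)\<^sup>2)"
      have "cnj (- of_real t * p) * p = - of_real (t * (cmod p)\<^sup>2)"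
        by (simp add: complex_norm_square mult_ac del: of_real_power)
      then have "0 \<le> bsq lam f - 2 * (t * (cmod p)\<^sup>2)" using q[of "- of_real t * p"] True
        by (simp del: of_real_mult)
      moreover have "2 * (t * (cmod p)\<^sup>2) = bsq lam f + 1" using \<open>p \<noteq> 0\<close> by (simp add: t_def)
      ultimately show False by simp
    qed
    then show ?thesis by simp
  next
    case False
    then have b: "bsq lam g > 0" using bsq_nonneg[of lam g] by linarith
    define t where "t = 1 / bsq lam g"
    have "cnj (- of_real t * p) * p = - of_real (t * (cmod p)\<^sup>2)"
      by (simp add: complex_norm_square mult_ac del: of_real_power)
    then have "0 \<le> bsq lam f + t\<^sup>2 * (cmod p)\<^sup>2 * bsq lam g - 2 * (t * (cmod p)\<^sup>2)"
      using q[of "- of_real t * p"] by (simp add: norm_mult power_mult_distrib del: of_real_mult)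
    also have "t\<^sup>2 * (cmod p)\<^sup>2 * bsq lam g = t * (cmod p)\<^sup>2" using b by (simp add: t_def power2_eq_square)
    finally have "t * (cmod p)\<^sup>2 \<le> bsq lam f" by simp
    then show ?thesis using b by (simp add: t_def field_simps)
  qed
  then have "sqrt ((cmod p)\<^sup>2) \<le> sqrt (bsq lam f * bsq lam g)" by (rule real_sqrt_le_mono)
  then show ?thesis by (simp add: p_def real_sqrt_mult)
qed

subsection \<open>The Bergman space\<close>

text \<open>An element is continuous on the ball and zero elsewhere, hence Borel, so the completed
  sigma-algebra can be left behind.\<close>

lemma bergman_space_iff:
  "f \<in> bergman_space lam \<longleftrightarrow> holomorphic_in f (ball 0 1) \<and> f \<in> bL2 lam \<and> (\<forall>z. z \<notin> ball 0 1 \<longrightarrow> f z = 0)"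
proof -
  have "f \<in> borel_measurable borel" if "holomorphic_in f (ball 0 1)" "\<forall>z. z \<notin> ball 0 1 \<longrightarrow> f z = 0"
  proof -
    have "(\<lambda>z. indicator (ball 0 1) z *\<^sub>R f z) \<in> borel_measurable borel"
      using holomorphic_in_continuous_on[OF that(1)] by (intro borel_measurable_continuous_on_indicator) auto
    also have "(\<lambda>z. indicator (ball 0 1) z *\<^sub>R f z) = f"
      using that(2) by (auto simp: fun_eq_iff indicator_def)
    finally show ?thesis .
  qed
  moreover have "integrable (bergman_measure lam) (\<lambda>z. (norm (f z))\<^sup>2) \<longleftrightarrow> integrable (bmeas lam) (\<lambda>z. (norm (f z))\<^sup>2)"
    if [measurable]: "f \<in> borel_measurable borel"
    unfolding bmeas_def by (subst integrable_distr_eq) (auto intro: borel_measurable_bergman)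
  ultimately show ?thesis
    unfolding bergman_space_def square_integrable_def bL2_def using borel_measurable_bergman[of f lam] by blast
qed

lemma bergman_inner_eq:
  "f \<in> borel_measurable borel \<Longrightarrow> g \<in> borel_measurable borel \<Longrightarrow> bergman_inner lam f g = bip lam f g"
  unfolding bergman_inner_def bip_def bmeas_def
  by (subst integral_distr) (simp_all add: borel_measurable_bergman)

lemma bergman_norm_eq: "f \<in> borel_measurable borel \<Longrightarrow> bergman_norm lam f = sqrt (bsq lam f)"
  unfolding bergman_norm_def bsq_def bmeas_def
  by (subst integral_distr) (auto intro: borel_measurable_bergman)

lemma bergman_L2: "f \<in> bergman_space lam \<Longrightarrow> f \<in> bL2 lam"
  and bergman_holomorphic: "f \<in> bergman_space lam \<Longrightarrow> holomorphic_in f (ball 0 1)"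
  and bergman_outside: "f \<in> bergman_space lam \<Longrightarrow> z \<notin> ball 0 1 \<Longrightarrow> f z = 0"
  by (auto simp: bergman_space_iff)

lemma bergman_add: "f \<in> bergman_space lam \<Longrightarrow> g \<in> bergman_space lam \<Longrightarrow> (\<lambda>z. f z + g z) \<in> bergman_space lam"
  by (simp add: bergman_space_iff holomorphic_in_add bL2_add)

lemma bergman_diff: "f \<in> bergman_space lam \<Longrightarrow> g \<in> bergman_space lam \<Longrightarrow> (\<lambda>z. f z - g z) \<in> bergman_space lam"
  by (simp add: bergman_space_iff holomorphic_in_diff bL2_diff)

lemma bergman_cmult: "f \<in> bergman_space lam \<Longrightarrow> (\<lambda>z. c * f z) \<in> bergman_space lam"
  by (simp add: bergman_space_iff holomorphic_in_mult holomorphic_in_const bL2_cmult)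

lemma bergman_zero: "(\<lambda>z. 0) \<in> bergman_space lam"
  by (simp add: bergman_space_iff holomorphic_in_const bL2_def)

section \<open>Mean value inequalities\<close>

lemma holomorphic_circle_mean:
  assumes "\<phi> holomorphic_on S" "open S" "cball 0 1 \<subseteq> S"
  shows "ennreal ((cmod (\<phi> 0))\<^sup>2) \<le>
    (\<integral>\<^sup>+ t. ennreal ((cmod (\<phi> (exp (2 * of_real pi * \<i> * of_real t))))\<^sup>2) * indicator {0..1} t \<partial>lborel)"
proof -
  define e where "e t = exp (2 * of_real pi * \<i> * of_real t)" for t :: real
  have norm_e: "cmod (e t) = 1" for t
    using norm_exp_i_times[of "2 * pi * t"] by (simp add: e_def mult_ac)
  have cont_e: "continuous_on A e" for A unfolding e_def by (intro continuous_intros)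
  \<comment> \<open>Cauchy's formula is applied to the square of \<open>\<phi>\<close>: its value at
    the centre is its mean over the circle, and the modulus of that mean is at most the mean of
    \<open>(cmod \<phi>)\<^sup>2\<close>.\<close>
  define \<psi> where "\<psi> w = \<phi> w * \<phi> w" for w
  have hol: "\<psi> holomorphic_on S" unfolding \<psi>_def by (intro holomorphic_intros assms)
  have "((\<lambda>u. \<psi> u / (u - 0)) has_contour_integral (2 * of_real pi * \<i> * \<psi> 0)) (circlepath 0 1)"
    using hol assms by (intro Cauchy_integral_circlepath_simple) (auto intro: holomorphic_on_subset)
  then have "((\<lambda>t. \<psi> (e t) / e t * vector_derivative (circlepath 0 1) (at t within {0..1})) has_integral (2 * of_real pi * \<i> * \<psi> 0)) {0..1}"
    unfolding has_contour_integral_def by (simp add: circlepath_def part_circlepath_def linepath_def e_def mult_ac)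
  then have "((\<lambda>t. (2 * of_real pi * \<i>) * \<psi> (e t)) has_integral (2 * of_real pi * \<i>) * \<psi> 0) {0..1}"
  proof (rule has_integral_eq[rotated])
    fix t :: real assume t: "t \<in> {0..1}"
    have "e t \<noteq> 0" using norm_e[of t] by auto
    then show "\<psi> (e t) / e t * vector_derivative (circlepath 0 1) (at t within {0..1}) = 2 * of_real pi * \<i> * \<psi> (e t)"
      using vector_derivative_circlepath01[of t 0 1] t by (simp add: e_def mult_ac)
  qed
  then have I: "((\<lambda>t. \<psi> (e t)) has_integral \<psi> 0) {0..1}"
  proof -
    define c where "c = 2 * of_real pi * \<i>"
    assume "((\<lambda>t. (2 * of_real pi * \<i>) * \<psi> (e t)) has_integral (2 * of_real pi * \<i>) * \<psi> 0) {0..1}"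
    from has_integral_mult_right[OF this[folded c_def], of "inverse c"]
    have "((\<lambda>t. (inverse c * c) * \<psi> (e t)) has_integral (inverse c * c) * \<psi> 0) {0..1}"
      by (simp only: mult.assoc)
    moreover have "inverse c * c = 1" by (rule left_inverse) (simp add: c_def)
    ultimately show ?thesis by simp
  qed
  have in_S: "e t \<in> S" for t using assms(3) norm_e[of t] by (auto simp: subset_iff)
  have cont_\<phi>: "continuous_on {0..1} (\<lambda>t. \<phi> (e t))"
    using holomorphic_on_imp_continuous_on[OF assms(1)] in_S cont_e
    by (intro continuous_on_compose2[of S \<phi> _ e]) auto
  define h where "h t = (cmod (\<phi> (e t)))\<^sup>2" for t
  have h: "continuous_on {0..1} h" unfolding h_def by (intro continuous_intros cont_\<phi>)
  have "cmod (integral {0..1} (\<lambda>t. \<psi> (e t))) \<le> integral {0..1} h"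
    by (rule integral_norm_bound_integral[OF has_integral_integrable[OF I] integrable_continuous_interval[OF h]])
      (auto simp: \<psi>_def h_def norm_mult power2_eq_square)
  then have le: "(cmod (\<phi> 0))\<^sup>2 \<le> integral {0..1} h"
    using integral_unique[OF I] by (simp add: \<psi>_def norm_mult power2_eq_square)
  note si = borel_integrable_atLeastAtMost'[OF h]
  have "(\<integral>\<^sup>+ t. ennreal (h t) * indicator {0..1} t \<partial>lborel) = (\<integral>\<^sup>+ t. ennreal (indicator {0..1} t *\<^sub>R h t) \<partial>lborel)"
    by (intro nn_integral_cong) (auto simp: indicator_def)
  also have "\<dots> = ennreal (LINT t:{0..1}|lborel. h t)"
    using si unfolding set_integrable_def set_lebesgue_integral_def
    by (intro nn_integral_eq_integral) (auto simp: h_def)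
  also have "(LINT t:{0..1}|lborel. h t) = integral {0..1} h"
    by (rule set_borel_integral_eq_integral[OF si])
  finally show ?thesis using le by (simp add: h_def e_def ennreal_leI)
qed

text \<open>The circle inequality on the disc through \<open>z\<close> in direction \<open>u\<close>
  is integrated over all \<open>u\<close> in the ball. Each rotation
  \<open>u \<mapsto> e t *s u\<close> preserves Lebesgue measure, so after exchanging the integrals
  the one over \<open>t\<close> contributes the factor 1.\<close>

lemma holomorphic_ball_mean:
  fixes f :: "complex^'n::finite \<Rightarrow> complex"
  assumes f: "holomorphic_in f (ball 0 1)" and f0: "f \<in> borel_measurable borel"
    and r: "r > 0" "cball z r \<subseteq> ball 0 1"
  shows "ennreal ((cmod (f z))\<^sup>2) * emeasure lborel (ball (0::complex^'n) r)
    \<le> (\<integral>\<^sup>+ u. ennreal ((cmod (f u))\<^sup>2) * indicator (ball z r) u \<partial>lborel)"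
proof -
  note [measurable] = f0
  define e where "e t = exp (2 * of_real pi * \<i> * of_real t)" for t :: real
  have norm_e: "cmod (e t) = 1" for t
    using norm_exp_i_times[of "2 * pi * t"] by (simp add: e_def mult_ac)
  have [measurable]: "e \<in> borel_measurable borel"
    unfolding e_def[abs_def] by (intro borel_measurable_continuous_onI continuous_intros)
  let ?B = "ball (0::complex^'n) r"
  let ?F = "\<lambda>t u. ennreal ((cmod (f (z + e t *s u)))\<^sup>2) * indicator {0..1} t * indicator ?B u"
  have m2: "(\<lambda>p. z + e (fst p) *s snd p) \<in> borel_measurable (borel \<Otimes>\<^sub>M borel)"
    by (rule borel_measurable_vecI) (simp, measurable)
  have ptw: "ennreal ((cmod (f z))\<^sup>2) * indicator ?B u \<le> (\<integral>\<^sup>+ t. ?F t u \<partial>lborel)" for u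
  proof (cases "u \<in> ?B")
    case True
    define S where "S = {t. z + t *s u \<in> ball 0 1}"
    have "open S"
    proof -
      have "S = (\<lambda>t. z + t *s u) -` ball 0 1" by (auto simp: S_def)
      moreover have "continuous_on UNIV (\<lambda>t. z + t *s u)"
        by (intro continuous_at_imp_continuous_on ballI has_derivative_continuous[OF has_derivative_line])
      ultimately show ?thesis using open_vimage[OF open_ball] by metis
    qed
    moreover have "cball 0 1 \<subseteq> S"
    proof
      fix t :: complex assume "t \<in> cball 0 1"
      then have "cmod t * norm u \<le> 1 * norm u" by (intro mult_right_mono) auto
      then have "z + t *s u \<in> cball z r" using True by (simp add: dist_norm norm_vec_smult)
      then show "t \<in> S" using r by (auto simp: S_def)
    qed
    moreover have "(\<lambda>t. f (z + t *s u)) holomorphic_on S" unfolding S_def by (rule holomorphic_in_line[OF f])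
    ultimately have "ennreal ((cmod (f (z + 0 *s u)))\<^sup>2) \<le>
      (\<integral>\<^sup>+ t. ennreal ((cmod (f (z + exp (2 * of_real pi * \<i> * of_real t) *s u)))\<^sup>2) * indicator {0..1} t \<partial>lborel)"
      by (intro holomorphic_circle_mean[where \<phi>="\<lambda>t. f (z + t *s u)" and S=S])
    then show ?thesis using True by (simp add: e_def)
  qed simp
  have rot: "(\<integral>\<^sup>+ u. ennreal ((cmod (f (z + e t *s u)))\<^sup>2) * indicator ?B u \<partial>lborel)
      = (\<integral>\<^sup>+ u. ennreal ((cmod (f u))\<^sup>2) * indicator (ball z r) u \<partial>lborel)" for t
  proof -
    have "(\<integral>\<^sup>+ u. ennreal ((cmod (f (z + u)))\<^sup>2) * indicator ?B u \<partial>lborel) =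
      ennreal (1 ^ DIM(complex^'n)) * (\<integral>\<^sup>+ u. ennreal ((cmod (f (z + e t *s u)))\<^sup>2) * indicator ?B (e t *s u) \<partial>lborel)"
      by (rule nn_integral_similarity) (auto simp: linear_smult_left norm_vec_smult norm_e)
    also have "\<dots> = (\<integral>\<^sup>+ u. ennreal ((cmod (f (z + e t *s u)))\<^sup>2) * indicator ?B u \<partial>lborel)"
      by (simp add: indicator_def norm_vec_smult norm_e)
    finally have "(\<integral>\<^sup>+ u. ennreal ((cmod (f (z + e t *s u)))\<^sup>2) * indicator ?B u \<partial>lborel)
      = (\<integral>\<^sup>+ u. ennreal ((cmod (f (z + u)))\<^sup>2) * indicator ?B u \<partial>lborel)" by simp
    also have "\<dots> = (\<integral>\<^sup>+ u. ennreal ((cmod (f (z + u)))\<^sup>2) * indicator (ball z r) (z + u) \<partial>lborel)"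
      by (simp add: indicator_def dist_norm)
    also have "\<dots> = (\<integral>\<^sup>+ u. ennreal ((cmod (f u))\<^sup>2) * indicator (ball z r) u \<partial>distr lborel borel ((+) z))"
      by (subst nn_integral_distr) simp_all
    finally show ?thesis by (simp add: lborel_distr_plus)
  qed
  have "ennreal ((cmod (f z))\<^sup>2) * emeasure lborel ?B = (\<integral>\<^sup>+ u. ennreal ((cmod (f z))\<^sup>2) * indicator ?B u \<partial>lborel)"
    by (simp add: nn_integral_cmult)
  also have "\<dots> \<le> (\<integral>\<^sup>+ u. \<integral>\<^sup>+ t. ?F t u \<partial>lborel \<partial>lborel)"
    by (intro nn_integral_mono ptw)
  also have "\<dots> = (\<integral>\<^sup>+ t. \<integral>\<^sup>+ u. ?F t u \<partial>lborel \<partial>lborel)"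
    by (rule lborel_pair.Fubini') (use m2 in measurable)
  also have "\<dots> = (\<integral>\<^sup>+ t. indicator {0..1::real} t * (\<integral>\<^sup>+ u. ennreal ((cmod (f u))\<^sup>2) * indicator (ball z r) u \<partial>lborel) \<partial>lborel)"
  proof (rule nn_integral_cong)
    fix t :: real
    have [measurable]: "(\<lambda>u. z + e t *s u) \<in> borel_measurable borel" by (rule borel_measurable_vecI) simp
    have "(\<integral>\<^sup>+ u. ?F t u \<partial>lborel) = (\<integral>\<^sup>+ u. indicator {0..1} t * (ennreal ((cmod (f (z + e t *s u)))\<^sup>2) * indicator ?B u) \<partial>lborel)"
      by (simp add: mult_ac)
    also have "\<dots> = indicator {0..1} t * (\<integral>\<^sup>+ u. ennreal ((cmod (f (z + e t *s u)))\<^sup>2) * indicator ?B u \<partial>lborel)"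
      by (rule nn_integral_cmult) measurable
    finally show "(\<integral>\<^sup>+ u. ?F t u \<partial>lborel) = indicator {0..1} t * (\<integral>\<^sup>+ u. ennreal ((cmod (f u))\<^sup>2) * indicator (ball z r) u \<partial>lborel)"
      by (simp only: rot)
  qed
  also have "\<dots> = (\<integral>\<^sup>+ u. ennreal ((cmod (f u))\<^sup>2) * indicator (ball z r) u \<partial>lborel)"
    by (subst nn_integral_multc) simp_all
  finally show ?thesis .
qed

locale bergman =
  fixes lam :: real and N :: "'n::finite itself"
  assumes lam: "lam > real CARD('n)"
begin

abbreviation A2 :: "(complex^'n \<Rightarrow> complex) set" where
  "A2 \<equiv> bergman_space lam"

lemma bweight_lower_bound:
  assumes "\<rho> < 1"
  obtains c where "c > 0" "\<And>z :: complex^'n. z \<in> cball 0 \<rho> \<Longrightarrow> c \<le> bweight lam z"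
proof (cases "\<rho> \<ge> 0")
  case True
  define p where "p = lam - real CARD('n) - 1"
  have \<rho>2: "\<rho>\<^sup>2 < 1" using True assms by (simp add: power_less_one_iff)
  \<comment> \<open>The exponent \<open>p\<close> may have either sign: for \<open>p \<ge> 0\<close>
    the weight is smallest at radius \<open>\<rho>\<close>, and otherwise it is at least 1.\<close>
  show thesis
  proof (rule that[of "min 1 ((1 - \<rho>\<^sup>2) powr p)"])
    show "0 < min 1 ((1 - \<rho>\<^sup>2) powr p)" using \<rho>2 by simp
    fix z :: "complex^'n" assume z: "z \<in> cball 0 \<rho>"
    then have zz: "(norm z)\<^sup>2 \<le> \<rho>\<^sup>2" by (intro power_mono) auto
    have w: "bweight lam z = (1 - (norm z)\<^sup>2) powr p" using z assms by (simp add: bweight_def p_def)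
    show "min 1 ((1 - \<rho>\<^sup>2) powr p) \<le> bweight lam z"
    proof (cases "p \<ge> 0")
      case True
      then have "(1 - \<rho>\<^sup>2) powr p \<le> (1 - (norm z)\<^sup>2) powr p" using zz \<rho>2 by (intro powr_mono2) auto
      then show ?thesis by (simp add: w)
    next
      case False
      then have "1 powr p \<le> (1 - (norm z)\<^sup>2) powr p" using zz \<rho>2 by (intro powr_mono2') auto
      then show ?thesis by (simp add: w)
    qed
  qed
qed (auto intro: that[of 1])

lemma bL2_nn_integral:
  assumes "f \<in> bL2 lam"
  shows "(\<integral>\<^sup>+ z. ennreal ((cmod (f z))\<^sup>2) \<partial>bmeas lam) = ennreal (bsq lam f)"
  using assms unfolding bL2_def bsq_def by (intro nn_integral_eq_integral) auto

lemma bL2_iff_nn_integral: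
  "f \<in> bL2 lam \<longleftrightarrow> f \<in> borel_measurable borel \<and> (\<integral>\<^sup>+ z. ennreal ((cmod (f z))\<^sup>2) \<partial>bmeas lam) < \<infinity>"
  unfolding bL2_def by (auto simp: integrable_iff_bounded)

text \<open>The mean value inequality on balls of a fixed radius \<open>r\<close>, together with the
  positive lower bound of the weight on the slightly larger ball
  \<open>cball 0 (\<rho> + r)\<close>. The constant is uniform on compact subsets, so convergence in
  norm is locally uniform.\<close>

lemma point_evaluation:
  assumes "\<rho> < 1"
  obtains C where "C \<ge> 0" "\<And>f z. f \<in> A2 \<Longrightarrow> z \<in> cball 0 \<rho> \<Longrightarrow> cmod (f z) \<le> C * sqrt (bsq lam f)"
proof -
  define r where "r = (1 - \<rho>) / 2"
  have r: "r > 0" "\<rho> + r < 1" using assms by (auto simp: r_def field_simps)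
  obtain \<kappa> where \<kappa>: "0 < \<kappa>" "\<And>f :: complex^'n \<Rightarrow> ennreal. f \<in> borel_measurable borel \<Longrightarrow>
    (\<integral>\<^sup>+ z. f z \<partial>bmeas lam) = ennreal \<kappa> * (\<integral>\<^sup>+ z. ennreal (bweight lam z) * f z \<partial>lborel)"
    using nn_integral_bmeas_exists[OF lam] by blast
  obtain c where c: "c > 0" "\<And>z :: complex^'n. z \<in> cball 0 (\<rho> + r) \<Longrightarrow> c \<le> bweight lam z"
    using bweight_lower_bound[OF r(2)] by blast
  obtain v where v: "v > 0" "emeasure lborel (ball (0::complex^'n) r) = ennreal v"
  proof -
    have "unit_ball_vol (real DIM(complex^'n)) * r ^ DIM(complex^'n) > 0"
      using r by (intro mult_pos_pos unit_ball_vol_pos) auto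
    then show thesis using that r by (metis emeasure_ball less_imp_le)
  qed
  define C where "C = 1 / (\<kappa> * c * v)"
  have C: "C > 0" using \<kappa> c v by (simp add: C_def)
  show thesis
  proof (rule that[of "sqrt C"])
    show "0 \<le> sqrt C" using C by simp
    fix f and z :: "complex^'n" assume f: "f \<in> A2" and z: "z \<in> cball 0 \<rho>"
    have [measurable]: "f \<in> borel_measurable borel" using bL2_measurable[OF bergman_L2[OF f]] .
    have sub: "cball z r \<subseteq> cball 0 (\<rho> + r)"
    proof
      fix y assume "y \<in> cball z r"
      then show "y \<in> cball 0 (\<rho> + r)"
        using z norm_triangle_ineq[of z "y - z"] by (simp add: dist_norm norm_minus_commute)
    qed
    then have "ennreal ((cmod (f z))\<^sup>2) * ennreal v \<le> (\<integral>\<^sup>+ u. ennreal ((cmod (f u))\<^sup>2) * indicator (ball z r) u \<partial>lborel)"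
      unfolding v(2)[symmetric] using r
      by (intro holomorphic_ball_mean bergman_holomorphic[OF f]) (auto simp: subset_iff)
    then have "ennreal (\<kappa> * c) * (ennreal ((cmod (f z))\<^sup>2) * ennreal v) \<le>
      ennreal (\<kappa> * c) * (\<integral>\<^sup>+ u. ennreal ((cmod (f u))\<^sup>2) * indicator (ball z r) u \<partial>lborel)"
      by (rule mult_left_mono) simp
    also have "\<dots> = ennreal \<kappa> * (\<integral>\<^sup>+ u. ennreal c * (ennreal ((cmod (f u))\<^sup>2) * indicator (ball z r) u) \<partial>lborel)"
      using \<kappa> c by (simp add: nn_integral_cmult ennreal_mult mult.assoc)
    also have "\<dots> \<le> ennreal \<kappa> * (\<integral>\<^sup>+ u. ennreal (bweight lam u) * ennreal ((cmod (f u))\<^sup>2) \<partial>lborel)"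
    proof (intro mult_left_mono nn_integral_mono)
      fix u
      show "ennreal c * (ennreal ((cmod (f u))\<^sup>2) * indicator (ball z r) u) \<le> ennreal (bweight lam u) * ennreal ((cmod (f u))\<^sup>2)"
      proof (cases "u \<in> ball z r")
        case True
        then have "u \<in> cball z r" by simp
        then have "u \<in> cball 0 (\<rho> + r)" using sub by blast
        then show ?thesis using c(2)[of u] True by (auto intro!: mult_right_mono ennreal_leI)
      qed simp
    qed simp
    also have "\<dots> = (\<integral>\<^sup>+ u. ennreal ((cmod (f u))\<^sup>2) \<partial>bmeas lam)"
      by (rule \<kappa>(2)[symmetric]) measurable
    also have "\<dots> = ennreal (bsq lam f)" by (rule bL2_nn_integral[OF bergman_L2[OF f]])
    finally have "ennreal (\<kappa> * c * ((cmod (f z))\<^sup>2 * v)) \<le> ennreal (bsq lam f)"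
      using \<kappa> c v by (simp add: ennreal_mult)
    then have "\<kappa> * c * ((cmod (f z))\<^sup>2 * v) \<le> bsq lam f" by (subst (asm) ennreal_le_iff) auto
    then have "(cmod (f z))\<^sup>2 \<le> C * bsq lam f" using \<kappa> c v by (simp add: C_def field_simps)
    then have "sqrt ((cmod (f z))\<^sup>2) \<le> sqrt (C * bsq lam f)" by (rule real_sqrt_le_mono)
    then show "cmod (f z) \<le> sqrt C * sqrt (bsq lam f)" by (simp add: real_sqrt_mult)
  qed
qed

lemma bergman_bsq_zero:
  assumes "f \<in> A2" "bsq lam f = 0"
  shows "f z = 0"
proof (cases "z \<in> ball 0 1")
  case True
  then have "norm z < 1" by simp
  then obtain C where "\<And>f z'. f \<in> A2 \<Longrightarrow> z' \<in> cball 0 (norm z) \<Longrightarrow> cmod (f z') \<le> C * sqrt (bsq lam f)"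
    by (rule point_evaluation) blast
  from this[OF assms(1), of z] show ?thesis using assms(2) by simp
qed (use assms bergman_outside in auto)

text \<open>Point evaluation turns the sequence into a locally uniform Cauchy sequence, whose limit
  is holomorphic. Fatou's lemma shows that the limit is square-integrable and that the convergence
  also holds in norm.\<close>

lemma bergman_complete:
  assumes F: "\<And>k::nat. F k \<in> A2"
    and Cauchy: "\<And>e. e > 0 \<Longrightarrow> \<exists>K. \<forall>m\<ge>K. \<forall>n\<ge>K. bsq lam (\<lambda>z. F m z - F n z) < e"
  obtains h where "h \<in> A2" "(\<lambda>k. bsq lam (\<lambda>z. F k z - h z)) \<longlonglongrightarrow> 0"
proof -
  have unif: "uniformly_convergent_on (cball 0 \<rho>) F" if \<rho>: "\<rho> < 1" for \<rho>
  proof (rule Cauchy_uniformly_convergent, rule uniformly_Cauchy_onI)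
    fix e :: real assume e: "e > 0"
    obtain C where C: "C \<ge> 0" "\<And>f z. f \<in> A2 \<Longrightarrow> z \<in> cball 0 \<rho> \<Longrightarrow> cmod (f z) \<le> C * sqrt (bsq lam f)"
      using point_evaluation[OF \<rho>] by blast
    have "(e / (C + 1))\<^sup>2 > 0" using C e by simp
    from Cauchy[OF this] obtain K where K: "\<And>m n. m \<ge> K \<Longrightarrow> n \<ge> K \<Longrightarrow> bsq lam (\<lambda>z. F m z - F n z) < (e / (C + 1))\<^sup>2" by blast
    show "\<exists>M. \<forall>x\<in>cball 0 \<rho>. \<forall>m\<ge>M. \<forall>n\<ge>M. dist (F m x) (F n x) < e"
    proof (intro exI ballI allI impI)
      fix x m n assume x: "x \<in> cball (0::complex^'n) \<rho>" and "K \<le> m" "K \<le> n"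
      then have "sqrt (bsq lam (\<lambda>z. F m z - F n z)) < sqrt ((e / (C + 1))\<^sup>2)" using K real_sqrt_less_mono by blast
      also have "\<dots> = e / (C + 1)" using C e by simp
      finally have s: "sqrt (bsq lam (\<lambda>z. F m z - F n z)) < e / (C + 1)" .
      have "cmod (F m x - F n x) \<le> C * sqrt (bsq lam (\<lambda>z. F m z - F n z))"
        by (rule C(2)[OF bergman_diff[OF F F] x])
      also have "\<dots> \<le> C * (e / (C + 1))" using s C by (intro mult_left_mono) auto
      also have "\<dots> < e" using C e by (simp add: field_simps)
      finally show "dist (F m x) (F n x) < e" by (simp add: dist_norm)
    qed
  qed
  define l where "l z = lim (\<lambda>k. F k z)" for z
  define h where "h z = (if z \<in> ball 0 1 then l z else 0)" for z
  have ul: "uniform_limit (cball 0 \<rho>) F l sequentially" if "\<rho> < 1" for \<rho>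
    using unif[OF that] by (simp add: uniformly_convergent_uniform_limit_iff l_def[abs_def])
  have "holomorphic_in l (ball 0 1)"
    by (rule holomorphic_in_sequence[OF bergman_holomorphic[OF F] ul])
  then have hol: "holomorphic_in h (ball 0 1)"
    by (rule holomorphic_in_cong) (auto simp: h_def)
  have ptw: "(\<lambda>k. F k z) \<longlonglongrightarrow> h z" for z
  proof (cases "z \<in> ball 0 1")
    case True
    then show ?thesis using tendsto_uniform_limitI[OF ul[of "norm z"], of z] by (simp add: h_def)
  next
    case False
    then show ?thesis using bergman_outside[OF F False] by (simp add: h_def)
  qed
  have meas[measurable]: "F k \<in> borel_measurable borel" for k by (rule bL2_measurable[OF bergman_L2[OF F]])
  have hm[measurable]: "h \<in> borel_measurable borel"
    by (rule borel_measurable_LIMSEQ_metric[OF meas ptw])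
  have fatou: "(\<integral>\<^sup>+ z. ennreal ((cmod (F k z - h z))\<^sup>2) \<partial>bmeas lam) \<le> ennreal e"
    if K: "\<And>m n. m \<ge> K \<Longrightarrow> n \<ge> K \<Longrightarrow> bsq lam (\<lambda>z. F m z - F n z) < e" "k \<ge> K" for k K e
  proof -
    have "(\<integral>\<^sup>+ z. ennreal ((cmod (F k z - h z))\<^sup>2) \<partial>bmeas lam) =
      (\<integral>\<^sup>+ z. liminf (\<lambda>n. ennreal ((cmod (F k z - F n z))\<^sup>2)) \<partial>bmeas lam)"
    proof (rule nn_integral_cong)
      fix z
      have "(\<lambda>n. ennreal ((cmod (F k z - F n z))\<^sup>2)) \<longlonglongrightarrow> ennreal ((cmod (F k z - h z))\<^sup>2)"
        by (intro tendsto_intros ptw)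
      then show "ennreal ((cmod (F k z - h z))\<^sup>2) = liminf (\<lambda>n. ennreal ((cmod (F k z - F n z))\<^sup>2))"
        by (rule lim_imp_Liminf[symmetric, rotated]) simp
    qed
    also have "\<dots> \<le> liminf (\<lambda>n. \<integral>\<^sup>+ z. ennreal ((cmod (F k z - F n z))\<^sup>2) \<partial>bmeas lam)"
      by (rule nn_integral_liminf) measurable
    also have "\<dots> = liminf (\<lambda>n. ennreal (bsq lam (\<lambda>z. F k z - F n z)))"
      by (simp add: bL2_nn_integral bL2_diff bergman_L2 F)
    also have "\<dots> \<le> ennreal e"
    proof (rule Liminf_le)
      show "\<forall>\<^sub>F n in sequentially. ennreal (bsq lam (\<lambda>z. F k z - F n z)) \<le> ennreal e"
        using eventually_ge_at_top[of K] by eventually_elim (rule ennreal_leI, rule less_imp_le, rule K(1)[OF K(2)])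
    qed simp
    finally show ?thesis .
  qed
  obtain K0 where K0: "\<And>m n. m \<ge> K0 \<Longrightarrow> n \<ge> K0 \<Longrightarrow> bsq lam (\<lambda>z. F m z - F n z) < 1"
    using Cauchy[of 1] by auto
  have diffL2: "(\<lambda>z. F K0 z - h z) \<in> bL2 lam"
  proof -
    have "(\<integral>\<^sup>+ z. ennreal ((cmod (F K0 z - h z))\<^sup>2) \<partial>bmeas lam) \<le> ennreal 1"
      by (rule fatou[of K0]) (use K0 in auto)
    then show ?thesis unfolding bL2_iff_nn_integral by (auto intro: le_less_trans)
  qed
  have "h \<in> bL2 lam"
    using bL2_diff[OF bergman_L2[OF F[of K0]] diffL2] by simp
  then have hA: "h \<in> A2" using hol by (auto simp: bergman_space_iff h_def)
  moreover have "(\<lambda>k. bsq lam (\<lambda>z. F k z - h z)) \<longlonglongrightarrow> 0"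
  proof (rule LIMSEQ_I)
    fix e :: real assume e: "e > 0"
    obtain K where K: "\<And>m n. m \<ge> K \<Longrightarrow> n \<ge> K \<Longrightarrow> bsq lam (\<lambda>z. F m z - F n z) < e / 2"
      using Cauchy[of "e / 2"] e by auto
    have "bsq lam (\<lambda>z. F k z - h z) < e" if "k \<ge> K" for k
    proof -
      have "ennreal (bsq lam (\<lambda>z. F k z - h z)) \<le> ennreal (e / 2)"
        using fatou[OF K that] bL2_nn_integral[OF bL2_diff[OF bergman_L2[OF F] bergman_L2[OF hA]], of k] by simp
      then show ?thesis using e by (subst (asm) ennreal_le_iff) auto
    qed
    then show "\<exists>no. \<forall>n\<ge>no. norm (bsq lam (\<lambda>z. F n z - h z) - 0) < e" by auto
  qed
  ultimately show thesis by (rule that)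
qed

end

text \<open>With this it is enough to check unitarity on norms, which are accessible to nonnegative
  integrals.\<close>

lemma bip_polarization:
  assumes "f \<in> bL2 lam" "g \<in> bL2 lam"
  shows "Re (bip lam f g) = (bsq lam (\<lambda>z. f z + g z) - bsq lam f - bsq lam g) / 2"
    and "Im (bip lam f g) = (bsq lam (\<lambda>z. f z + \<i> * g z) - bsq lam f - bsq lam g) / 2"
proof -
  show "Re (bip lam f g) = (bsq lam (\<lambda>z. f z + g z) - bsq lam f - bsq lam g) / 2"
    by (simp add: bsq_add assms)
  have "bsq lam (\<lambda>z. f z + \<i> * g z) = bsq lam f + bsq lam g + 2 * Re (bip lam f (\<lambda>z. \<i> * g z))"
    using bsq_add[OF assms(1) bL2_cmult[OF assms(2), of \<i>]] by (simp add: bsq_cmult)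
  then show "Im (bip lam f g) = (bsq lam (\<lambda>z. f z + \<i> * g z) - bsq lam f - bsq lam g) / 2"
    by (simp add: bip_cmult_right)
qed

context bergman
begin

text \<open>The representing function minimises \<open>bsq lam f - 2 * Re (L f)\<close>.\<close>

lemma riesz_representation:
  assumes add: "\<And>f g. f \<in> A2 \<Longrightarrow> g \<in> A2 \<Longrightarrow> L (\<lambda>z. f z + g z) = L f + L g"
    and cmult: "\<And>c f. f \<in> A2 \<Longrightarrow> L (\<lambda>z. c * f z) = c * L f"
    and bound: "\<And>f. f \<in> A2 \<Longrightarrow> cmod (L f) \<le> C * sqrt (bsq lam f)"
  obtains h where "h \<in> A2" "\<And>f. f \<in> A2 \<Longrightarrow> L f = bip lam f h"
proof -
  define Q where "Q f = bsq lam f - 2 * Re (L f)" for f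
  define q where "q = Inf (Q ` A2)"
  have "- C\<^sup>2 \<le> Q f" if "f \<in> A2" for f
  proof -
    define s where "s = sqrt (bsq lam f)"
    have "Re (L f) \<le> s * C" using bound[OF that] complex_Re_le_cmod[of "L f"] by (simp add: s_def mult.commute)
    moreover have "bsq lam f = s\<^sup>2" by (simp add: s_def)
    moreover have "0 \<le> s\<^sup>2 + C\<^sup>2 - 2 * (s * C)"
      using zero_le_power2[of "s - C"] unfolding power2_diff by (simp only: mult.assoc)
    ultimately show ?thesis unfolding Q_def by linarith
  qed
  then have bdd: "bdd_below (Q ` A2)" by (auto intro!: bdd_belowI[of _ "- C\<^sup>2"])
  have q: "q \<le> Q f" if "f \<in> A2" for f
    unfolding q_def by (rule cInf_lower[OF _ bdd]) (use that in auto)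
  have "\<exists>f. f \<in> A2 \<and> Q f < q + 1 / real (Suc k)" for k
  proof -
    have "Q ` A2 \<noteq> {}" using bergman_zero by blast
    moreover have "Inf (Q ` A2) < q + 1 / real (Suc k)" by (simp add: q_def)
    ultimately show ?thesis using cInf_less_iff[OF _ bdd] by auto
  qed
  then obtain F where F: "\<And>k. F k \<in> A2" and QF: "\<And>k. Q (F k) < q + 1 / real (Suc k)" by metis
  \<comment> \<open>The parallelogram identity with the midpoint \<open>?m\<close> as competitor; it
    makes the minimising sequence Cauchy.\<close>
  have par: "bsq lam (\<lambda>z. f z - g z) \<le> 2 * (Q f - q) + 2 * (Q g - q)" if f: "f \<in> A2" and g: "g \<in> A2" for f g
  proof -
    let ?m = "\<lambda>z. (1 / 2) * (f z + g z)"
    have m: "?m \<in> A2" by (intro bergman_cmult bergman_add f g)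
    have "L ?m = (1 / 2) * (L f + L g)"
      using cmult[OF bergman_add[OF f g], of "1/2"] add[OF f g] by simp
    then have 1: "Re (L ?m) = (Re (L f) + Re (L g)) / 2" by (simp only:) simp
    have 2: "bsq lam ?m = (1 / 4) * bsq lam (\<lambda>z. f z + g z)"
      using bsq_cmult[of lam "1/2" "\<lambda>z. f z + g z"] by (simp add: power2_eq_square norm_divide)
    have "4 * Q ?m + bsq lam (\<lambda>z. f z - g z) = 2 * Q f + 2 * Q g"
      unfolding Q_def 1 2 bsq_add[OF bergman_L2[OF f] bergman_L2[OF g]] bsq_diff[OF bergman_L2[OF f] bergman_L2[OF g]]
      by (simp add: algebra_simps)
    then show ?thesis using q[OF m] by simp
  qed
  obtain h where h: "h \<in> A2" "(\<lambda>k. bsq lam (\<lambda>z. F k z - h z)) \<longlonglongrightarrow> 0"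
  proof (rule bergman_complete[OF F])
    fix e :: real assume e: "e > 0"
    then obtain K where K: "1 / real (Suc K) < e / 4" using nat_approx_posE[of "e / 4"] by auto
    have "bsq lam (\<lambda>z. F m z - F n z) < e" if "m \<ge> K" "n \<ge> K" for m n
    proof -
      have small: "Q (F m) - q < e / 4" if "m \<ge> K" for m
      proof -
        have "Q (F m) - q < 1 / real (Suc m)" using QF[of m] by (simp only: less_diff_eq diff_less_eq add.commute)
        also have "\<dots> \<le> 1 / real (Suc K)" using that by (intro divide_left_mono) auto
        finally show ?thesis using K by (rule less_trans)
      qed
      have "bsq lam (\<lambda>z. F m z - F n z) \<le> 2 * (Q (F m) - q) + 2 * (Q (F n) - q)" by (rule par[OF F F])
      also have "\<dots> < e" using small[OF that(1)] small[OF that(2)] by (simp only: mult_2)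
      finally show ?thesis .
    qed
    then show "\<exists>K. \<forall>m\<ge>K. \<forall>n\<ge>K. bsq lam (\<lambda>z. F m z - F n z) < e" by blast
  qed
  show thesis
  proof (rule that[OF h(1)])
    fix g assume g: "g \<in> A2"
    define b where "b = bsq lam g"
    have b: "b \<ge> 0" by (simp add: b_def)
    define d where "d k = bip lam g (F k) - L g" for k
    have dk: "(cmod (d k))\<^sup>2 \<le> (b + 1) * (1 / real (Suc k))" for k
    proof -
      \<comment> \<open>The competitor \<open>F k + c * g\<close> is tested with a near-optimal
        \<open>c\<close>. The optimal factor is \<open>1 / b\<close>; \<open>1 / (b + 1)\<close>
        does as well and is defined for \<open>b = 0\<close> too.\<close>
      define t where "t = 1 / (b + 1)"
      define c where "c = - of_real t * cnj (d k)"
      have "Q (\<lambda>z. F k z + c * g z) = Q (F k) + (cmod c)\<^sup>2 * b + 2 * Re (c * d k)"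
      proof -
        have "Re (bip lam (F k) (\<lambda>z. c * g z)) = Re (c * bip lam g (F k))"
          unfolding bip_cmult_right by (metis bip_cnj cnj.simps(1) complex_cnj_mult complex_cnj_cnj)
        then show ?thesis
          using F[of k] g by (simp add: Q_def bsq_add bergman_L2 bL2_cmult bsq_cmult add bergman_cmult cmult b_def d_def right_diff_distrib)
      qed
      moreover have "q \<le> Q (\<lambda>z. F k z + c * g z)" by (intro q bergman_add bergman_cmult F g)
      moreover have "c * d k = - of_real (t * (cmod (d k))\<^sup>2)"
        by (simp add: c_def complex_norm_square mult_ac del: of_real_power)
      then have "Re (c * d k) = - t * (cmod (d k))\<^sup>2" by simp
      moreover have "(cmod c)\<^sup>2 * b \<le> t * (cmod (d k))\<^sup>2"
      proof -
        have "t \<ge> 0" using b by (simp add: t_def)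
        then have "cmod c = t * cmod (d k)"
          by (simp only: c_def norm_mult norm_minus_cancel norm_of_real complex_mod_cnj abs_of_nonneg)
        then have "(cmod c)\<^sup>2 * b = t * (cmod (d k))\<^sup>2 * (t * b)"
          by (simp add: power_mult_distrib power2_eq_square)
        also have "\<dots> \<le> t * (cmod (d k))\<^sup>2 * 1"
          using b by (intro mult_left_mono) (auto simp: t_def)
        finally show ?thesis by simp
      qed
      ultimately have "t * (cmod (d k))\<^sup>2 \<le> 1 / real (Suc k)" using QF[of k] by linarith
      then show ?thesis using b by (simp add: t_def field_simps)
    qed
    have "(\<lambda>k. (b + 1) * (1 / real (Suc k))) \<longlonglongrightarrow> (b + 1) * 0"
      by (intro tendsto_intros LIMSEQ_Suc[OF lim_1_over_n])
    then have "(\<lambda>k. (cmod (d k))\<^sup>2) \<longlonglongrightarrow> 0"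
    proof (intro Lim_null_comparison[of "\<lambda>k. (cmod (d k))\<^sup>2"] always_eventually allI)
      show "norm ((cmod (d k))\<^sup>2) \<le> (b + 1) * (1 / real (Suc k))" for k using dk[of k] by simp
    qed simp
    then have "(\<lambda>k. sqrt ((cmod (d k))\<^sup>2)) \<longlonglongrightarrow> sqrt 0" by (rule tendsto_real_sqrt)
    then have d0: "d \<longlonglongrightarrow> 0" by (simp add: tendsto_norm_zero_iff)
    have "(\<lambda>k. bip lam g (\<lambda>z. F k z - h z)) \<longlonglongrightarrow> 0"
    proof (rule Lim_null_comparison)
      show "\<forall>\<^sub>F k in sequentially. norm (bip lam g (\<lambda>z. F k z - h z)) \<le> sqrt b * sqrt (bsq lam (\<lambda>z. F k z - h z))"
        unfolding b_def by (intro always_eventually allI bip_Cauchy_Schwarz bergman_L2 g bergman_diff F h)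
      have "(\<lambda>k. sqrt b * sqrt (bsq lam (\<lambda>z. F k z - h z))) \<longlonglongrightarrow> sqrt b * sqrt 0"
        by (intro tendsto_intros h)
      then show "(\<lambda>k. sqrt b * sqrt (bsq lam (\<lambda>z. F k z - h z))) \<longlonglongrightarrow> 0" by simp
    qed
    from tendsto_diff[OF d0 this] have "(\<lambda>k. bip lam g h - L g) \<longlonglongrightarrow> 0"
      using F g h(1) by (simp add: d_def bip_diff_right bergman_L2)
    then show "L g = bip lam g h" by (simp add: LIMSEQ_const_iff)
  qed
qed

subsection \<open>The reproducing kernel\<close>

text \<open>\<open>kern w z\<close> is the Bergman kernel \<open>K(z, w)\<close>: holomorphic in
  \<open>z\<close> and antiholomorphic in \<open>w\<close>.\<close>

definition kern :: "complex^'n \<Rightarrow> complex^'n \<Rightarrow> complex" where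
  "kern w = (SOME k. k \<in> A2 \<and> (\<forall>f\<in>A2. f w = bip lam f k))"

lemma
  assumes w: "w \<in> ball 0 1"
  shows kern_in: "kern w \<in> A2" and kern: "f \<in> A2 \<Longrightarrow> bip lam f (kern w) = f w"
proof -
  have "norm w < 1" using w by simp
  then obtain C where C: "\<And>f z. f \<in> A2 \<Longrightarrow> z \<in> cball 0 (norm w) \<Longrightarrow> cmod (f z) \<le> C * sqrt (bsq lam f)"
    by (rule point_evaluation) blast
  obtain k where "k \<in> A2" "\<And>f. f \<in> A2 \<Longrightarrow> f w = bip lam f k"
    by (rule riesz_representation[of "\<lambda>f. f w" C]) (use C in auto)
  then have "kern w \<in> A2 \<and> (\<forall>f\<in>A2. f w = bip lam f (kern w))"
    unfolding kern_def by (intro someI_ex[where P="\<lambda>k. k \<in> A2 \<and> (\<forall>f\<in>A2. f w = bip lam f k)"]) blast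
  then show "kern w \<in> A2" "f \<in> A2 \<Longrightarrow> bip lam f (kern w) = f w" by auto
qed

lemma kern_sym: "z \<in> ball 0 1 \<Longrightarrow> w \<in> ball 0 1 \<Longrightarrow> kern w z = cnj (kern z w)"
  by (metis bip_cnj kern kern_in)

lemma bergman_eqI:
  assumes "f \<in> A2" "g \<in> A2" "\<And>z. z \<in> ball 0 1 \<Longrightarrow> f z = g z"
  shows "f = g"
  using assms bergman_outside by (metis ext)

text \<open>The squared norm of \<open>kern w\<close> is its value at \<open>w\<close>, and point
  evaluation bounds this value by \<open>C\<close> times the norm.\<close>

lemma kern_norm_bounded:
  assumes "\<rho> < 1"
  obtains C where "C \<ge> 0" "\<And>w. w \<in> cball 0 \<rho> \<Longrightarrow> sqrt (bsq lam (kern w)) \<le> C"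
proof -
  obtain C where C: "C \<ge> 0" "\<And>f z. f \<in> A2 \<Longrightarrow> z \<in> cball 0 \<rho> \<Longrightarrow> cmod (f z) \<le> C * sqrt (bsq lam f)"
    using point_evaluation[OF assms] by blast
  show thesis
  proof (rule that[OF C(1)])
    fix w :: "complex^'n" assume w: "w \<in> cball 0 \<rho>"
    then have wb: "w \<in> ball 0 1" using assms by simp
    define s where "s = sqrt (bsq lam (kern w))"
    have "s\<^sup>2 = bsq lam (kern w)" by (simp add: s_def)
    also have "\<dots> = cmod (bip lam (kern w) (kern w))" by (simp add: bip_self)
    also have "\<dots> = cmod (kern w w)" by (simp add: kern[OF wb kern_in[OF wb]])
    also have "\<dots> \<le> C * s" unfolding s_def by (rule C(2)[OF kern_in[OF wb] w])
    finally have "s * s \<le> C * s" by (simp add: power2_eq_square)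
    moreover have "s \<ge> 0" by (simp add: s_def)
    ultimately show "sqrt (bsq lam (kern w)) \<le> C"
      using C(1) unfolding s_def[symmetric] by (cases "s = 0") (auto simp: mult_le_cancel_right)
  qed
qed

text \<open>The kernels are total: the Riesz vectors of two functionals which agree on all kernels
  agree at every point. Identities between operators can thus be checked on kernels.\<close>

lemma functional_eqI:
  assumes add: "\<And>f g. f \<in> A2 \<Longrightarrow> g \<in> A2 \<Longrightarrow> L (\<lambda>z. f z + g z) = L f + L g"
      "\<And>f g. f \<in> A2 \<Longrightarrow> g \<in> A2 \<Longrightarrow> L' (\<lambda>z. f z + g z) = L' f + L' g"
    and cmult: "\<And>c f. f \<in> A2 \<Longrightarrow> L (\<lambda>z. c * f z) = c * L f" "\<And>c f. f \<in> A2 \<Longrightarrow> L' (\<lambda>z. c * f z) = c * L' f"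
    and bound: "\<And>f. f \<in> A2 \<Longrightarrow> cmod (L f) \<le> C * sqrt (bsq lam f)" "\<And>f. f \<in> A2 \<Longrightarrow> cmod (L' f) \<le> C' * sqrt (bsq lam f)"
    and eq: "\<And>w. w \<in> ball 0 1 \<Longrightarrow> L (kern w) = L' (kern w)"
    and f: "f \<in> A2"
  shows "L f = L' f"
proof -
  obtain h where h: "h \<in> A2" "\<And>f. f \<in> A2 \<Longrightarrow> L f = bip lam f h"
    using riesz_representation[of L C] add cmult bound by blast
  obtain h' where h': "h' \<in> A2" "\<And>f. f \<in> A2 \<Longrightarrow> L' f = bip lam f h'"
    using riesz_representation[of L' C'] add cmult bound by blast
  have "h = h'"
  proof (rule bergman_eqI[OF h(1) h'(1)])
    fix w :: "complex^'n" assume w: "w \<in> ball 0 1"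
    have "bip lam (kern w) h = bip lam (kern w) h'" using eq[OF w] h h' kern_in[OF w] by simp
    then have "bip lam h (kern w) = bip lam h' (kern w)" by (metis bip_cnj)
    then show "h w = h' w" by (simp add: kern[OF w h(1)] kern[OF w h'(1)])
  qed
  then show ?thesis using h h' f by simp
qed

subsection \<open>Weighted composition operators\<close>

lemma AE_bmeas_ball: "AE z in bmeas lam. z \<in> ball (0::complex^'n) 1"
proof -
  have [measurable]: "- ball (0::complex^'n) 1 \<in> sets borel" by simp
  obtain \<kappa> where \<kappa>: "\<And>f :: complex^'n \<Rightarrow> ennreal. f \<in> borel_measurable borel \<Longrightarrow>
    (\<integral>\<^sup>+ z. f z \<partial>bmeas lam) = ennreal \<kappa> * (\<integral>\<^sup>+ z. ennreal (bweight lam z) * f z \<partial>lborel)"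
    using nn_integral_bmeas_exists[OF lam] by blast
  have "(\<integral>\<^sup>+ z. indicator (- ball (0::complex^'n) 1) z \<partial>bmeas lam) =
      ennreal \<kappa> * (\<integral>\<^sup>+ z. ennreal (bweight lam z) * indicator (- ball (0::complex^'n) 1) z \<partial>lborel)"
    by (rule \<kappa>) measurable
  also have "(\<integral>\<^sup>+ z. ennreal (bweight lam z) * indicator (- ball (0::complex^'n) 1) z \<partial>lborel) = (\<integral>\<^sup>+ z. 0 \<partial>(lborel :: (complex^'n) measure))"
    by (rule nn_integral_cong) (simp add: bweight_def indicator_def)
  finally have "emeasure (bmeas lam) (- ball (0::complex^'n) 1) = 0"
    by (simp add: nn_integral_indicator)
  then show ?thesis by (intro AE_I[of _ _ "- ball 0 1"]) auto
qed

definition wcomp :: "complex^('n option)^('n option) \<Rightarrow> (complex^'n \<Rightarrow> complex) \<Rightarrow> (complex^'n \<Rightarrow> complex) \<Rightarrow> (complex^'n \<Rightarrow> complex)" where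
  "wcomp u m f = (\<lambda>z. if z \<in> ball 0 1 then m z * f (ball_action u z) else 0)"

text \<open>A holomorphic branch of \<open>aut_denom u\<close> to the power \<open>- lam\<close>, up
  to a phase. Only the modulus is prescribed, because that alone decides unitarity, and every choice
  of lift to the covering group yields such an \<open>m\<close>.\<close>

definition multiplier :: "complex^('n option)^('n option) \<Rightarrow> (complex^'n \<Rightarrow> complex) \<Rightarrow> bool" where
  "multiplier u m \<longleftrightarrow> form_unitary u \<and> holomorphic_in m (ball 0 1) \<and>
     (\<forall>z\<in>ball 0 1. cmod (m z) = cmod (aut_denom u z) powr (- lam))"

lemma wcomp_measurable:
  assumes "multiplier u m" and [measurable]: "f \<in> borel_measurable borel"
  shows "wcomp u m f \<in> borel_measurable borel"
proof -
  have [measurable]: "(\<lambda>z. indicator (ball 0 1) z *\<^sub>R m z) \<in> borel_measurable borel"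
    using assms(1) unfolding multiplier_def
    by (intro borel_measurable_continuous_on_indicator holomorphic_in_continuous_on) auto
  have eq: "wcomp u m f = (\<lambda>z. (indicator (ball 0 1) z *\<^sub>R m z) * f (ball_action u z))"
    by (auto simp: wcomp_def fun_eq_iff indicator_def)
  show ?thesis unfolding eq by measurable
qed

lemma wcomp_nn_integral:
  assumes um: "multiplier u m" and f[measurable]: "f \<in> borel_measurable borel"
  shows "(\<integral>\<^sup>+ z. ennreal ((cmod (wcomp u m f z))\<^sup>2) \<partial>bmeas lam) = (\<integral>\<^sup>+ z. ennreal ((cmod (f z))\<^sup>2) \<partial>bmeas lam)"
proof -
  have "(\<integral>\<^sup>+ z. ennreal ((cmod (wcomp u m f z))\<^sup>2) \<partial>bmeas lam) =
    (\<integral>\<^sup>+ z. ennreal ((cmod (f (ball_action u z)))\<^sup>2) * ennreal (cmod (aut_denom u z) powr (- 2 * lam)) \<partial>bmeas lam)"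
  proof (rule nn_integral_cong_AE, use AE_bmeas_ball in eventually_elim)
    fix z :: "complex^'n" assume z: "z \<in> ball 0 1"
    then have "(cmod (wcomp u m f z))\<^sup>2 = (cmod (f (ball_action u z)))\<^sup>2 * (cmod (aut_denom u z) powr (- lam))\<^sup>2"
      using um by (simp add: wcomp_def multiplier_def norm_mult power_mult_distrib)
    also have "(cmod (aut_denom u z) powr (- lam))\<^sup>2 = cmod (aut_denom u z) powr (- 2 * lam)"
      by (simp add: powr_add[symmetric] power2_eq_square)
    finally show "ennreal ((cmod (wcomp u m f z))\<^sup>2) = ennreal ((cmod (f (ball_action u z)))\<^sup>2) * ennreal (cmod (aut_denom u z) powr (- 2 * lam))"
      by (simp add: ennreal_mult)
  qed
  also have "\<dots> = (\<integral>\<^sup>+ z. ennreal ((cmod (f z))\<^sup>2) \<partial>bmeas lam)"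
    by (rule nn_integral_ball_action[OF lam, of u "\<lambda>z. ennreal ((cmod (f z))\<^sup>2)"]) (use um in \<open>auto simp: multiplier_def\<close>)
  finally show ?thesis .
qed

lemma
  assumes "multiplier u m" "f \<in> bL2 lam"
  shows wcomp_L2: "wcomp u m f \<in> bL2 lam" and wcomp_bsq: "bsq lam (wcomp u m f) = bsq lam f"
proof -
  show L2: "wcomp u m f \<in> bL2 lam"
    using assms by (simp add: bL2_iff_nn_integral wcomp_measurable wcomp_nn_integral)
  have "ennreal (bsq lam (wcomp u m f)) = ennreal (bsq lam f)"
    using wcomp_nn_integral[OF assms(1) bL2_measurable[OF assms(2)]]
    by (simp add: bL2_nn_integral[OF L2] bL2_nn_integral[OF assms(2)])
  then show "bsq lam (wcomp u m f) = bsq lam f" by (subst (asm) ennreal_inj) auto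
qed

lemma wcomp_add: "wcomp u m (\<lambda>z. f z + g z) = (\<lambda>z. wcomp u m f z + wcomp u m g z)"
  and wcomp_cmult: "wcomp u m (\<lambda>z. c * f z) = (\<lambda>z. c * wcomp u m f z)"
  by (auto simp: wcomp_def fun_eq_iff algebra_simps)

lemma wcomp_bip:
  assumes "multiplier u m" "f \<in> bL2 lam" "g \<in> bL2 lam"
  shows "bip lam (wcomp u m f) (wcomp u m g) = bip lam f g"
proof (rule complex_eqI)
  note W = wcomp_L2[OF assms(1)] wcomp_bsq[OF assms(1)]
  show "Re (bip lam (wcomp u m f) (wcomp u m g)) = Re (bip lam f g)"
    using assms(2,3) by (simp add: bip_polarization W bL2_add flip: wcomp_add)
  have "(\<lambda>z. wcomp u m f z + \<i> * wcomp u m g z) = wcomp u m (\<lambda>z. f z + \<i> * g z)"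
    by (simp add: wcomp_add wcomp_cmult)
  then show "Im (bip lam (wcomp u m f) (wcomp u m g)) = Im (bip lam f g)"
    using assms(2,3) by (simp add: bip_polarization W bL2_add bL2_cmult)
qed

lemma wcomp_bergman:
  assumes um: "multiplier u m" and f: "f \<in> A2"
  shows "wcomp u m f \<in> A2"
proof -
  have u: "form_unitary u" "holomorphic_in m (ball 0 1)" using um by (auto simp: multiplier_def)
  have "holomorphic_in (\<lambda>z. m z * f (ball_action u z)) (ball 0 1)"
    by (intro holomorphic_in_mult u holomorphic_in_compose[OF bergman_holomorphic[OF f]] holomorphic_in_ball_action)
      (use ball_action_in_ball[OF u(1)] in auto)
  then have "holomorphic_in (wcomp u m f) (ball 0 1)"
    by (rule holomorphic_in_cong) (auto simp: wcomp_def)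
  then show ?thesis using wcomp_L2[OF um bergman_L2[OF f]] by (simp add: bergman_space_iff wcomp_def)
qed

text \<open>Since the operators are unitary, this is a formula for the adjoint. The modulus of
  \<open>m'\<close> is right by the cocycle identity for \<open>u ** v = mat 1\<close>.\<close>

lemma wcomp_inverse:
  assumes um: "multiplier u m"
  obtains v m' where "multiplier v m'" "v ** u = mat 1" "u ** v = mat 1"
    "\<And>z. z \<in> ball 0 1 \<Longrightarrow> m' z = 1 / m (ball_action v z)"
    "\<And>f. (\<And>z. z \<notin> ball 0 1 \<Longrightarrow> f z = 0) \<Longrightarrow> wcomp u m (wcomp v m' f) = f"
    "\<And>f. (\<And>z. z \<notin> ball 0 1 \<Longrightarrow> f z = 0) \<Longrightarrow> wcomp v m' (wcomp u m f) = f"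
proof -
  have u: "form_unitary u" and m: "holomorphic_in m (ball 0 1)"
    and mu: "\<And>z. z \<in> ball 0 1 \<Longrightarrow> cmod (m z) = cmod (aut_denom u z) powr (- lam)"
    using um by (auto simp: multiplier_def)
  obtain v where v: "u ** v = mat 1" "v ** u = mat 1" "form_unitary v" using form_unitary_inverse[OF u] .
  define m' where "m' z = 1 / m (ball_action v z)" for z
  have m0: "m z \<noteq> 0" if "z \<in> ball 0 1" for z
    using mu[OF that] aut_denom_nonzero[OF u that] by auto
  have vu: "ball_action v (ball_action u z) = z" if "z \<in> ball 0 1" for z
    using ball_action_mult[OF aut_denom_nonzero[OF u that], of v] by (simp add: v)
  have uv: "ball_action u (ball_action v z) = z" if "z \<in> ball 0 1" for z
    using ball_action_mult[OF aut_denom_nonzero[OF v(3) that], of u] by (simp add: v)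
  have ub: "ball_action u z \<in> ball 0 1" and vb: "ball_action v z \<in> ball 0 1" if "z \<in> ball 0 1" for z
    using that ball_action_in_ball u v by blast+
  have "multiplier v m'"
    unfolding multiplier_def
  proof (intro conjI ballI)
    show "holomorphic_in m' (ball 0 1)"
      unfolding m'_def
      by (intro holomorphic_in_divide holomorphic_in_const holomorphic_in_compose[OF m] holomorphic_in_ball_action v m0 vb)
        (use vb in auto)
    fix z :: "complex^'n" assume z: "z \<in> ball 0 1"
    have "aut_denom u (ball_action v z) * aut_denom v z = 1"
      using aut_denom_mult[OF aut_denom_nonzero[OF v(3) z], of u] by (simp add: v)
    then have "cmod (aut_denom u (ball_action v z)) = 1 / cmod (aut_denom v z)"
      using aut_denom_nonzero[OF v(3) z] by (metis nonzero_eq_divide_eq norm_divide norm_one)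
    then have "cmod (m (ball_action v z)) = (1 / cmod (aut_denom v z)) powr (- lam)"
      using mu[OF vb[OF z]] by simp
    then show "cmod (m' z) = cmod (aut_denom v z) powr (- lam)"
      using aut_denom_nonzero[OF v(3) z]
      by (simp add: m'_def norm_divide powr_divide powr_minus inverse_eq_divide)
  qed (rule v)
  moreover have "wcomp u m (wcomp v m' f) = f" if "\<And>z. z \<notin> ball 0 1 \<Longrightarrow> f z = 0" for f
    using that ub vu m0 by (auto simp: wcomp_def m'_def fun_eq_iff)
  moreover have "wcomp v m' (wcomp u m f) = f" if "\<And>z. z \<notin> ball 0 1 \<Longrightarrow> f z = 0" for f
    using that vb uv m0 by (auto simp: wcomp_def m'_def fun_eq_iff)
  ultimately show thesis using that v(1,2) m'_def by blast
qed

text \<open>Covariance of the kernel. By unitarity the operator moves to the other argument as its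
  inverse, and there the kernel at \<open>u w\<close> evaluates a weighted composition whose point
  is \<open>v (u w) = w\<close>.\<close>

lemma wcomp_kern:
  assumes um: "multiplier u m" and w: "w \<in> ball 0 1"
  shows "wcomp u m (kern (ball_action u w)) = (\<lambda>z. cnj (1 / m w) * kern w z)"
proof -
  obtain v m' where v: "multiplier v m'" "v ** u = mat 1" "u ** v = mat 1"
    "\<And>z. z \<in> ball 0 1 \<Longrightarrow> m' z = 1 / m (ball_action v z)"
    "\<And>f. (\<And>z. z \<notin> ball 0 1 \<Longrightarrow> f z = 0) \<Longrightarrow> wcomp u m (wcomp v m' f) = f"
    using wcomp_inverse[OF um] by metis
  have u: "form_unitary u" using um by (simp add: multiplier_def)
  define y where "y = ball_action u w"
  have y: "y \<in> ball 0 1" unfolding y_def by (rule ball_action_in_ball[OF u w])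
  have vy: "ball_action v y = w"
    using ball_action_mult[OF aut_denom_nonzero[OF u w], of v] by (simp add: v y_def)
  show ?thesis
  proof (rule bergman_eqI)
    show "wcomp u m (kern (ball_action u w)) \<in> A2" using wcomp_bergman[OF um kern_in[OF y]] by (simp add: y_def)
    show "(\<lambda>z. cnj (1 / m w) * kern w z) \<in> A2" by (intro bergman_cmult kern_in w)
    fix z :: "complex^'n" assume z: "z \<in> ball 0 1"
    have k: "wcomp v m' (kern z) \<in> A2" by (rule wcomp_bergman[OF v(1) kern_in[OF z]])
    have "wcomp u m (kern y) z = bip lam (wcomp u m (kern y)) (kern z)"
      by (rule kern[OF z wcomp_bergman[OF um kern_in[OF y]], symmetric])
    also have "\<dots> = bip lam (wcomp u m (kern y)) (wcomp u m (wcomp v m' (kern z)))"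
      using v(5)[of "kern z"] bergman_outside[OF kern_in[OF z]] by simp
    also have "\<dots> = bip lam (kern y) (wcomp v m' (kern z))"
      by (rule wcomp_bip[OF um bergman_L2[OF kern_in[OF y]] bergman_L2[OF k]])
    also have "\<dots> = cnj (wcomp v m' (kern z) y)" using kern[OF y k] by (metis bip_cnj)
    also have "\<dots> = cnj (1 / m w) * kern w z"
      using y by (simp add: wcomp_def v(4) vy kern_sym[OF z w])
    finally show "wcomp u m (kern (ball_action u w)) z = cnj (1 / m w) * kern w z" by (simp add: y_def)
  qed
qed

end

subsection \<open>Maximal abelian subgroups\<close>

lemma det_cnj: "det (\<chi> i j. cnj (A $ i $ j)) = cnj (det (A :: complex^'k::finite^'k))"
  by (simp add: det_def cnj_sum cnj_prod)

text \<open>With the signature matrix \<open>E\<close> of the form, the conjugate transpose of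
  \<open>A\<close> times \<open>E ** A\<close> equals \<open>E\<close>; the claim is the determinant
  of this identity.\<close>

lemma form_unitary_det:
  assumes A: "form_unitary (A :: complex^('n::finite option)^('n option))"
  shows "cmod (det A) = 1"
proof -
  define s :: "'n option \<Rightarrow> complex" where "s i = (case i of None \<Rightarrow> 1 | Some _ \<Rightarrow> - 1)" for i
  have s_simps: "s None = 1" "s (Some i) = - 1" for i by (simp_all add: s_def)
  define E :: "complex^('n option)^('n option)" where "E = (\<chi> i j. if i = j then s i else 0)"
  define A' where "A' = (\<chi> i j. cnj (A $ i $ j))"
  have E_nth: "E $ i $ j = (if i = j then s i else 0)" for i j by (simp add: E_def)
  have E_mult: "(E ** M) $ i $ j = s i * M $ i $ j" for M i j
  proof -
    have "(E ** M) $ i $ j = (\<Sum>k\<in>UNIV. E $ i $ k * M $ k $ j)" by (simp add: matrix_matrix_mult_def)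
    also have "\<dots> = (\<Sum>k\<in>UNIV. if i = k then s i * M $ k $ j else 0)"
      by (rule sum.cong) (simp_all add: E_nth)
    finally show ?thesis by simp
  qed
  have EE: "E ** E = mat 1"
    unfolding vec_eq_iff E_mult by (auto simp: E_nth mat_def s_def split: option.splits)
  have "(transpose A' ** (E ** A)) $ i $ j = E $ i $ j" for i j
  proof -
    have "(transpose A' ** (E ** A)) $ i $ j = (\<Sum>k\<in>UNIV. cnj (A $ k $ i) * (s k * A $ k $ j))"
    proof -
      have "(transpose A' ** (E ** A)) $ i $ j = (\<Sum>k\<in>UNIV. transpose A' $ i $ k * (E ** A) $ k $ j)"
        by (simp only: matrix_matrix_mult_def[of "transpose A'"] vec_lambda_beta)
      then show ?thesis by (simp add: transpose_def A'_def E_mult)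
    qed
    also have "\<dots> = herm_form (A *v axis j 1) (A *v axis i 1)"
    proof -
      have "(A *v axis l 1) $ k = A $ k $ l" for k l
        by (simp add: matrix_vector_mult_def axis_def if_distrib cong: if_cong)
      then show ?thesis by (simp add: sum_UNIV_option herm_form_def sum_negf mult.commute s_simps)
    qed
    also have "\<dots> = herm_form (axis j 1) (axis i 1)" using A by (simp add: form_unitary_def)
    also have "\<dots> = s i * axis j 1 $ i"
    proof -
      have "herm_form x (axis i 1) = s i * x $ i" for x
        by (cases i) (auto simp: herm_form_def axis_def s_simps if_distrib cong: if_cong)
      then show ?thesis .
    qed
    also have "\<dots> = E $ i $ j"
      by (simp add: E_nth axis_def)
    finally show ?thesis .
  qed
  then have "transpose A' ** (E ** A) = E" by (simp add: vec_eq_iff)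
  then have "det (transpose A' ** (E ** A)) = det E" by simp
  then have "cnj (det A) * (det E * det A) = det E"
    by (simp add: det_mul det_transpose A'_def det_cnj)
  moreover have "det E * det E = 1" using EE by (metis det_I det_mul)
  then have "det E \<noteq> 0" by auto
  ultimately have "det A * cnj (det A) = 1" by (simp add: field_simps)
  then have "of_real ((cmod (det A))\<^sup>2) = (1 :: complex)" by (simp add: complex_norm_square del: of_real_power)
  then have "(cmod (det A))\<^sup>2 = 1" by (simp only: of_real_eq_1_iff)
  then show ?thesis using abs_square_eq_1[of "cmod (det A)"] by simp
qed

section \<open>The group SU(n,1), centralizers, and the geometry of the form\<close>

lemma SU_n1_simps:
  "A \<in> carrier SU_n1 \<longleftrightarrow> det A = 1 \<and> form_unitary A"
  "A \<otimes>\<^bsub>SU_n1\<^esub> B = A ** B" "\<one>\<^bsub>SU_n1\<^esub> = mat 1"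
  by (simp_all add: SU_n1_def form_unitary_def)

lemma group_SU_n1: "group (SU_n1 :: (complex^('n::finite option)^('n option)) monoid)"
proof (rule groupI)
  fix A :: "complex^('n::finite option)^('n option)" assume "A \<in> carrier SU_n1"
  then have A: "det A = 1" "form_unitary A" by (auto simp: SU_n1_simps)
  obtain B where B: "A ** B = mat 1" "B ** A = mat 1" "form_unitary B"
    using form_unitary_inverse[OF A(2)] .
  have "det B = 1" using B(1) A(1) by (metis det_I det_mul mult_1)
  then show "\<exists>B\<in>carrier SU_n1. B \<otimes>\<^bsub>SU_n1\<^esub> A = \<one>\<^bsub>SU_n1\<^esub>"
    using B by (auto simp: SU_n1_simps)
qed (auto simp: SU_n1_simps det_mul form_unitary_mult form_unitary_one matrix_mul_assoc)

definition centralizer_in :: "('a, 'b) monoid_scheme \<Rightarrow> 'a set \<Rightarrow> 'a set" where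
  "centralizer_in G S = {x \<in> carrier G. \<forall>y\<in>S. x \<otimes>\<^bsub>G\<^esub> y = y \<otimes>\<^bsub>G\<^esub> x}"

lemma subgroup_centralizer_in:
  assumes "group G" "S \<subseteq> carrier G"
  shows "subgroup (centralizer_in G S) G"
proof -
  interpret group G by fact
  show ?thesis
  proof
    fix x y assume "x \<in> centralizer_in G S" "y \<in> centralizer_in G S"
    then show "x \<otimes>\<^bsub>G\<^esub> y \<in> centralizer_in G S"
      using assms(2) by (auto simp: centralizer_in_def subset_iff) (metis m_assoc)
  next
    fix x assume x: "x \<in> centralizer_in G S"
    have "inv\<^bsub>G\<^esub> x \<otimes>\<^bsub>G\<^esub> y = y \<otimes>\<^bsub>G\<^esub> inv\<^bsub>G\<^esub> x" if y: "y \<in> S" for y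
    proof -
      have c: "x \<in> carrier G" "y \<in> carrier G" "x \<otimes>\<^bsub>G\<^esub> y = y \<otimes>\<^bsub>G\<^esub> x"
        using x y assms(2) by (auto simp: centralizer_in_def)
      have "x \<otimes>\<^bsub>G\<^esub> y \<otimes>\<^bsub>G\<^esub> inv\<^bsub>G\<^esub> x = y" using c by (simp add: m_assoc)
      then have "inv\<^bsub>G\<^esub> x \<otimes>\<^bsub>G\<^esub> y = inv\<^bsub>G\<^esub> x \<otimes>\<^bsub>G\<^esub> (x \<otimes>\<^bsub>G\<^esub> y \<otimes>\<^bsub>G\<^esub> inv\<^bsub>G\<^esub> x)" by simp
      also have "\<dots> = y \<otimes>\<^bsub>G\<^esub> inv\<^bsub>G\<^esub> x" using c(1,2) by (simp add: m_assoc[symmetric])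
      finally show ?thesis .
    qed
    then show "inv\<^bsub>G\<^esub> x \<in> centralizer_in G S" using x by (simp add: centralizer_in_def)
  qed (use assms(2) in \<open>auto simp: centralizer_in_def subset_iff\<close>)
qed

text \<open>The double centralizer of an extended commuting set is an abelian subgroup.\<close>

lemma maximal_abelian_contains_centralizer:
  assumes "group G" and max: "maximal_abelian_subgroup H G"
    and g: "g \<in> carrier G" "\<And>h. h \<in> H \<Longrightarrow> g \<otimes>\<^bsub>G\<^esub> h = h \<otimes>\<^bsub>G\<^esub> g"
  shows "g \<in> H"
proof -
  have H: "subgroup H G" "\<And>x y. x \<in> H \<Longrightarrow> y \<in> H \<Longrightarrow> x \<otimes>\<^bsub>G\<^esub> y = y \<otimes>\<^bsub>G\<^esub> x"
    using max by (auto simp: maximal_abelian_subgroup_def abelian_subgroup_def)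
  have Hc: "insert g H \<subseteq> carrier G" using subgroup.subset[OF H(1)] g by auto
  define C where "C = centralizer_in G (insert g H)"
  define K where "K = centralizer_in G C"
  have C: "insert g H \<subseteq> C" using Hc g H(2) by (auto simp: C_def centralizer_in_def)
  have "C \<subseteq> carrier G" by (auto simp: C_def centralizer_in_def)
  then have "subgroup K G" unfolding K_def by (rule subgroup_centralizer_in[OF assms(1)])
  moreover have "K \<subseteq> C" using C by (auto simp: K_def C_def centralizer_in_def)
  then have "\<forall>x\<in>K. \<forall>y\<in>K. x \<otimes>\<^bsub>G\<^esub> y = y \<otimes>\<^bsub>G\<^esub> x" by (auto simp: K_def centralizer_in_def)
  moreover have HK: "insert g H \<subseteq> K"
  proof
    fix x assume x: "x \<in> insert g H"
    have "x \<otimes>\<^bsub>G\<^esub> y = y \<otimes>\<^bsub>G\<^esub> x" if "y \<in> C" for y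
      using that x by (auto simp: C_def centralizer_in_def)
    then show "x \<in> K" using x Hc by (auto simp: K_def centralizer_in_def)
  qed
  ultimately have "K = H" using max by (auto simp: maximal_abelian_subgroup_def abelian_subgroup_def)
  then show ?thesis using HK by auto
qed

text \<open>A Gram matrix argument: a correspondence between spanning families which preserves the form is
  induced by a form-preserving matrix.\<close>

lemma form_unitary_extend:
  fixes R :: "((complex^('n::finite option)) \<times> (complex^('n option))) set"
  assumes gram: "\<And>x y x' y'. (x, y) \<in> R \<Longrightarrow> (x', y') \<in> R \<Longrightarrow> herm_form y y' = herm_form x x'"
    and dom: "vec.span (fst ` R) = UNIV" and ran: "vec.span (snd ` R) = UNIV"
  obtains A where "form_unitary A" "\<And>x y. (x, y) \<in> R \<Longrightarrow> A *v x = y"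
proof -
  obtain B where B: "B \<subseteq> fst ` R" "vec.independent B" "fst ` R \<subseteq> vec.span B"
    using vec.basis_exists[of "fst ` R"] by metis
  have spB: "vec.span B = UNIV" using B(3) dom vec.span_mono vec.span_span by (metis top.extremum_unique)
  have "\<forall>b\<in>B. \<exists>y. (b, y) \<in> R" using B(1) by force
  then obtain \<iota> where \<iota>: "\<And>b. b \<in> B \<Longrightarrow> (b, \<iota> b) \<in> R" by metis
  obtain f where f: "Vector_Spaces.linear (*s) (*s) f" "\<And>b. b \<in> B \<Longrightarrow> f b = \<iota> b"
    using vec.linear_independent_extend[OF B(2), of \<iota>] by blast
  define A where "A = matrix f"
  have A: "A *v x = f x" for x unfolding A_def by (rule matrix_works[OF f(1)])
  \<comment> \<open>\<open>A\<close> is prescribed on the basis \<open>B\<close> only. Comparing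
    forms against every pair of \<open>R\<close>, and then using that the second components span,
    shows that it has the right value on all of \<open>R\<close>.\<close>
  have key: "herm_form (A *v z) y = herm_form z x" if xy: "(x, y) \<in> R" for x y z
  proof -
    have "z \<in> vec.span B" using spB by simp
    then show ?thesis
    proof (induction rule: vec.span_induct_alt)
      case base
      then show ?case by simp
    next
      case (step c b z)
      have "herm_form (A *v b) y = herm_form b x"
        using gram[OF \<iota>[OF step(1)] xy] f(2)[OF step(1)] by (simp add: A)
      then show ?case using step(2)
        by (simp add: matrix_vector_right_distrib vector_scalar_commute herm_form_simps)
    qed
  qed
  have AR: "A *v x = y" if xy: "(x, y) \<in> R" for x y
  proof -
    have "herm_form (A *v x - y) w = 0" for w
    proof -
      have "w \<in> vec.span (snd ` R)" using ran by simp
      then show ?thesis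
      proof (induction rule: vec.span_induct_alt)
        case base
        then show ?case by simp
      next
        case (step c b z)
        then obtain x' where "(x', b) \<in> R" by auto
        then have "herm_form (A *v x - y) b = 0" using key gram[OF xy] by (simp add: herm_form_simps)
        then show ?case using step(2) by (simp add: herm_form_add_right herm_form_smult_right)
      qed
    qed
    then show ?thesis using herm_form_nondegenerate by (metis right_minus_eq)
  qed
  have "form_unitary A"
    unfolding form_unitary_def
  proof (intro allI)
    fix z w :: "complex^('n option)"
    have "w \<in> vec.span (fst ` R)" using dom by simp
    then show "herm_form (A *v z) (A *v w) = herm_form z w"
    proof (induction rule: vec.span_induct_alt)
      case base
      then show ?case by simp
    next
      case (step c b w)
      then obtain y where "(b, y) \<in> R" by auto
      then have "herm_form (A *v z) (A *v b) = herm_form z b" using key AR by simp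
      then show ?case using step(2)
        by (simp add: matrix_vector_right_distrib vector_scalar_commute herm_form_add_right herm_form_smult_right)
    qed
  qed
  then show thesis using AR that by blast
qed

lemma matrix_eq_on_span:
  fixes A B :: "complex^'k::finite^'m::finite"
  assumes "vec.span S = UNIV" "\<And>x. x \<in> S \<Longrightarrow> A *v x = B *v x"
  shows "A = B"
  unfolding matrix_eq
proof
  fix x :: "complex^'k"
  have "x \<in> vec.span S" using assms(1) by simp
  then show "A *v x = B *v x"
    by (induction rule: vec.span_induct_alt)
      (simp_all add: matrix_vector_right_distrib vector_scalar_commute assms(2))
qed

text \<open>The form has a single positive direction. Orthogonality and the Cauchy-Schwarz
  inequality bound the product of the last coordinates of \<open>u\<close> and \<open>v\<close> by
  \<open>a * b\<close>, and positivity of \<open>v\<close> makes \<open>b\<close> smaller than the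
  last coordinate of \<open>v\<close>, so \<open>a\<close> must exceed that of
  \<open>u\<close>.\<close>

lemma hquad_orthogonal_negative:
  assumes v: "hquad v > 0" and uv: "herm_form u v = 0" and u: "u \<noteq> 0"
  shows "hquad u < 0"
proof -
  define a where "a = L2_set (\<lambda>i. cmod (u $ Some i)) UNIV"
  define b where "b = L2_set (\<lambda>i. cmod (v $ Some i)) UNIV"
  have a: "a\<^sup>2 = (\<Sum>i\<in>UNIV. (cmod (u $ Some i))\<^sup>2)" "a \<ge> 0"
    and b: "b\<^sup>2 = (\<Sum>i\<in>UNIV. (cmod (v $ Some i))\<^sup>2)" "b \<ge> 0"
    by (simp_all add: a_def b_def L2_set_def sum_nonneg)
  have "b\<^sup>2 < (cmod (v $ None))\<^sup>2" using v b by (simp add: hquad_def)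
  then have bv: "b < cmod (v $ None)" using b(2) by (meson norm_ge_zero power_less_imp_less_base)
  have "cmod (u $ None) * cmod (v $ None) = cmod (\<Sum>i\<in>UNIV. u $ Some i * cnj (v $ Some i))"
  proof -
    have "u $ None * cnj (v $ None) = (\<Sum>i\<in>UNIV. u $ Some i * cnj (v $ Some i))"
      using uv by (simp add: herm_form_def)
    then show ?thesis by (metis complex_mod_cnj norm_mult)
  qed
  also have "\<dots> \<le> (\<Sum>i\<in>UNIV. \<bar>cmod (u $ Some i)\<bar> * \<bar>cmod (v $ Some i)\<bar>)"
    by (rule order_trans[OF norm_sum]) (simp add: norm_mult)
  also have "\<dots> \<le> a * b" unfolding a_def b_def by (rule L2_set_mult_ineq)
  finally have le: "cmod (u $ None) * cmod (v $ None) \<le> a * b" .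
  have "cmod (u $ None) < a"
  proof (cases "a = 0")
    case True
    then have "cmod (u $ None) * cmod (v $ None) \<le> 0" using le by simp
    then have "u $ None = 0" using bv b(2) by (simp add: mult_le_0_iff) (smt (verit) norm_ge_zero norm_eq_zero)
    moreover have "u $ Some i = 0" for i
      using True a(1) by (simp add: sum_nonneg_eq_0_iff)
    ultimately have "u = 0" by (simp add: vec_eq_iff) (metis option.exhaust)
    then show ?thesis using u by simp
  next
    case False
    then have "a * b < a * cmod (v $ None)" using a(2) bv by simp
    then have "cmod (u $ None) * cmod (v $ None) < a * cmod (v $ None)" using le by linarith
    then show ?thesis by (simp add: mult_less_cancel_right)
  qed
  then have "(cmod (u $ None))\<^sup>2 < a\<^sup>2" by (intro power_strict_mono) auto
  then show ?thesis using a by (simp add: hquad_def)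
qed

lemma subspace_of_vec_subspace: "vec.subspace W \<Longrightarrow> subspace (W :: (complex^'k::finite) set)"
  by (simp add: subspace_def vec.subspace_def scaleR_eq_smult)

text \<open>A subspace containing a positive vector is nondegenerate, hence complemented by its
  orthogonal space.\<close>

lemma form_orthogonal_decomposition:
  fixes W :: "(complex^('n::finite option)) set"
  assumes W: "vec.subspace W" and v: "v \<in> W" "hquad v > 0"
  defines "P \<equiv> {u. \<forall>w\<in>W. herm_form u w = 0}"
  obtains w u where "w \<in> W" "u \<in> P" "x = w + u"
proof -
  have WP: "W \<inter> P = {0}"
  proof -
    have "u = 0" if "u \<in> W" "u \<in> P" for u
    proof (rule ccontr)
      assume "u \<noteq> 0"
      then have "hquad u < 0" using that v by (intro hquad_orthogonal_negative[of v]) (auto simp: P_def)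
      moreover have "herm_form u u = 0" using that by (auto simp: P_def)
      ultimately show False by (simp add: herm_form_self)
    qed
    moreover have "0 \<in> W" using W by (rule vec.subspace_0)
    ultimately show ?thesis by (auto simp: P_def)
  qed
  \<comment> \<open>\<open>E\<close> relates the form to the Euclidean inner product: it maps the
    Euclidean complement of \<open>W\<close> onto \<open>P\<close>. Real dimensions can then be
    counted; multiplying by \<open>\<i>\<close> inside \<open>W\<close> recovers the imaginary part
    of the form.\<close>
  define E :: "complex^('n option) \<Rightarrow> complex^('n option)"
    where "E x = (\<chi> k. case k of None \<Rightarrow> x $ None | Some i \<Rightarrow> - x $ Some i)" for x
  have E_nth: "E x $ None = x $ None" "E x $ Some i = - x $ Some i" for x i by (simp_all add: E_def)
  have EE: "E (E x) = x" for x by (auto simp: vec_eq_iff E_def split: option.splits)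
  have Elin: "linear E" by (rule linearI) (auto simp: vec_eq_iff E_def split: option.splits)
  have inner: "E u \<bullet> w = Re (herm_form u w)" for u w
    by (simp add: inner_vec_def herm_form_def sum_UNIV_option E_nth inner_complex_def sum_negf sum_subtractf sum.distrib)
  have Psub: "vec.subspace P"
    by (auto simp: P_def vec.subspace_def herm_form_add_left herm_form_smult_left)
  have "E ` {y \<in> UNIV. \<forall>x\<in>W. orthogonal x y} = P"
  proof (intro equalityI subsetI)
    fix u assume u: "u \<in> P"
    then have "E u \<in> {y \<in> UNIV. \<forall>x\<in>W. orthogonal x y}"
      by (auto simp: P_def orthogonal_def inner inner_commute[of _ "E u"])
    then show "u \<in> E ` {y \<in> UNIV. \<forall>x\<in>W. orthogonal x y}" by (rule image_eqI[rotated]) (simp add: EE)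
  next
    fix u assume "u \<in> E ` {y \<in> UNIV. \<forall>x\<in>W. orthogonal x y}"
    then obtain y where y: "u = E y" "\<forall>x\<in>W. orthogonal x y" by auto
    have "herm_form u w = 0" if w: "w \<in> W" for w
    proof (rule complex_eqI)
      have "y \<bullet> w = 0" "y \<bullet> (\<i> *s w) = 0"
        using y(2) w vec.subspace_scale[OF W w, of \<i>] by (auto simp: orthogonal_def inner_commute)
      moreover have "y = E u" by (simp add: y EE)
      ultimately show "Re (herm_form u w) = Re 0" "Im (herm_form u w) = Im 0"
        by (simp_all add: inner herm_form_smult_right)
    qed
    then show "u \<in> P" by (simp add: P_def)
  qed
  moreover have "inj E" by (metis EE injI)
  then have "dim (E ` {y \<in> UNIV. \<forall>x\<in>W. orthogonal x y}) = dim {y \<in> UNIV. \<forall>x\<in>W. orthogonal x y}"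
    using Elin by (intro dim_image_eq) (auto intro: inj_on_subset)
  ultimately have "dim P + dim W = DIM(complex^('n option))"
    using dim_subspace_orthogonal_to_vectors[OF subspace_of_vec_subspace[OF W] subspace_UNIV] by simp
  moreover have "dim {x + y |x y. x \<in> W \<and> y \<in> P} + dim (W \<inter> P) = dim W + dim P"
    by (intro dim_sums_Int subspace_of_vec_subspace W Psub)
  ultimately have "dim {x + y |x y. x \<in> W \<and> y \<in> P} = DIM(complex^('n option))"
    by (simp add: WP)
  then have "span {x + y |x y. x \<in> W \<and> y \<in> P} = UNIV" by (simp only: dim_eq_full)
  moreover have "subspace {x + y |x y. x \<in> W \<and> y \<in> P}"
    by (intro subspace_sums subspace_of_vec_subspace W Psub)
  ultimately have "x \<in> {x + y |x y. x \<in> W \<and> y \<in> P}"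
    using span_eq_iff[of "{x + y |x y. x \<in> W \<and> y \<in> P}"] by simp
  then show thesis using that by blast
qed

section \<open>Cyclic vectors and the conjugation inverting the subgroup\<close>

definition orbit_span :: "(complex^'k::finite^'k) set \<Rightarrow> complex^'k \<Rightarrow> (complex^'k) set" where
  "orbit_span H v = vec.span ((\<lambda>h. h *v v) ` H)"

context
  fixes H :: "(complex^('n::finite option)^('n option)) set"
  assumes max: "maximal_abelian_subgroup H SU_n1"
begin

lemma H_subgroup: "subgroup H SU_n1"
  and H_commute: "h \<in> H \<Longrightarrow> k \<in> H \<Longrightarrow> h ** k = k ** h"
  using max by (auto simp: maximal_abelian_subgroup_def abelian_subgroup_def SU_n1_simps)

lemma H_unitary: "h \<in> H \<Longrightarrow> form_unitary h"
  using subgroup.subset[OF H_subgroup] SU_n1_simps(1) by blast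

lemma H_one: "mat 1 \<in> H"
  using subgroup.one_closed[OF H_subgroup] by (simp add: SU_n1_simps)

lemma H_mult: "h \<in> H \<Longrightarrow> k \<in> H \<Longrightarrow> h ** k \<in> H"
  using subgroup.m_closed[OF H_subgroup] by (simp add: SU_n1_simps)

lemma H_inverse:
  assumes "h \<in> H"
  obtains k where "k \<in> H" "h ** k = mat 1" "k ** h = mat 1"
proof
  interpret group "SU_n1 :: (complex^('n option)^('n option)) monoid" by (rule group_SU_n1)
  have c: "h \<in> carrier SU_n1" using subgroup.subset[OF H_subgroup] assms by blast
  show "inv\<^bsub>SU_n1\<^esub> h \<in> H" using subgroup.m_inv_closed[OF H_subgroup assms] .
  show "h ** inv\<^bsub>SU_n1\<^esub> h = mat 1" "inv\<^bsub>SU_n1\<^esub> h ** h = mat 1"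
    using r_inv[OF c] l_inv[OF c] by (simp_all add: SU_n1_simps)
qed

lemma H_form: "h \<in> H \<Longrightarrow> herm_form (h *v x) (h *v y) = herm_form x y"
  using H_unitary by (simp add: form_unitary_def)

text \<open>The factor \<open>s\<close> is a root of the inverse determinant; as the determinant has
  modulus 1, so has \<open>s\<close>, and the form is still preserved. All consequences of
  maximality beyond commutativity are drawn from this lemma.\<close>

lemma unitary_commutant_in_H:
  assumes A: "form_unitary A" and com: "\<And>h. h \<in> H \<Longrightarrow> A ** h = h ** A"
  obtains s B where "cmod s = 1" "B \<in> H" "\<And>x. B *v x = s *s (A *v x)"
proof -
  define m where "m = CARD('n option)"
  define d where "d = det A"
  have d: "cmod d = 1" unfolding d_def by (rule form_unitary_det[OF A])
  then have d0: "d \<noteq> 0" by auto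
  define s where "s = exp (Ln (1 / d) / of_nat m)"
  have "cmod s = exp (Re (Ln (1 / d)) / real m)"
    by (simp add: s_def Re_divide_of_nat)
  also have "Re (Ln (1 / d)) = 0" using d d0 by (simp add: Re_Ln norm_divide)
  finally have s: "cmod s = 1" by simp
  have "m > 0" by (simp add: m_def)
  then have "s ^ m = exp (Ln (1 / d))" by (simp add: s_def exp_of_nat_mult[symmetric])
  then have sm: "s ^ m = 1 / d" using d0 by simp
  define B where "B = (\<chi> i. s *s A $ i)"
  have Bx: "B *v x = s *s (A *v x)" for x
    by (simp add: B_def vec_eq_iff matrix_vector_mult_def sum_distrib_left mult.assoc)
  have "det B = (\<Prod>i\<in>(UNIV::'n option set). s) * det (\<chi> i. A $ i)" unfolding B_def by (rule det_rows_mul)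
  then have "det B = s ^ m * d" by (simp add: m_def d_def)
  then have "det B = 1" using sm d0 by simp
  moreover have "cnj s * s = 1" using s by (metis complex_norm_square mult.commute of_real_1 one_power2)
  then have "form_unitary B"
    using A by (simp add: form_unitary_def Bx herm_form_smult_left herm_form_smult_right mult.assoc[symmetric] mult.commute[of s])
  ultimately have Bc: "B \<in> carrier SU_n1" by (simp add: SU_n1_simps)
  have "B ** h = h ** B" if "h \<in> H" for h
    unfolding matrix_eq
    using com[OF that] by (metis Bx matrix_vector_mul_assoc vector_scalar_commute)
  then have "B \<in> H"
    by (intro maximal_abelian_contains_centralizer[OF group_SU_n1 max Bc]) (simp add: SU_n1_simps)
  then show thesis using that s Bx by blast
qed

lemma orbit_span_self: "v \<in> orbit_span H v"
  unfolding orbit_span_def using H_one by (intro vec.span_base) force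

lemma orbit_span_invariant:
  assumes "h \<in> H" "x \<in> orbit_span H v"
  shows "h *v x \<in> orbit_span H v"
  using assms(2) unfolding orbit_span_def
proof (induction rule: vec.span_induct_alt)
  case base
  then show ?case by (simp add: vec.span_zero)
next
  case (step c b x)
  then obtain k where "k \<in> H" "b = k *v v" by auto
  then have "h *v b \<in> vec.span ((\<lambda>h. h *v v) ` H)"
    using H_mult[OF assms(1)] by (intro vec.span_base) (auto simp: matrix_vector_mul_assoc)
  then show ?case using step(2)
    by (simp add: matrix_vector_right_distrib vector_scalar_commute vec.span_add vec.span_scale)
qed

lemma orbit_span_minimal:
  assumes "x \<in> orbit_span H v"
  shows "orbit_span H x \<subseteq> orbit_span H v"
  unfolding orbit_span_def[of H x]
  by (rule vec.span_minimal) (use orbit_span_invariant[OF _ assms] in \<open>auto simp: orbit_span_def\<close>)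

text \<open>If the orbit of a positive \<open>v\<close> does not span, the reflection in its span commutes with \<open>H\<close>,
  hence lies in \<open>H\<close> up to a scalar, and separates \<open>v\<close> from a vector orthogonal to it.\<close>

lemma positive_cyclic_vector:
  obtains v where "hquad v > 0" "orbit_span H v = UNIV"
proof -
  let ?pos = "\<lambda>v :: complex^('n option). hquad v > 0"
  let ?dim = "\<lambda>v. vec.dim (orbit_span H v)"
  have pos: "?pos (axis None 1)"
    by (simp add: hquad_def axis_def)
  have bounded: "\<forall>v. ?pos v \<longrightarrow> ?dim v < Suc (CARD('n option))"
  proof (intro allI impI)
    fix v :: "complex^('n option)"
    show "?dim v < Suc (CARD('n option))"
      using vec.dim_subset_UNIV[of "orbit_span H v"] unfolding vec.dimension_def card_cart_basis by linarith
  qed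
  have "\<exists>v. ?pos v \<and> (\<forall>v'. ?pos v' \<longrightarrow> ?dim v' \<le> ?dim v)"
    by (rule ex_has_greatest_nat[of ?pos, OF pos bounded])
  then obtain v where v: "hquad v > 0" "\<And>v'. hquad v' > 0 \<Longrightarrow> ?dim v' \<le> ?dim v"
    by blast
  define W where "W = orbit_span H v"
  have "W = UNIV"
  proof (rule ccontr)
    assume nW: "W \<noteq> UNIV"
    have Wsub: "vec.subspace W" by (simp add: W_def orbit_span_def)
    have vW: "v \<in> W" by (simp add: W_def orbit_span_self)
    define P where "P = {u. \<forall>w\<in>W. herm_form u w = 0}"
    have decomp: "\<exists>w\<in>W. \<exists>u\<in>P. x = w + u" for x
      unfolding P_def by (rule form_orthogonal_decomposition[OF Wsub vW v(1), of x]) blast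
    have hW: "h *v w \<in> W" if "h \<in> H" "w \<in> W" for h w
      using orbit_span_invariant that by (simp add: W_def)
    have hP: "h *v u \<in> P" if h: "h \<in> H" and u: "u \<in> P" for h u
    proof -
      obtain k where k: "k \<in> H" "h ** k = mat 1" "k ** h = mat 1" by (rule H_inverse[OF h])
      have "herm_form (h *v u) w = 0" if "w \<in> W" for w
      proof -
        have "herm_form (h *v u) (h *v (k *v w)) = herm_form u (k *v w)" by (rule H_form[OF h])
        then show ?thesis using u hW[OF k(1) that] by (simp add: matrix_vector_mul_assoc k P_def)
      qed
      then show ?thesis by (simp add: P_def)
    qed
    define R where "R = (\<lambda>w. (w, w)) ` W \<union> (\<lambda>u. (u, - u)) ` P"
    have PW: "herm_form u w = 0" "herm_form w u = 0" if "u \<in> P" "w \<in> W" for u w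
    proof -
      show "herm_form u w = 0" using that by (simp add: P_def)
      then show "herm_form w u = 0" using herm_form_cnj[of u w] by simp
    qed
    have neg: "herm_form (- x) y = - herm_form x y" "herm_form x (- y) = - herm_form x y" for x y :: "complex^('n option)"
      using herm_form_diff_left[of 0 x y] herm_form_diff_right[of x 0 y] by simp_all
    have gram: "herm_form y y' = herm_form x x'" if "(x, y) \<in> R" "(x', y') \<in> R" for x y x' y'
      using that PW by (auto simp: R_def neg)
    have sp: "vec.span S = UNIV" if "W \<subseteq> S" "P \<subseteq> S" for S
    proof -
      have "x \<in> vec.span S" for x
      proof -
        obtain w u where "w \<in> W" "u \<in> P" and x: "x = w + u" using decomp[of x] by blast
        then show ?thesis unfolding x using that by (intro vec.span_add vec.span_base) auto
      qed
      then show ?thesis by blast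
    qed
    have sp2: "W \<subseteq> snd ` R" "P \<subseteq> snd ` R"
    proof -
      show "W \<subseteq> snd ` R" by (force simp: R_def)
      have "- u \<in> P" if "u \<in> P" for u using that by (simp add: P_def neg)
      then show "P \<subseteq> snd ` R" unfolding R_def by (force intro: image_eqI[of _ _ "(- _, _)"])
    qed
    have sp1: "W \<subseteq> fst ` R" "P \<subseteq> fst ` R" by (force simp: R_def)+
    obtain A where A: "form_unitary A" "\<And>x y. (x, y) \<in> R \<Longrightarrow> A *v x = y"
      using form_unitary_extend[OF gram sp[OF sp1] sp[OF sp2]] by blast
    have AW: "A *v w = w" if "w \<in> W" for w using A(2) that by (auto simp: R_def)
    have AP: "A *v u = - u" if "u \<in> P" for u using A(2) that by (auto simp: R_def)
    have neg_mult: "h *v (- u) = - (h *v u)" for h :: "complex^('n option)^('n option)" and u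
      using matrix_vector_mult_diff_distrib[of h 0 u] by simp
    have "A ** h = h ** A" if h: "h \<in> H" for h
    proof (rule matrix_eq_on_span[OF sp[of "W \<union> P"]])
      fix x assume "x \<in> W \<union> P"
      then show "A ** h *v x = h ** A *v x"
        by (auto simp: matrix_vector_mul_assoc[symmetric] AW AP hW[OF h] hP[OF h] neg_mult)
    qed auto
    from unitary_commutant_in_H[OF A(1) this] obtain s B
      where B: "cmod s = 1" "B \<in> H" "\<And>x. B *v x = s *s (A *v x)" by blast
    obtain x where "x \<notin> W" using nW by blast
    then obtain w u where wu: "x = w + u" "w \<in> W" "u \<in> P" using decomp[of x] by blast
    have uW: "u \<notin> W" using wu \<open>x \<notin> W\<close> vec.subspace_add[OF Wsub] by blast
    \<comment> \<open>With this \<open>t\<close> the form value of \<open>t *s v\<close> is at least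
      \<open>hquad v + \<bar>hquad u\<bar>\<close>, so adding \<open>u\<close> leaves it
      positive.\<close>
    define t where "t = complex_of_real (1 + \<bar>hquad u\<bar> / hquad v)"
    have t1: "1 + \<bar>hquad u\<bar> / hquad v \<ge> 1" using v(1) by simp
    then have t0: "t \<noteq> 0" unfolding t_def by (metis not_one_le_zero of_real_eq_0_iff)
    define v' where "v' = t *s v + u"
    have "herm_form v' v' = herm_form (t *s v) (t *s v) + herm_form u u"
      using PW[OF wu(3) vW] by (simp add: v'_def herm_form_simps)
    then have "complex_of_real (hquad v') = complex_of_real (hquad (t *s v) + hquad u)"
      by (simp add: herm_form_self)
    then have hv': "hquad v' = (1 + \<bar>hquad u\<bar> / hquad v)\<^sup>2 * hquad v + hquad u"
      by (simp only: of_real_eq_iff hquad_smult) (simp only: t_def norm_of_real power2_abs)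
    have "(1 + \<bar>hquad u\<bar> / hquad v) * hquad v \<le> (1 + \<bar>hquad u\<bar> / hquad v)\<^sup>2 * hquad v"
      using t1 v(1) self_le_power[OF t1, of 2] by (intro mult_right_mono) auto
    moreover have "(1 + \<bar>hquad u\<bar> / hquad v) * hquad v = hquad v + \<bar>hquad u\<bar>"
      using v(1) by (simp add: field_simps)
    ultimately have "hquad v' > 0" using v(1) hv' by linarith
    define W' where "W' = orbit_span H v'"
    have W'sub: "vec.subspace W'" by (simp add: W'_def orbit_span_def)
    have v'W': "v' \<in> W'" by (simp add: W'_def orbit_span_self)
    \<comment> \<open>\<open>B\<close> is the scalar \<open>s\<close> on \<open>W\<close> and
      \<open>- s\<close> on \<open>P\<close>. The orbit span of \<open>v'\<close> therefore contains
      \<open>v\<close> and \<open>u\<close> separately and is strictly larger than \<open>W\<close>,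
      against the choice of \<open>v\<close> with an orbit span of greatest dimension.\<close>
    have "B *v v' \<in> W'" using orbit_span_invariant[OF B(2)] v'W' by (simp add: W'_def)
    moreover have "B *v v' = s *s (t *s v - u)"
      by (simp add: B(3) v'_def matrix_vector_right_distrib vector_scalar_commute AW[OF vW] AP[OF wu(3)])
    moreover have "inverse s *s (s *s (t *s v - u)) = t *s v - u"
    proof -
      have "inverse s * s = 1" using B(1) by (intro left_inverse) auto
      then show ?thesis by (simp only: vector_smult_assoc vector_smult_lid)
    qed
    ultimately have m: "t *s v - u \<in> W'" using vec.subspace_scale[OF W'sub, of "B *v v'" "inverse s"] by simp
    have "v' + (t *s v - u) = (2 * t) *s v" by (simp add: v'_def vec_eq_iff)
    then have "(2 * t) *s v \<in> W'" using vec.subspace_add[OF W'sub v'W' m] by simp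
    then have "inverse (2 * t) *s ((2 * t) *s v) \<in> W'" by (rule vec.subspace_scale[OF W'sub])
    moreover have "inverse (2 * t) *s ((2 * t) *s v) = v" using t0 by (simp add: vec_eq_iff)
    ultimately have vW': "v \<in> W'" by simp
    have "v' - t *s v \<in> W'" by (intro vec.subspace_diff W'sub v'W' vec.subspace_scale vW')
    then have uW': "u \<in> W'" by (simp add: v'_def)
    have "W \<subseteq> W'" unfolding W_def W'_def by (rule orbit_span_minimal) (use vW' in \<open>simp add: W'_def\<close>)
    then have "W \<subset> W'" using uW uW' by blast
    then have "vec.dim W < vec.dim W'"
      using vec.dim_psubset[of W W'] by (simp add: vec.span_eq_iff[THEN iffD2] Wsub W'sub)
    then show False using v(2)[OF \<open>hquad v' > 0\<close>] by (simp add: W_def W'_def)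
  qed
  then show thesis using that[OF v(1)] by (simp add: W_def)
qed

lemma cyclic_point:
  obtains z0 where "z0 \<in> ball 0 1" "orbit_span H (hlift z0) = UNIV"
proof -
  obtain v where v: "hquad v > 0" "orbit_span H v = UNIV" by (rule positive_cyclic_vector)
  have "v $ None \<noteq> 0" using v(1) by (rule hquad_pos_nonzero)
  then have eq: "v = (v $ None) *s hlift (hproj v)" by (rule hlift_hproj)
  have "v \<in> orbit_span H (hlift (hproj v))"
    by (subst eq) (simp add: orbit_span_def vec.span_scale orbit_span_self[unfolded orbit_span_def])
  then have "orbit_span H (hlift (hproj v)) = UNIV" using orbit_span_minimal v(2) by blast
  then show thesis using that hquad_hproj[OF v(1)] by blast
qed

text \<open>Cyclicity at \<open>z0\<close> is witnessed by \<open>n + 1\<close> elements of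
  \<open>H\<close> whose orbit vectors form a basis. The determinant of the corresponding vectors at
  \<open>z\<close> is continuous in \<open>z\<close>, so the same elements work nearby.\<close>

lemma cyclic_open:
  assumes "orbit_span H (hlift z0) = UNIV"
  obtains r where "r > 0" "\<And>z. z \<in> ball z0 r \<Longrightarrow> orbit_span H (hlift z) = UNIV"
proof -
  define V where "V = (\<lambda>h. h *v hlift z0) ` H"
  obtain S where S: "S \<subseteq> V" "vec.independent S" "V \<subseteq> vec.span S" "card S = vec.dim V"
    using vec.basis_exists[of V] by metis
  have spV: "vec.span V = UNIV" using assms by (simp add: orbit_span_def V_def)
  then have spS: "vec.span S = UNIV" using S(3) by (metis vec.span_mono vec.span_span top.extremum_uniqueI)
  have "card S = CARD('n option)"
    using S(4) spV vec.dim_eq_full[of V] by (simp add: vec.dimension_def card_cart_basis)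
  moreover have "finite S" using vec.finiteI_independent[OF S(2)] .
  ultimately obtain f where f: "bij_betw f (UNIV :: 'n option set) S"
    using finite_same_card_bij[of "UNIV :: 'n option set" S] by auto
  have "\<forall>k. \<exists>h\<in>H. f k = h *v hlift z0" using f S(1) unfolding V_def bij_betw_def by blast
  then obtain g where g: "\<And>k. g k \<in> H" "\<And>k. f k = g k *v hlift z0" by metis
  define M where "M z = (\<chi> k. g k *v hlift z)" for z
  have row: "row k (M z) = g k *v hlift z" for k z by (simp add: row_def M_def vec_eq_iff)
  have "rows (M z0) = S"
  proof -
    have "rows (M z0) = range f" by (auto simp: rows_def row g(2))
    then show ?thesis using f by (simp add: bij_betw_def)
  qed
  then have "\<exists>B. B ** M z0 = mat 1" using spS matrix_left_invertible_span_rows_gen by blast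
  then have det0: "det (M z0) \<noteq> 0" by (metis invertible_det_nz invertible_left_inverse)
  have cont: "continuous_on UNIV (\<lambda>z. det (M z))"
  proof -
    have "continuous_on UNIV (\<lambda>z. M z $ i $ j)" for i j
      by (simp add: M_def matrix_vector_mult_def sum_UNIV_option) (intro continuous_intros)
    then show ?thesis
      unfolding det_def by (intro continuous_on_sum continuous_on_mult continuous_on_prod continuous_on_const)
  qed
  have "open {z. det (M z) \<noteq> 0}"
    using open_vimage[OF open_Compl[OF closed_singleton] cont, of 0] by (simp add: vimage_def)
  then obtain r where r: "r > 0" "ball z0 r \<subseteq> {z. det (M z) \<noteq> 0}"
    using det0 open_contains_ball by blast
  show thesis
  proof (rule that[OF r(1)])
    fix z assume "z \<in> ball z0 r"
    then have "det (M z) \<noteq> 0" using r by blast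
    then have "\<exists>B. B ** M z = mat 1" by (metis invertible_det_nz invertible_left_inverse)
    then have "vec.span (rows (M z)) = UNIV" using matrix_left_invertible_span_rows_gen by blast
    moreover have "rows (M z) \<subseteq> (\<lambda>h. h *v hlift z) ` H" using g(1) by (auto simp: rows_def row)
    ultimately show "orbit_span H (hlift z) = UNIV"
      unfolding orbit_span_def using vec.span_mono by blast
  qed
qed

text \<open>For a cyclic \<open>v\<close> the map \<open>h v \<mapsto> h\<^sup>-\<^sup>1 v\<close> extends to an antilinear involution \<open>x \<mapsto> A (cnjv x)\<close>
  inverting \<open>H\<close>. It moves each cyclic vector along its own orbit, since the map
  \<open>h x \<mapsto> h (A (cnjv x))\<close> preserves the form and commutes with \<open>H\<close>.\<close>

lemma conjugation_exists:
  obtains A z0 r where "form_unitary A" "z0 \<in> ball 0 1" "r > 0"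
    "\<And>x. A *v cnjv (A *v cnjv x) = x" "A *v cnjv (hlift z0) = hlift z0"
    "\<And>z. z \<in> ball z0 r \<Longrightarrow> \<exists>h\<in>H. \<exists>s. cmod s = 1 \<and> A *v cnjv (hlift z) = s *s (h *v hlift z)"
proof -
  obtain z0 where z0: "z0 \<in> ball 0 1" "orbit_span H (hlift z0) = UNIV" by (rule cyclic_point)
  obtain r where r: "r > 0" "\<And>z. z \<in> ball z0 r \<Longrightarrow> orbit_span H (hlift z) = UNIV"
    by (rule cyclic_open[OF z0(2)]) blast
  define v where "v = hlift z0"
  have spv: "vec.span ((\<lambda>h. h *v v) ` H) = UNIV" using z0(2) by (simp add: orbit_span_def v_def)
  have form_cnjv: "herm_form (cnjv x) (cnjv y) = herm_form y x" for x y :: "complex^('n option)"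
    by (simp add: herm_form_def mult.commute)
  \<comment> \<open>Apply the invariance of the form under \<open>h ** k\<close> to the vectors
    \<open>k' x\<close> and \<open>h' x\<close>. Inverting the group elements exchanges the
    arguments of the form, which is why the inversion extends antilinearly.\<close>
  have com3: "herm_form (h *v x) (k *v x) = herm_form (k' *v x) (h' *v x)"
    if "h \<in> H" "k \<in> H" "h ** h' = mat 1" "k ** k' = mat 1" "h' \<in> H" "k' \<in> H" for h k h' k' x
  proof -
    have e1: "(h ** k) *v (k' *v x) = h *v x"
      by (simp add: matrix_vector_mul_assoc matrix_mul_assoc[symmetric] that(4))
    have "(k ** h) *v (h' *v x) = k *v x"
      by (simp add: matrix_vector_mul_assoc matrix_mul_assoc[symmetric] that(3))
    then have e2: "(h ** k) *v (h' *v x) = k *v x" unfolding H_commute[OF that(1,2)] .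
    show ?thesis
      using H_form[OF H_mult[OF that(1,2)], of "k' *v x" "h' *v x"] unfolding e1 e2 .
  qed
  \<comment> \<open>The conjugate in the first component turns the antilinear extension problem into
    a complex linear one.\<close>
  define R where "R = {(cnjv (h *v v), k *v v) | h k. h \<in> H \<and> k \<in> H \<and> h ** k = mat 1}"
  have gram: "herm_form y y' = herm_form x x'" if "(x, y) \<in> R" "(x', y') \<in> R" for x y x' y'
  proof -
    obtain h k where hk: "x = cnjv (h *v v)" "y = k *v v" "h \<in> H" "k \<in> H" "h ** k = mat 1"
      using \<open>(x, y) \<in> R\<close> unfolding R_def mem_Collect_eq prod.inject by blast
    obtain h' k' where hk': "x' = cnjv (h' *v v)" "y' = k' *v v" "h' \<in> H" "k' \<in> H" "h' ** k' = mat 1"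
      using \<open>(x', y') \<in> R\<close> unfolding R_def mem_Collect_eq prod.inject by blast
    have "herm_form (h' *v v) (h *v v) = herm_form (k *v v) (k' *v v)"
      by (rule com3[OF hk'(3) hk(3) hk'(5) hk(5) hk'(4) hk(4)])
    then show ?thesis by (simp add: hk hk' form_cnjv)
  qed
  have cnjv_span: "cnjv x \<in> vec.span (cnjv ` S)" if "x \<in> vec.span S" for x and S :: "(complex^('n option)) set"
    using that
  proof (induction rule: vec.span_induct_alt)
    case base
    have "cnjv (0 :: complex^('n option)) = 0" by (simp add: vec_eq_iff)
    then show ?case by (simp add: vec.span_zero)
  next
    case (step c b x)
    then show ?case by (simp add: cnjv_add cnjv_smult vec.span_add vec.span_scale vec.span_base)
  qed
  have dom: "vec.span (fst ` R) = UNIV"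
  proof -
    have "cnjv ` (\<lambda>h. h *v v) ` H \<subseteq> fst ` R"
    proof (rule subsetI)
      fix y assume "y \<in> cnjv ` (\<lambda>h. h *v v) ` H"
      then obtain h where h: "h \<in> H" "y = cnjv (h *v v)" by blast
      obtain k where "k \<in> H" "h ** k = mat 1" "k ** h = mat 1" by (rule H_inverse[OF h(1)])
      then have "(y, k *v v) \<in> R" using h unfolding R_def by blast
      then show "y \<in> fst ` R" by force
    qed
    from vec.span_mono[OF this] have sub: "vec.span (cnjv ` (\<lambda>h. h *v v) ` H) \<subseteq> vec.span (fst ` R)" .
    have "x \<in> vec.span (fst ` R)" for x
    proof -
      have "cnjv x \<in> vec.span ((\<lambda>h. h *v v) ` H)" using spv by simp
      from subsetD[OF sub cnjv_span[OF this]] show ?thesis by simp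
    qed
    then show ?thesis by blast
  qed
  have ran: "vec.span (snd ` R) = UNIV"
  proof -
    have "(\<lambda>h. h *v v) ` H \<subseteq> snd ` R"
    proof (rule subsetI)
      fix y assume "y \<in> (\<lambda>h. h *v v) ` H"
      then obtain k where k: "k \<in> H" "y = k *v v" by blast
      obtain h where "h \<in> H" "k ** h = mat 1" "h ** k = mat 1" by (rule H_inverse[OF k(1)])
      then have "(cnjv (h *v v), y) \<in> R" using k unfolding R_def by blast
      then show "y \<in> snd ` R" by force
    qed
    from vec.span_mono[OF this] show ?thesis by (simp add: spv top.extremum_unique)
  qed
  obtain A where A: "form_unitary A" "\<And>x y. (x, y) \<in> R \<Longrightarrow> A *v x = y"
    using form_unitary_extend[OF gram dom ran] by blast
  define C where "C x = A *v cnjv x" for x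
  have Cadd: "C (x + y) = C x + C y" and Csm: "C (c *s x) = cnj c *s C x" and C0: "C 0 = 0" for x y c
  proof -
    show "C (x + y) = C x + C y" by (simp add: C_def cnjv_add matrix_vector_right_distrib)
    show "C (c *s x) = cnj c *s C x" by (simp add: C_def cnjv_smult vector_scalar_commute)
    have "cnjv (0 :: complex^('n option)) = 0" by (simp add: vec_eq_iff)
    then show "C 0 = 0" by (simp add: C_def)
  qed
  have Cv: "C (h *v v) = k *v v" if "h \<in> H" "k \<in> H" "h ** k = mat 1" for h k
    unfolding C_def by (rule A(2)) (use that in \<open>auto simp: R_def\<close>)
  have v_induct: "Q x" if "Q 0" "\<And>c h y. h \<in> H \<Longrightarrow> Q y \<Longrightarrow> Q (c *s (h *v v) + y)" for Q x
  proof -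
    have "x \<in> vec.span ((\<lambda>h. h *v v) ` H)" using spv by simp
    then show ?thesis by (induction rule: vec.span_induct_alt) (use that in auto)
  qed
  have CC: "C (C x) = x" for x
  proof (rule v_induct[of "\<lambda>x. C (C x) = x"])
    fix c h y assume h: "h \<in> H" and y: "C (C y) = y"
    obtain k where "k \<in> H" "h ** k = mat 1" "k ** h = mat 1" by (rule H_inverse[OF h])
    then have "C (C (h *v v)) = h *v v" using Cv h by metis
    then show "C (C (c *s (h *v v) + y)) = c *s (h *v v) + y" by (simp add: Cadd Csm y)
  qed (simp add: C0)
  \<comment> \<open>\<open>C\<close> intertwines every element of \<open>H\<close> with its inverse;
    on the orbit of \<open>v\<close> this is the definition, since inverses in an abelian group
    multiply.\<close>
  have Ch: "C (h *v x) = k *v C x" if h: "h \<in> H" and k: "k \<in> H" "h ** k = mat 1" for h k x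
  proof (rule v_induct[of "\<lambda>x. C (h *v x) = k *v C x"])
    fix c l y assume l: "l \<in> H" and y: "C (h *v y) = k *v C y"
    obtain m where m: "m \<in> H" "l ** m = mat 1" "m ** l = mat 1" by (rule H_inverse[OF l])
    have "(h ** l) ** (k ** m) = (h ** k) ** (l ** m)"
      using H_commute[OF l k(1)] by (metis matrix_mul_assoc)
    then have "C ((h ** l) *v v) = (k ** m) *v v"
      using h k l m by (intro Cv H_mult) (auto simp: matrix_mul_lid)
    then have "C (h *v (l *v v)) = k *v C (l *v v)"
      by (simp add: Cv[OF l m(1,2)] matrix_vector_mul_assoc)
    then show "C (h *v (c *s (l *v v) + y)) = k *v C (c *s (l *v v) + y)"
      by (simp add: Cadd Csm y matrix_vector_right_distrib vector_scalar_commute)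
  qed (simp add: C0)
  have Cform: "herm_form (C x) (C y) = herm_form y x" for x y
    using A(1) by (simp add: C_def form_unitary_def form_cnjv)
  have moved: "\<exists>h\<in>H. \<exists>s. cmod s = 1 \<and> C x = s *s (h *v x)" if x: "orbit_span H x = UNIV" for x
  proof -
    have spx: "vec.span ((\<lambda>h. h *v x) ` H) = UNIV" using x by (simp add: orbit_span_def)
    define R where "R = (\<lambda>h. (h *v x, h *v C x)) ` H"
    have gram: "herm_form y y' = herm_form z z'" if "(z, y) \<in> R" "(z', y') \<in> R" for z y z' y'
    proof -
      obtain h where h: "h \<in> H" "z = h *v x" "y = h *v C x"
        using \<open>(z, y) \<in> R\<close> unfolding R_def by blast
      obtain k where k: "k \<in> H" "z' = k *v x" "y' = k *v C x"
        using \<open>(z', y') \<in> R\<close> unfolding R_def by blast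
      obtain h' where h': "h' \<in> H" "h ** h' = mat 1" "h' ** h = mat 1" by (rule H_inverse[OF h(1)])
      obtain k' where k': "k' \<in> H" "k ** k' = mat 1" "k' ** k = mat 1" by (rule H_inverse[OF k(1)])
      have "herm_form y y' = herm_form (C (h' *v x)) (C (k' *v x))"
        using Ch[OF h'(1) h(1) h'(3)] Ch[OF k'(1) k(1) k'(3)] by (simp add: h k)
      also have "\<dots> = herm_form (k' *v x) (h' *v x)" by (rule Cform)
      also have "\<dots> = herm_form z z'" unfolding h(2) k(2)
        by (rule com3[OF h(1) k(1) h'(2) k'(2) h'(1) k'(1), symmetric])
      finally show ?thesis .
    qed
    have dom: "vec.span (fst ` R) = UNIV" using spx by (simp add: R_def image_image)
    have "C y \<in> vec.span (snd ` R)" for y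
    proof -
      have "y \<in> vec.span ((\<lambda>h. h *v x) ` H)" using spx by simp
      then show ?thesis
      proof (induction rule: vec.span_induct_alt)
        case base
        then show ?case by (simp add: C0 vec.span_zero)
      next
        case (step c b y)
        then obtain h where h: "h \<in> H" "b = h *v x" by blast
        obtain k where k: "k \<in> H" "h ** k = mat 1" "k ** h = mat 1" by (rule H_inverse[OF h(1)])
        have "C b = k *v C x" using Ch[OF h(1) k(1,2)] h by simp
        then have "C b \<in> vec.span (snd ` R)" using k(1) by (intro vec.span_base) (force simp: R_def)
        then show ?case using step(2) by (simp add: Cadd Csm vec.span_add vec.span_scale)
      qed
    qed
    then have "C (C y) \<in> vec.span (snd ` R)" for y by blast
    then have ran: "vec.span (snd ` R) = UNIV" by (auto simp: CC)
    obtain U where U: "form_unitary U" "\<And>x y. (x, y) \<in> R \<Longrightarrow> U *v x = y"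
      using form_unitary_extend[OF gram dom ran] by blast
    have Uh: "U *v (h *v x) = h *v C x" if "h \<in> H" for h using U(2) that by (auto simp: R_def)
    have "U ** h = h ** U" if h: "h \<in> H" for h
    proof (rule matrix_eq_on_span[OF spx])
      fix y assume "y \<in> (\<lambda>h. h *v x) ` H"
      then obtain k where k: "k \<in> H" "y = k *v x" by blast
      have "U *v ((h ** k) *v x) = (h ** k) *v C x" by (rule Uh[OF H_mult[OF h k(1)]])
      then show "(U ** h) *v y = (h ** U) *v y"
        using Uh[OF k(1)] k(2) by (simp add: matrix_vector_mul_assoc[symmetric])
    qed
    from unitary_commutant_in_H[OF U(1) this] obtain s B
      where B: "cmod s = 1" "B \<in> H" "\<And>x. B *v x = s *s (U *v x)" by blast
    have "U *v x = C x" using Uh[OF H_one] by simp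
    then have "B *v x = s *s C x" by (simp add: B(3))
    moreover have "s \<noteq> 0" using B(1) by auto
    ultimately have "C x = inverse s *s (B *v x)" by (simp add: vector_smult_assoc)
    moreover have "cmod (inverse s) = 1" using B(1) by (simp add: norm_inverse)
    ultimately show ?thesis using B(2) by blast
  qed
  have "C v = v" using Cv[OF H_one H_one] by simp
  then show thesis
    using that[OF A(1) z0(1) r(1)] CC moved[OF r(2)] by (simp add: C_def v_def)
qed

end

subsection \<open>The commutant\<close>

lemma cnjv_vimage_ball: "cnjv -` ball 0 1 = ball 0 1"
  by auto

lemma continuous_on_cnjv: "continuous_on S cnjv"
  by (rule linear_continuous_on[OF linear_conv_bounded_linear[THEN iffD1, OF linear_cnjv]])

lemma continuous_on_ball_action:
  assumes "form_unitary A"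
  shows "continuous_on (ball 0 1) (ball_action A)"
proof -
  have "continuous_on (ball 0 1) (\<lambda>z. \<chi> i. ball_action A z $ i)"
    by (intro continuous_on_vec_lambda holomorphic_in_continuous_on holomorphic_in_ball_action assms)
  then show ?thesis by simp
qed

lemma exp_log_multiplier:
  assumes "exp l = w"
  shows "cmod (exp (- of_real a * l)) = cmod w powr (- a)"
  using assms by (auto simp: powr_def)

context bergman
begin

lemma multiplier_log:
  assumes A: "form_unitary A"
    and L: "holomorphic_in L (ball 0 1)" "\<And>z. z \<in> ball 0 1 \<Longrightarrow> exp (L z) = aut_denom A z"
  shows "multiplier A (\<lambda>z. exp (- of_real lam * L z))"
  unfolding multiplier_def
proof (intro conjI ballI A)
  show "holomorphic_in (\<lambda>z. exp (- of_real lam * L z)) (ball 0 1)"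
    by (rule holomorphic_in_exp[OF holomorphic_in_mult[OF holomorphic_in_const L(1)]])
  show "cmod (exp (- of_real lam * L z)) = cmod (aut_denom A z) powr (- lam)" if "z \<in> ball 0 1" for z
    by (rule exp_log_multiplier[OF L(2)[OF that]])
qed

lemma nn_integral_bmeas_cnjv:
  assumes [measurable]: "f \<in> borel_measurable borel"
  shows "(\<integral>\<^sup>+ z. f (cnjv z) \<partial>bmeas lam) = (\<integral>\<^sup>+ z. f (z :: complex^'n) \<partial>bmeas lam)"
proof -
  obtain \<kappa> where \<kappa>: "\<And>f :: complex^'n \<Rightarrow> ennreal. f \<in> borel_measurable borel \<Longrightarrow>
    (\<integral>\<^sup>+ z. f z \<partial>bmeas lam) = ennreal \<kappa> * (\<integral>\<^sup>+ z. ennreal (bweight lam z) * f z \<partial>lborel)"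
    using nn_integral_bmeas_exists[OF lam] by blast
  have [measurable]: "(cnjv :: complex^'n \<Rightarrow> _) \<in> borel_measurable borel"
    by (rule borel_measurable_continuous_onI[OF continuous_on_cnjv])
  have "(\<integral>\<^sup>+ z. ennreal (bweight lam z) * f z \<partial>lborel) =
      ennreal (1 ^ DIM(complex^'n)) * (\<integral>\<^sup>+ z. ennreal (bweight lam (cnjv z)) * f (cnjv z) \<partial>lborel)"
    by (rule nn_integral_similarity[OF linear_cnjv]) auto
  moreover have "bweight lam (cnjv z) = bweight lam z" for z :: "complex^'n"
    by (simp add: bweight_def indicator_def)
  ultimately show ?thesis by (simp add: \<kappa>)
qed

text \<open>The bound is explicit because the estimates for functionals built from \<open>S\<close>
  depend on it.\<close>

definition bounded_op :: "((complex^'n \<Rightarrow> complex) \<Rightarrow> (complex^'n \<Rightarrow> complex)) \<Rightarrow> real \<Rightarrow> bool" where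
  "bounded_op S C \<longleftrightarrow> (\<forall>f\<in>A2. S f \<in> A2) \<and>
     (\<forall>f\<in>A2. \<forall>g\<in>A2. S (\<lambda>z. f z + g z) = (\<lambda>z. S f z + S g z)) \<and>
     (\<forall>c. \<forall>f\<in>A2. S (\<lambda>z. c * f z) = (\<lambda>z. c * S f z)) \<and>
     (\<forall>f\<in>A2. sqrt (bsq lam (S f)) \<le> C * sqrt (bsq lam f))"

lemma bounded_opD:
  assumes "bounded_op S C" "f \<in> A2"
  shows "S f \<in> A2" "g \<in> A2 \<Longrightarrow> S (\<lambda>z. f z + g z) = (\<lambda>z. S f z + S g z)"
    "S (\<lambda>z. c * f z) = (\<lambda>z. c * S f z)" "sqrt (bsq lam (S f)) \<le> C * sqrt (bsq lam f)"
  using assms by (auto simp: bounded_op_def)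

lemma bergman_bounded_operator_iff:
  "bergman_bounded_operator lam S \<longleftrightarrow> (\<exists>C. bounded_op S C)"
proof -
  have "bergman_norm lam f = sqrt (bsq lam f)" if "f \<in> A2" for f :: "complex^'n \<Rightarrow> complex"
    by (rule bergman_norm_eq[OF bL2_measurable[OF bergman_L2[OF that]]])
  then show ?thesis unfolding bergman_bounded_operator_def bounded_op_def by (auto 4 4)
qed

lemma bounded_op_compose:
  assumes "bounded_op S C" "bounded_op T D" "C \<ge> 0"
  shows "bounded_op (\<lambda>f. S (T f)) (C * D)"
  unfolding bounded_op_def
proof (intro conjI ballI allI)
  fix f g c assume f: "f \<in> A2"
  note T = bounded_opD[OF assms(2)]
  note S = bounded_opD[OF assms(1)]
  show "S (T f) \<in> A2" using f T S by blast
  show "S (T (\<lambda>z. c * f z)) = (\<lambda>z. c * S (T f) z)" using T(3)[OF f] S(3)[OF T(1)[OF f]] by simp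
  have "sqrt (bsq lam (S (T f))) \<le> C * sqrt (bsq lam (T f))" by (rule S(4)[OF T(1)[OF f]])
  also have "\<dots> \<le> C * (D * sqrt (bsq lam f))" by (rule mult_left_mono[OF T(4)[OF f] assms(3)])
  finally show "sqrt (bsq lam (S (T f))) \<le> C * D * sqrt (bsq lam f)" by (simp add: mult.assoc)
  assume g: "g \<in> A2"
  show "S (T (\<lambda>z. f z + g z)) = (\<lambda>z. S (T f) z + S (T g) z)"
    using T(2)[OF f g] S(2)[OF T(1)[OF f] T(1)[OF g]] by simp
qed

lemma bounded_op_nonneg:
  assumes "bounded_op S C"
  obtains C' where "C' \<ge> 0" "bounded_op S C'"
proof (rule that[of "max C 0"])
  have "C * sqrt (bsq lam f) \<le> max C 0 * sqrt (bsq lam f)" for f :: "complex^'n \<Rightarrow> complex"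
    by (intro mult_right_mono) auto
  then show "bounded_op S (max C 0)" using assms unfolding bounded_op_def by (meson order_trans)
qed simp

end

text \<open>The data of an antiholomorphic involution \<open>z \<mapsto> ball_action A (cnjv z)\<close> which near \<open>z0\<close> moves
  points along \<open>H\<close>-orbits.\<close>

locale conjugated_bergman = bergman lam N
  for lam :: real and N :: "'n::finite itself" +
  fixes H :: "(complex^('n option)^('n option)) set"
    and mult_of :: "complex^('n option)^('n option) \<Rightarrow> complex^'n \<Rightarrow> complex"
    and A :: "complex^('n option)^('n option)" and z0 :: "complex^'n" and r :: real
    and L :: "complex^'n \<Rightarrow> complex"
  assumes H_mult_of: "\<And>h. h \<in> H \<Longrightarrow> multiplier h (mult_of h)"
    and A: "form_unitary A" and z0: "z0 \<in> ball 0 1" and r: "r > 0"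
    and A_involution: "\<And>x. A *v cnjv (A *v cnjv x) = x"
    and A_fixed: "A *v cnjv (hlift z0) = hlift z0"
    and A_orbit: "\<And>z. z \<in> ball z0 r \<Longrightarrow> \<exists>h\<in>H. \<exists>s. cmod s = 1 \<and> A *v cnjv (hlift z) = s *s (h *v hlift z)"
    and L: "holomorphic_in L (ball 0 1)" "\<And>z. z \<in> ball 0 1 \<Longrightarrow> exp (L z) = aut_denom A z"
begin

definition \<sigma> :: "complex^'n \<Rightarrow> complex^'n" where "\<sigma> z = ball_action A (cnjv z)"

definition \<nu> :: "complex^'n \<Rightarrow> complex" where "\<nu> z = exp (- of_real lam * L (cnjv z))"

text \<open>Written as a weighted composition followed by conjugation of both the argument and the
  value, since each of these preserves the norm. The form with \<open>\<sigma>\<close> and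
  \<open>\<nu>\<close> is \<open>conj_op_apply\<close>.\<close>

definition conj_op :: "(complex^'n \<Rightarrow> complex) \<Rightarrow> complex^'n \<Rightarrow> complex" where
  "conj_op f = (\<lambda>z. cnj (wcomp A (\<lambda>z. exp (- of_real lam * L z)) f (cnjv z)))"

lemma multiplier_A: "multiplier A (\<lambda>z. exp (- of_real lam * L z))"
  by (rule multiplier_log[OF A L])

lemma cnjv_ball: "z \<in> ball 0 1 \<Longrightarrow> cnjv z \<in> ball (0 :: complex^'n) 1"
  by simp

lemma sigma_ball: "z \<in> ball 0 1 \<Longrightarrow> \<sigma> z \<in> ball 0 1"
  unfolding \<sigma>_def by (rule ball_action_in_ball[OF A cnjv_ball])

lemma cnjv_hlift: "cnjv (hlift z) = hlift (cnjv z)"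
  by (auto simp: vec_eq_iff hlift_def split: option.splits)

lemma A_hlift: "z \<in> ball 0 1 \<Longrightarrow> A *v cnjv (hlift z) = aut_denom A (cnjv z) *s hlift (\<sigma> z)"
  unfolding \<sigma>_def cnjv_hlift by (rule hlift_ball_action[OF aut_denom_nonzero[OF A cnjv_ball]])

text \<open>Both are read off from \<open>A_involution\<close> at \<open>hlift z\<close>: the last
  coordinate gives the product of the denominators, and the line gives the point.\<close>

lemma
  assumes z: "z \<in> ball 0 1"
  shows denom_sigma: "cnj (aut_denom A (cnjv z)) * aut_denom A (cnjv (\<sigma> z)) = 1"
    and sigma_sigma: "\<sigma> (\<sigma> z) = z"
proof -
  have "hlift z = A *v cnjv (aut_denom A (cnjv z) *s hlift (\<sigma> z))"
    using A_involution[of "hlift z"] A_hlift[OF z] by simp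
  also have "\<dots> = (cnj (aut_denom A (cnjv z)) * aut_denom A (cnjv (\<sigma> z))) *s hlift (\<sigma> (\<sigma> z))"
    by (simp add: cnjv_smult vector_scalar_commute A_hlift[OF sigma_ball[OF z]] vector_smult_assoc)
  finally have eq: "hlift z = (cnj (aut_denom A (cnjv z)) * aut_denom A (cnjv (\<sigma> z))) *s hlift (\<sigma> (\<sigma> z))" .
  from arg_cong[OF this, of "\<lambda>x. x $ None"]
  show 1: "cnj (aut_denom A (cnjv z)) * aut_denom A (cnjv (\<sigma> z)) = 1" by simp
  from eq have "hlift z = hlift (\<sigma> (\<sigma> z))" unfolding 1 by simp
  then show "\<sigma> (\<sigma> z) = z" by (metis hproj_hlift)
qed

lemma sigma_z0: "\<sigma> z0 = z0"
  using A_fixed unfolding \<sigma>_def ball_action_hlift cnjv_hlift by simp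

lemma continuous_on_sigma: "continuous_on (ball 0 1) \<sigma>"
  unfolding \<sigma>_def
  by (rule continuous_on_compose2[OF continuous_on_ball_action[OF A] continuous_on_cnjv]) auto

text \<open>The exponent is a continuous logarithm of 1, and it is real at \<open>z0\<close>.\<close>

lemma nu_sigma:
  assumes z: "z \<in> ball 0 1"
  shows "\<nu> (\<sigma> z) * cnj (\<nu> z) = 1"
proof -
  define E where "E z = L (cnjv (\<sigma> z)) + cnj (L (cnjv z))" for z
  have contL: "continuous_on (ball 0 1) L" by (rule holomorphic_in_continuous_on[OF L(1)])
  have cont: "continuous_on (ball 0 1) E"
  proof -
    have "continuous_on (ball 0 1) (\<lambda>z. L (cnjv (\<sigma> z)))"
      by (intro continuous_on_compose2[OF contL] continuous_on_compose2[OF continuous_on_cnjv continuous_on_sigma])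
        (use sigma_ball cnjv_ball in blast)+
    moreover have "continuous_on (ball 0 1) (\<lambda>z. L (cnjv z))"
      by (intro continuous_on_compose2[OF contL continuous_on_cnjv]) (use cnjv_ball in blast)
    ultimately show ?thesis unfolding E_def by (intro continuous_intros)
  qed
  have exp_E: "exp (E w) = 1" if w: "w \<in> ball 0 1" for w
    using L(2)[OF cnjv_ball[OF w]] L(2)[OF cnjv_ball[OF sigma_ball[OF w]]] denom_sigma[OF w]
    by (simp add: E_def exp_add exp_cnj[symmetric] mult.commute)
  have "E z = E z0"
    by (rule exp_one_imp_constant[OF _ cont exp_E z z0]) auto
  also have "E z0 = of_real (2 * Re (L (cnjv z0)))"
    by (simp add: E_def sigma_z0 complex_add_cnj)
  also have "2 * Re (L (cnjv z0)) = 0"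
  proof -
    have "exp (complex_of_real (2 * Re (L (cnjv z0)))) = 1"
      using exp_E[OF z0] by (simp add: E_def sigma_z0 complex_add_cnj)
    then have "complex_of_real (exp (2 * Re (L (cnjv z0)))) = 1" by (simp only: exp_of_real)
    then have "exp (2 * Re (L (cnjv z0))) = 1" by (simp only: of_real_eq_1_iff)
    then show ?thesis by simp
  qed
  finally have "E z = 0" by simp
  moreover have "\<nu> (\<sigma> z) * cnj (\<nu> z) = exp (- of_real lam * E z)"
    by (simp add: \<nu>_def E_def exp_cnj exp_add[symmetric] distrib_left)
  ultimately show ?thesis by simp
qed

lemma nu_nonzero: "\<nu> z \<noteq> 0"
  by (simp add: \<nu>_def)

lemma conj_op_apply: "z \<in> ball 0 1 \<Longrightarrow> conj_op f z = cnj (\<nu> z * f (\<sigma> z))"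
  by (simp add: conj_op_def wcomp_def \<nu>_def \<sigma>_def)

lemma conj_op_add: "conj_op (\<lambda>z. f z + g z) = (\<lambda>z. conj_op f z + conj_op g z)"
  and conj_op_cmult: "conj_op (\<lambda>z. c * f z) = (\<lambda>z. cnj c * conj_op f z)"
  by (simp_all add: conj_op_def wcomp_add wcomp_cmult)

lemma
  assumes f: "f \<in> A2"
  shows conj_op_bergman: "conj_op f \<in> A2" and conj_op_bsq: "bsq lam (conj_op f) = bsq lam f"
proof -
  define g where "g = wcomp A (\<lambda>z. exp (- of_real lam * L z)) f"
  have g: "g \<in> A2" unfolding g_def by (rule wcomp_bergman[OF multiplier_A f])
  have J: "conj_op f = (\<lambda>z. cnj (g (cnjv z)))" by (simp add: conj_op_def g_def)
  have [measurable]: "g \<in> borel_measurable borel" by (rule bL2_measurable[OF bergman_L2[OF g]])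
  have [measurable]: "(cnjv :: complex^'n \<Rightarrow> _) \<in> borel_measurable borel"
    by (rule borel_measurable_continuous_onI[OF continuous_on_cnjv])
  have nn: "(\<integral>\<^sup>+ z. ennreal ((cmod (conj_op f z))\<^sup>2) \<partial>bmeas lam) = ennreal (bsq lam f)"
  proof -
    have "(\<integral>\<^sup>+ z. ennreal ((cmod (conj_op f z))\<^sup>2) \<partial>bmeas lam) = (\<integral>\<^sup>+ z. ennreal ((cmod (g (cnjv z)))\<^sup>2) \<partial>bmeas lam)"
      by (simp add: J)
    also have "\<dots> = (\<integral>\<^sup>+ z. ennreal ((cmod (g z))\<^sup>2) \<partial>bmeas lam)"
      by (rule nn_integral_bmeas_cnjv[of "\<lambda>z. ennreal ((cmod (g z))\<^sup>2)"]) measurable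
    also have "\<dots> = ennreal (bsq lam g)" by (rule bL2_nn_integral[OF bergman_L2[OF g]])
    also have "bsq lam g = bsq lam f" unfolding g_def by (rule wcomp_bsq[OF multiplier_A bergman_L2[OF f]])
    finally show ?thesis .
  qed
  have [measurable]: "conj_op f \<in> borel_measurable borel" unfolding J by measurable
  have L2: "conj_op f \<in> bL2 lam" by (simp add: bL2_iff_nn_integral nn)
  have "holomorphic_in (conj_op f) (ball 0 1)"
    using holomorphic_in_cnj[OF bergman_holomorphic[OF g]] unfolding J cnjv_vimage_ball .
  then show "conj_op f \<in> A2"
    using L2 bergman_outside[OF g] by (simp add: bergman_space_iff J)
  have "ennreal (bsq lam (conj_op f)) = ennreal (bsq lam f)" using nn bL2_nn_integral[OF L2] by simp
  then show "bsq lam (conj_op f) = bsq lam f" by (subst (asm) ennreal_inj) auto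
qed

lemma conj_op_bip:
  assumes f: "f \<in> A2" and g: "g \<in> A2"
  shows "bip lam (conj_op f) (conj_op g) = bip lam g f"
proof -
  note JL = bergman_L2[OF conj_op_bergman]
  have "Re (bip lam (conj_op f) (conj_op g)) = Re (bip lam f g)"
    using f g by (simp add: bip_polarization JL bergman_L2 conj_op_bsq bergman_add flip: conj_op_add)
  moreover have "Im (bip lam (conj_op f) (conj_op g)) = - Im (bip lam f g)"
  proof -
    have "(\<lambda>z. conj_op f z + \<i> * conj_op g z) = conj_op (\<lambda>z. f z + (- \<i>) * g z)"
      by (simp only: conj_op_add conj_op_cmult) simp
    then have "Im (bip lam (conj_op f) (conj_op g)) = (bsq lam (\<lambda>z. f z + (- \<i>) * g z) - bsq lam f - bsq lam g) / 2"
      using f g by (simp only: bip_polarization JL conj_op_bsq bergman_add bergman_cmult)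
    also have "\<dots> = Re (bip lam f (\<lambda>z. (- \<i>) * g z))"
      using bip_polarization(1)[OF bergman_L2[OF f] bL2_cmult[OF bergman_L2[OF g], of "- \<i>"]] bsq_cmult[of lam "- \<i>" g]
      by simp
    also have "\<dots> = - Im (bip lam f g)"
      unfolding bip_cmult_right by simp
    finally show ?thesis .
  qed
  ultimately have "bip lam (conj_op f) (conj_op g) = cnj (bip lam f g)" by (simp add: complex_eq_iff)
  then show ?thesis by (simp add: bip_cnj)
qed

lemma conj_op_involution:
  assumes f: "f \<in> A2"
  shows "conj_op (conj_op f) = f"
proof (rule bergman_eqI[OF conj_op_bergman[OF conj_op_bergman[OF f]] f])
  fix z :: "complex^'n" assume z: "z \<in> ball 0 1"
  have "conj_op (conj_op f) z = (\<nu> (\<sigma> z) * cnj (\<nu> z)) * f z"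
    by (simp add: conj_op_apply[OF z] conj_op_apply[OF sigma_ball[OF z]] sigma_sigma[OF z])
  then show "conj_op (conj_op f) z = f z" by (simp add: nu_sigma[OF z])
qed

text \<open>The symmetry of the bilinear form: antiunitarity exchanges the arguments, and
  \<open>conj_op\<close> is its own inverse.\<close>

lemma bip_conj_sym: "f \<in> A2 \<Longrightarrow> g \<in> A2 \<Longrightarrow> bip lam f (conj_op g) = bip lam g (conj_op f)"
  using conj_op_bip[OF conj_op_bergman] conj_op_involution by metis

lemma bip_conj_kern:
  assumes "f \<in> A2" "w \<in> ball 0 1"
  shows "bip lam f (conj_op (kern w)) = \<nu> w * f (\<sigma> w)"
proof -
  have "bip lam f (conj_op (kern w)) = bip lam (kern w) (conj_op f)"
    by (rule bip_conj_sym[OF assms(1) kern_in[OF assms(2)]])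
  also have "\<dots> = cnj (bip lam (conj_op f) (kern w))" by (simp add: bip_cnj)
  also have "\<dots> = cnj (conj_op f w)" by (simp add: kern[OF assms(2) conj_op_bergman[OF assms(1)]])
  finally show ?thesis by (simp add: conj_op_apply[OF assms(2)])
qed

section \<open>Symmetry of the operators commuting with the subgroup\<close>

definition commuting_op :: "((complex^'n \<Rightarrow> complex) \<Rightarrow> (complex^'n \<Rightarrow> complex)) \<Rightarrow> real \<Rightarrow> bool" where
  "commuting_op S C \<longleftrightarrow> bounded_op S C \<and> C \<ge> 0 \<and>
     (\<forall>h\<in>H. \<forall>f\<in>A2. S (wcomp h (mult_of h) f) = wcomp h (mult_of h) (S f))"

lemma commuting_op_compose:
  assumes "commuting_op S C" "commuting_op T D"
  shows "commuting_op (\<lambda>f. S (T f)) (C * D)"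
  using assms bounded_op_compose[of S C T D] bounded_opD(1)[of T D]
  by (auto simp: commuting_op_def)

context
  fixes S C assumes S: "commuting_op S C"
begin

lemma S_op: "bounded_op S C" and C_nonneg: "C \<ge> 0"
  using S by (auto simp: commuting_op_def)

lemma S_bergman: "f \<in> A2 \<Longrightarrow> S f \<in> A2"
  by (rule bounded_opD(1)[OF S_op])

lemma S_kern_bergman: "w \<in> ball 0 1 \<Longrightarrow> S (kern w) \<in> A2"
  by (rule S_bergman[OF kern_in])

text \<open>Here \<open>\<sigma> x\<close> is \<open>h x\<close> for some \<open>h \<in> H\<close>.
  Commuting \<open>S\<close> past the weighted composition by \<open>h\<close>, with the covariance
  of the kernel, gives \<open>S (kern x) x = \<bar>m x\<bar>\<^sup>2 * S (kern (\<sigma> x))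
  (\<sigma> x)\<close>. As \<open>\<bar>s\<bar> = 1\<close>, the moduli of \<open>m x\<close> and
  \<open>\<nu> x\<close> agree, and \<open>nu_sigma\<close> converts \<open>cnj (\<nu> x)\<close>
  into the inverse of \<open>\<nu> (\<sigma> x)\<close>.\<close>

lemma S_kern_orbit:
  assumes x: "x \<in> ball z0 r" "x \<in> ball 0 1"
  shows "\<nu> x * S (kern (\<sigma> x)) (\<sigma> x) = \<nu> (\<sigma> x) * S (kern x) x"
proof -
  obtain h s where h: "h \<in> H" "cmod s = 1" "A *v cnjv (hlift x) = s *s (h *v hlift x)"
    using A_orbit[OF x(1)] by blast
  define m where "m = mult_of h"
  have m: "multiplier h m" unfolding m_def by (rule H_mult_of[OF h(1)])
  then have hu: "form_unitary h" by (simp add: multiplier_def)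
  have dh: "aut_denom h x \<noteq> 0" by (rule aut_denom_nonzero[OF hu x(2)])
  have s0: "s \<noteq> 0" using h(2) by auto
  have eq: "aut_denom A (cnjv x) *s hlift (\<sigma> x) = (s * aut_denom h x) *s hlift (ball_action h x)"
    using h(3) unfolding A_hlift[OF x(2)] hlift_ball_action[OF dh] vector_smult_assoc .
  from arg_cong[OF eq, of "\<lambda>x. x $ None"] have d: "aut_denom A (cnjv x) = s * aut_denom h x" by simp
  have "hproj (aut_denom A (cnjv x) *s hlift (\<sigma> x)) = hproj ((s * aut_denom h x) *s hlift (ball_action h x))"
    by (simp only: eq)
  then have sx: "\<sigma> x = ball_action h x"
    using s0 dh by (simp add: d hproj_smult)
  have "cmod (m x) = cmod (aut_denom h x) powr (- lam)" using m x(2) by (auto simp: multiplier_def)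
  also have "\<dots> = cmod (aut_denom A (cnjv x)) powr (- lam)" by (simp add: d norm_mult h(2))
  also have "\<dots> = cmod (\<nu> x)"
    unfolding \<nu>_def using exp_log_multiplier[OF L(2)[OF cnjv_ball[OF x(2)]]] by simp
  finally have mn: "cmod (m x) = cmod (\<nu> x)" .
  then have m0: "m x \<noteq> 0" using nu_nonzero[of x] by auto
  have k: "kern (\<sigma> x) \<in> A2" by (rule kern_in[OF sigma_ball[OF x(2)]])
  have "wcomp h m (S (kern (\<sigma> x))) = S (wcomp h m (kern (\<sigma> x)))"
    using S h(1) k by (simp add: commuting_op_def m_def)
  also have "wcomp h m (kern (\<sigma> x)) = (\<lambda>z. cnj (1 / m x) * kern x z)"
    unfolding sx by (rule wcomp_kern[OF m x(2)])
  also have "S (\<lambda>z. cnj (1 / m x) * kern x z) = (\<lambda>z. cnj (1 / m x) * S (kern x) z)"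
    by (rule bounded_opD(3)[OF S_op kern_in[OF x(2)]])
  finally have "wcomp h m (S (kern (\<sigma> x))) x = cnj (1 / m x) * S (kern x) x" by simp
  then have "m x * S (kern (\<sigma> x)) (\<sigma> x) = cnj (1 / m x) * S (kern x) x"
    using x(2) by (simp add: wcomp_def sx)
  then have "(cnj (m x) * m x) * S (kern (\<sigma> x)) (\<sigma> x) = S (kern x) x"
    using m0 by (simp add: field_simps)
  moreover have "cnj (m x) * m x = cnj (\<nu> x) * \<nu> x"
    using mn by (metis complex_norm_square mult.commute)
  ultimately have "S (kern x) x = cnj (\<nu> x) * (\<nu> x * S (kern (\<sigma> x)) (\<sigma> x))" by (simp add: mult.assoc)
  then have "\<nu> (\<sigma> x) * S (kern x) x = (\<nu> (\<sigma> x) * cnj (\<nu> x)) * (\<nu> x * S (kern (\<sigma> x)) (\<sigma> x))"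
    by (simp only: mult.assoc)
  then show ?thesis by (simp add: nu_sigma[OF x(2)])
qed

text \<open>The antilinear \<open>conj_op\<close> undoes the antiholomorphic dependence of
  \<open>kern w\<close> on \<open>w\<close>, so \<open>K2\<close> is holomorphic in both variables.
  Its symmetry is that of \<open>S\<close> for the bilinear form, tested on kernels.\<close>

definition K2 :: "complex^'n \<Rightarrow> complex^'n \<Rightarrow> complex" where
  "K2 z w = conj_op (S (kern w)) z"

lemma K2_holomorphic1: "w \<in> ball 0 1 \<Longrightarrow> holomorphic_in (\<lambda>z. K2 z w) (ball 0 1)"
  unfolding K2_def by (rule bergman_holomorphic[OF conj_op_bergman[OF S_kern_bergman]])

text \<open>The functional \<open>f \<mapsto> S f (\<sigma> z)\<close> is bounded; as a function of
  \<open>w\<close>, \<open>K2 z w\<close> is a multiple of its Riesz vector, which is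
  holomorphic.\<close>

lemma K2_holomorphic2:
  assumes z: "z \<in> ball 0 1"
  shows "holomorphic_in (K2 z) (ball 0 1)"
proof -
  have "norm (\<sigma> z) < 1" using sigma_ball[OF z] by simp
  then obtain D where D: "D \<ge> 0" "\<And>f y. f \<in> A2 \<Longrightarrow> y \<in> cball 0 (norm (\<sigma> z)) \<Longrightarrow> cmod (f y) \<le> D * sqrt (bsq lam f)"
    by (rule point_evaluation) blast
  obtain k where k: "k \<in> A2" "\<And>f. f \<in> A2 \<Longrightarrow> S f (\<sigma> z) = bip lam f k"
  proof (rule riesz_representation[of "\<lambda>f. S f (\<sigma> z)" "D * C"])
    show "S (\<lambda>z. f z + g z) (\<sigma> z) = S f (\<sigma> z) + S g (\<sigma> z)" if "f \<in> A2" "g \<in> A2" for f g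
      using bounded_opD(2)[OF S_op that] by simp
    show "S (\<lambda>z. c * f z) (\<sigma> z) = c * S f (\<sigma> z)" if "f \<in> A2" for c f
      using bounded_opD(3)[OF S_op that] by simp
    show "cmod (S f (\<sigma> z)) \<le> D * C * sqrt (bsq lam f)" if f: "f \<in> A2" for f
    proof -
      have "cmod (S f (\<sigma> z)) \<le> D * sqrt (bsq lam (S f))" by (rule D(2)[OF S_bergman[OF f]]) simp
      also have "\<dots> \<le> D * (C * sqrt (bsq lam f))" by (rule mult_left_mono[OF bounded_opD(4)[OF S_op f] D(1)])
      finally show ?thesis by (simp add: mult.assoc)
    qed
  qed (rule that)
  have "holomorphic_in (\<lambda>w. cnj (\<nu> z) * k w) (ball 0 1)"
    by (intro holomorphic_in_mult holomorphic_in_const bergman_holomorphic[OF k(1)])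
  then show ?thesis
  proof (rule holomorphic_in_cong)
    fix w :: "complex^'n" assume w: "w \<in> ball 0 1"
    have "cnj (S (kern w) (\<sigma> z)) = bip lam k (kern w)" by (simp add: k(2)[OF kern_in[OF w]] bip_cnj)
    then show "cnj (\<nu> z) * k w = K2 z w" by (simp add: K2_def conj_op_apply[OF z] kern[OF w k(1)])
  qed simp
qed

lemma K2_bounded:
  assumes "\<rho> < 1"
  obtains M where "\<And>z w. z \<in> cball 0 \<rho> \<Longrightarrow> w \<in> cball 0 \<rho> \<Longrightarrow> cmod (K2 z w) \<le> M"
proof -
  obtain D where D: "D \<ge> 0" "\<And>f z. f \<in> A2 \<Longrightarrow> z \<in> cball 0 \<rho> \<Longrightarrow> cmod (f z) \<le> D * sqrt (bsq lam f)"
    by (rule point_evaluation[OF assms]) blast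
  obtain E where E: "E \<ge> 0" "\<And>w. w \<in> cball 0 \<rho> \<Longrightarrow> sqrt (bsq lam (kern w)) \<le> E"
    by (rule kern_norm_bounded[OF assms]) blast
  show thesis
  proof (rule that[of "D * (C * E)"])
    fix z w :: "complex^'n" assume z: "z \<in> cball 0 \<rho>" and w: "w \<in> cball 0 \<rho>"
    then have wb: "w \<in> ball 0 1" using assms by simp
    have "cmod (K2 z w) \<le> D * sqrt (bsq lam (conj_op (S (kern w))))"
      unfolding K2_def by (rule D(2)[OF conj_op_bergman[OF S_kern_bergman[OF wb]] z])
    also have "\<dots> = D * sqrt (bsq lam (S (kern w)))" by (simp add: conj_op_bsq[OF S_kern_bergman[OF wb]])
    also have "\<dots> \<le> D * (C * sqrt (bsq lam (kern w)))"
      by (rule mult_left_mono[OF bounded_opD(4)[OF S_op kern_in[OF wb]] D(1)])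
    also have "\<dots> \<le> D * (C * E)" by (intro mult_left_mono E(2) w C_nonneg D(1))
    finally show "cmod (K2 z w) \<le> D * (C * E)" .
  qed
qed

text \<open>Substituting \<open>ball_action A y\<close> for the second variable turns the graph of
  \<open>\<sigma>\<close> into the set \<open>y = cnjv x\<close>, to which polarization applies near
  \<open>z0\<close>. The identity theorem in each variable separately extends the result to the
  whole ball.\<close>

lemma K2_sym:
  assumes z: "z \<in> ball 0 1" and w: "w \<in> ball 0 1"
  shows "K2 z w = K2 w z"
proof -
  define e where "e x y = K2 x (ball_action A y) - K2 (ball_action A y) x" for x y
  note act = ball_action_in_ball[OF A]
  have hol1: "holomorphic_in (\<lambda>x. e x y) (ball 0 1)" if "y \<in> ball 0 1" for y
    unfolding e_def by (intro holomorphic_in_diff K2_holomorphic1 K2_holomorphic2 act that)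
  have hol2: "holomorphic_in (e x) (ball 0 1)" if x: "x \<in> ball 0 1" for x
    unfolding e_def[abs_def]
    by (intro holomorphic_in_diff holomorphic_in_compose[OF K2_holomorphic2[OF x]]
        holomorphic_in_compose[OF K2_holomorphic1[OF x]] holomorphic_in_ball_action A)
      (use act in auto)
  define \<rho> where "\<rho> = (1 + norm z0) / 2"
  have \<rho>: "norm z0 < \<rho>" "\<rho> < 1" using z0 by (auto simp: \<rho>_def)
  obtain M where M: "\<And>z w. z \<in> cball 0 \<rho> \<Longrightarrow> w \<in> cball 0 \<rho> \<Longrightarrow> cmod (K2 z w) \<le> M"
    by (rule K2_bounded[OF \<rho>(2)]) blast
  have "isCont (ball_action A) (cnjv z0)"
    using continuous_on_ball_action[OF A] cnjv_ball[OF z0] by (meson continuous_on_eq_continuous_at open_ball)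
  then have "isCont (\<lambda>y. norm (ball_action A y)) (cnjv z0)" by (intro continuous_intros)
  moreover have "norm (ball_action A (cnjv z0)) < \<rho>" using \<rho>(1) sigma_z0 by (simp add: \<sigma>_def)
  ultimately have "\<forall>\<^sub>F y in at (cnjv z0). norm (ball_action A y) < \<rho>"
    using order_tendstoD(2) unfolding isCont_def by blast
  then obtain \<delta> where \<delta>: "\<delta> > 0" "\<And>y. dist y (cnjv z0) < \<delta> \<Longrightarrow> norm (ball_action A y) < \<rho>"
    using \<open>norm (ball_action A (cnjv z0)) < \<rho>\<close> unfolding eventually_at by (metis UNIV_I)
  \<comment> \<open>Small enough that \<open>x\<close> stays where \<open>A_orbit\<close> holds and
    that \<open>x\<close>, \<open>y\<close> and \<open>ball_action A y\<close> stay in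
    \<open>cball 0 \<rho>\<close>, where \<open>K2\<close> is bounded.\<close>
  define t where "t = min r (min \<delta> (\<rho> - norm z0))"
  have t: "t > 0" "t \<le> r" "t \<le> \<delta>" "t \<le> \<rho> - norm z0" using r \<delta>(1) \<rho>(1) by (auto simp: t_def)
  have sub1: "x \<in> cball 0 \<rho> \<and> x \<in> ball 0 1 \<and> x \<in> ball z0 r" if "x \<in> ball z0 t" for x
  proof -
    have "norm (x - z0) < t" using that by (simp add: dist_norm norm_minus_commute)
    then have "norm x < \<rho>" using norm_triangle_ineq[of z0 "x - z0"] t(4) by simp
    then show ?thesis using \<rho>(2) that t(2) by auto
  qed
  have sub2: "y \<in> ball 0 1 \<and> ball_action A y \<in> cball 0 \<rho>" if y: "y \<in> ball (cnjv z0) t" for y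
  proof -
    have "norm (y - cnjv z0) < t" using y by (simp add: dist_norm norm_minus_commute)
    then have "norm y < \<rho>" using norm_triangle_ineq[of "cnjv z0" "y - cnjv z0"] t(4) by simp
    moreover have "norm (ball_action A y) < \<rho>" by (rule \<delta>(2)) (use y t(3) in \<open>auto simp: dist_commute\<close>)
    ultimately show ?thesis using \<rho>(2) by auto
  qed
  have bound: "cmod (e x y) \<le> M + M" if "x \<in> ball z0 t" "y \<in> ball (cnjv z0) t" for x y
    using M[of x "ball_action A y"] M[of "ball_action A y" x] sub1[OF that(1)] sub2[OF that(2)]
      norm_triangle_ineq4[of "K2 x (ball_action A y)" "K2 (ball_action A y) x"]
    by (auto simp: e_def)
  have diag: "e x (cnjv x) = 0" if "x \<in> ball z0 t" for x
  proof -
    have x: "x \<in> ball z0 r" "x \<in> ball 0 1" using sub1[OF that] by auto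
    have "K2 x (\<sigma> x) = cnj (\<nu> x * S (kern (\<sigma> x)) (\<sigma> x))" by (simp add: K2_def conj_op_apply[OF x(2)])
    also have "\<dots> = cnj (\<nu> (\<sigma> x) * S (kern x) (\<sigma> (\<sigma> x)))" by (simp add: S_kern_orbit[OF x] sigma_sigma[OF x(2)])
    also have "\<dots> = K2 (\<sigma> x) x" by (simp add: K2_def conj_op_apply[OF sigma_ball[OF x(2)]])
    finally show ?thesis by (simp add: e_def \<sigma>_def)
  qed
  have small: "e x y = 0" if "x \<in> ball z0 (t / 3)" "y \<in> ball (cnjv z0) (t / 3)" for x y
  proof (rule polarization[where e=e and ?z0.0=z0 and r=t, OF bound _ _ diag that])
    show "holomorphic_in (\<lambda>x. e x y) (ball z0 t)" if "y \<in> ball (cnjv z0) t" for y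
      by (rule holomorphic_in_subset[OF hol1]) (use sub1 sub2 that in auto)
    show "holomorphic_in (e x) (ball (cnjv z0) t)" if "x \<in> ball z0 t" for x
      by (rule holomorphic_in_subset[OF hol2]) (use sub1 sub2 that in auto)
  qed
  have t3: "t / 3 > 0" using t by simp
  have e0: "e x y = 0" if x: "x \<in> ball 0 1" and y: "y \<in> ball 0 1" for x y
  proof (rule holomorphic_in_identity[OF hol2[OF x] t3 cnjv_ball[OF z0] _ y])
    fix y assume y: "y \<in> ball (cnjv z0) (t / 3)"
    then have "y \<in> ball (cnjv z0) t" using t by auto
    then have "y \<in> ball 0 1" using sub2 by blast
    then show "e x y = 0"
      by (rule holomorphic_in_identity[OF hol1 t3 z0 small[OF _ y] x])
  qed
  \<comment> \<open>The point \<open>cnjv (\<sigma> w)\<close> is the preimage of \<open>w\<close>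
    under \<open>ball_action A\<close>, as \<open>\<sigma>\<close> is an involution.\<close>
  have "e z (cnjv (\<sigma> w)) = 0" by (rule e0[OF z cnjv_ball[OF sigma_ball[OF w]]])
  moreover have "ball_action A (cnjv (\<sigma> w)) = w" using sigma_sigma[OF w] by (simp add: \<sigma>_def)
  ultimately show ?thesis by (simp add: e_def)
qed

lemma bip_S_kern_sym:
  assumes z: "z \<in> ball 0 1" and w: "w \<in> ball 0 1"
  shows "bip lam (S (kern w)) (conj_op (kern z)) = bip lam (S (kern z)) (conj_op (kern w))"
proof -
  have "bip lam (S (kern w)) (conj_op (kern z)) = cnj (K2 z w)" if "z \<in> ball 0 1" "w \<in> ball 0 1" for z w
    by (simp add: bip_conj_kern[OF S_kern_bergman[OF that(2)] that(1)] K2_def conj_op_apply[OF that(1)])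
  then show ?thesis using K2_sym[OF z w] z w by simp
qed

lemma conj_bip_bound:
  assumes "f \<in> A2" "g \<in> A2"
  shows "cmod (bip lam f (conj_op g)) \<le> sqrt (bsq lam f) * sqrt (bsq lam g)"
  using bip_Cauchy_Schwarz[OF bergman_L2[OF assms(1)] bergman_L2[OF conj_op_bergman[OF assms(2)]]]
  by (simp add: conj_op_bsq[OF assms(2)])

lemma conj_bip_linear:
  assumes "f \<in> A2" "g \<in> A2" "k \<in> A2"
  shows "bip lam k (conj_op (\<lambda>z. f z + g z)) = bip lam k (conj_op f) + bip lam k (conj_op g)"
    and "bip lam k (conj_op (\<lambda>z. c * f z)) = c * bip lam k (conj_op f)"
    and "bip lam (\<lambda>z. f z + g z) (conj_op k) = bip lam f (conj_op k) + bip lam g (conj_op k)"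
    and "bip lam (\<lambda>z. c * f z) (conj_op k) = c * bip lam f (conj_op k)"
  using assms
  by (simp_all add: conj_op_add conj_op_cmult bip_add_right bip_add_left bip_cmult_right bip_cmult_left bergman_L2 conj_op_bergman)

text \<open>Both sides are bounded and linear in \<open>f\<close> and in \<open>g\<close>, where the
  two conjugations in \<open>g\<close> cancel. The identity on pairs of kernels therefore extends by
  totality, first in \<open>g\<close> and then in \<open>f\<close>.\<close>

lemma bip_S_sym:
  assumes f: "f \<in> A2" and g: "g \<in> A2"
  shows "bip lam (S f) (conj_op g) = bip lam f (conj_op (S g))"
proof -
  note S' = bounded_opD[OF S_op]
  have bound1: "cmod (bip lam (S f) (conj_op g)) \<le> C * sqrt (bsq lam f) * sqrt (bsq lam g)" if "f \<in> A2" "g \<in> A2" for f g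
    by (rule order_trans[OF conj_bip_bound[OF S_bergman[OF that(1)] that(2)] mult_right_mono[OF S'(4)[OF that(1)]]]) simp
  have bound2: "cmod (bip lam f (conj_op (S g))) \<le> sqrt (bsq lam f) * (C * sqrt (bsq lam g))" if "f \<in> A2" "g \<in> A2" for f g
    by (rule order_trans[OF conj_bip_bound[OF that(1) S_bergman[OF that(2)]] mult_left_mono[OF S'(4)[OF that(2)]]]) simp
  have step: "bip lam (S (kern w)) (conj_op g) = bip lam (kern w) (conj_op (S g))"
    if w: "w \<in> ball 0 1" and g: "g \<in> A2" for w g
  proof (rule functional_eqI[of "\<lambda>g. bip lam (S (kern w)) (conj_op g)" "\<lambda>g. bip lam (kern w) (conj_op (S g))"
      "C * sqrt (bsq lam (kern w))" "sqrt (bsq lam (kern w)) * C"])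
    fix z :: "complex^'n" assume z: "z \<in> ball 0 1"
    show "bip lam (S (kern w)) (conj_op (kern z)) = bip lam (kern w) (conj_op (S (kern z)))"
      using bip_S_kern_sym[OF z w] bip_conj_sym[OF S_kern_bergman[OF z] kern_in[OF w]] by simp
  qed (use w g kern_in[OF w] bound1[OF kern_in[OF w]] bound2[OF kern_in[OF w]] in
      \<open>simp_all add: conj_bip_linear S' S_kern_bergman S_bergman mult.assoc\<close>)
  show ?thesis
  proof (rule functional_eqI[of "\<lambda>f. bip lam (S f) (conj_op g)" "\<lambda>f. bip lam f (conj_op (S g))"
      "C * sqrt (bsq lam g)" "C * sqrt (bsq lam g)"])
    fix w :: "complex^'n" assume w: "w \<in> ball 0 1"
    show "bip lam (S (kern w)) (conj_op g) = bip lam (kern w) (conj_op (S g))" by (rule step[OF w g])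
  next
    fix f assume f: "f \<in> A2"
    show "cmod (bip lam (S f) (conj_op g)) \<le> C * sqrt (bsq lam g) * sqrt (bsq lam f)"
      using bound1[OF f g] by (simp add: mult_ac)
    show "cmod (bip lam f (conj_op (S g))) \<le> C * sqrt (bsq lam g) * sqrt (bsq lam f)"
      using bound2[OF f g] by (simp add: mult_ac)
  qed (use f g in \<open>simp_all add: conj_bip_linear S' S_bergman\<close>)
qed

end

theorem commutant_commutative:
  assumes S: "commuting_op S C" and T: "commuting_op T D" and f: "f \<in> A2"
  shows "S (T f) = T (S f)"
proof -
  note TS = commuting_op_compose[OF T S]
  have Sf: "S f \<in> A2" and Tf: "T f \<in> A2" by (rule S_bergman[OF S f], rule S_bergman[OF T f])
  have STf: "S (T f) \<in> A2" and TSf: "T (S f) \<in> A2" by (rule S_bergman[OF S Tf], rule S_bergman[OF T Sf])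
  have eq: "bip lam (S (T f)) (conj_op g) = bip lam (T (S f)) (conj_op g)" if g: "g \<in> A2" for g
  proof -
    have Sg: "S g \<in> A2" by (rule S_bergman[OF S g])
    have "bip lam (S (T f)) (conj_op g) = bip lam (T f) (conj_op (S g))" by (rule bip_S_sym[OF S Tf g])
    also have "\<dots> = bip lam f (conj_op (T (S g)))" by (rule bip_S_sym[OF T f Sg])
    also have "\<dots> = bip lam (T (S f)) (conj_op g)" by (rule bip_S_sym[OF TS f g, symmetric])
    finally show ?thesis .
  qed
  show ?thesis
  proof (rule bergman_eqI[OF STf TSf])
    fix z :: "complex^'n" assume z: "z \<in> ball 0 1"
    \<comment> \<open>Pairing with \<open>conj_op (kern (\<sigma> z))\<close> evaluates at
      \<open>\<sigma> (\<sigma> z) = z\<close> up to the nonzero factor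
      \<open>\<nu> (\<sigma> z)\<close>, so the form separates functions.\<close>
    have w: "\<sigma> z \<in> ball 0 1" by (rule sigma_ball[OF z])
    have "\<nu> (\<sigma> z) * S (T f) (\<sigma> (\<sigma> z)) = \<nu> (\<sigma> z) * T (S f) (\<sigma> (\<sigma> z))"
      using eq[OF kern_in[OF w]] unfolding bip_conj_kern[OF STf w] bip_conj_kern[OF TSf w] .
    then show "S (T f) z = T (S f) z" by (simp add: nu_nonzero sigma_sigma[OF z])
  qed
qed

end

subsection \<open>Toeplitz operators\<close>

lemma AE_ball_volume_imp_bergman:
  fixes P :: "complex^'n::finite \<Rightarrow> bool"
  assumes "AE z in ball_volume. P z"
  shows "AE z in bergman_measure lam. P z"
  unfolding bergman_measure_def
  by (subst AE_density) (use assms in \<open>auto intro!: borel_measurable_ball_volume\<close>)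

lemma id_measurable_bergman: "(\<lambda>z. z) \<in> measurable (bergman_measure lam) borel"
  by (rule borel_measurable_bergman) simp

lemma AE_bmeas_iff:
  assumes "{z. P z} \<in> sets borel"
  shows "(AE z in bmeas lam. P z) \<longleftrightarrow> (AE z in bergman_measure lam. P z)"
  unfolding bmeas_def by (subst AE_distr_iff[OF id_measurable_bergman]) (use assms in auto)

text \<open>A symbol is Lebesgue measurable only. The Borel version \<open>\<psi>\<close> can be
  composed with the action and integrated over \<open>bmeas\<close>, and the exceptional set
  \<open>X\<close> is taken Borel so that it can be followed under the action.\<close>

lemma ball_volume_borel_version:
  fixes \<phi> :: "complex^'n::finite \<Rightarrow> complex"
  assumes "\<phi> \<in> borel_measurable ball_volume"
  obtains \<psi> X where "\<psi> \<in> borel_measurable borel" "X \<in> sets borel" "emeasure lborel X = 0"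
    "\<And>z. z \<in> ball 0 1 \<Longrightarrow> z \<notin> X \<Longrightarrow> \<phi> z = \<psi> z"
proof -
  define g where "g z = indicator (ball 0 1) z *\<^sub>R \<phi> z" for z
  have "\<phi> \<in> borel_measurable (lebesgue_on (ball 0 1))"
    using assms unfolding measurable_cong_sets[OF sets_ball_volume refl] .
  then have g: "g \<in> borel_measurable lebesgue"
    unfolding g_def[abs_def] by (subst (asm) borel_measurable_restrict_space_iff) auto
  have "(\<lambda>z. Re (g z)) \<in> borel_measurable lebesgue" "(\<lambda>z. Im (g z)) \<in> borel_measurable lebesgue"
    using g by auto
  then obtain a b where ab[measurable]: "a \<in> borel_measurable lborel" "b \<in> borel_measurable lborel"
    and ae: "AE z in lborel. Re (g z) = a z" "AE z in lborel. Im (g z) = b z"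
    using completion_ex_borel_measurable_real[of "\<lambda>z. Re (g z)" lborel]
      completion_ex_borel_measurable_real[of "\<lambda>z. Im (g z)" lborel] by blast
  have "AE z in lborel. g z = Complex (a z) (b z)"
    using ae by eventually_elim (simp add: complex_eq_iff)
  then obtain X where X: "{z \<in> space lborel. g z \<noteq> Complex (a z) (b z)} \<subseteq> X" "emeasure lborel X = 0" "X \<in> sets lborel"
    by (rule AE_E)
  show thesis
  proof (rule that[of "\<lambda>z. Complex (a z) (b z)" X])
    have "(\<lambda>z. Complex (a z) (b z)) = (\<lambda>z. of_real (a z) + \<i> * of_real (b z))"
      by (simp add: fun_eq_iff complex_eq_iff)
    moreover have "(\<lambda>z. of_real (a z) + \<i> * of_real (b z)) \<in> borel_measurable borel"
      using ab by simp
    ultimately show "(\<lambda>z. Complex (a z) (b z)) \<in> borel_measurable borel" by simp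
    show "\<phi> z = Complex (a z) (b z)" if "z \<in> ball 0 1" "z \<notin> X" for z
    proof -
      have "g z = Complex (a z) (b z)" using X(1) that(2) by auto
      then show ?thesis using that(1) by (simp add: g_def)
    qed
  qed (use X in auto)
qed

context bergman
begin

lemma AE_bmeas_null:
  fixes X :: "(complex^'n) set"
  assumes [measurable]: "X \<in> sets borel" and X: "emeasure lborel X = 0"
  shows "emeasure (bmeas lam) X = 0"
proof -
  obtain \<kappa> where \<kappa>: "\<And>f :: complex^'n \<Rightarrow> ennreal. f \<in> borel_measurable borel \<Longrightarrow>
    (\<integral>\<^sup>+ z. f z \<partial>bmeas lam) = ennreal \<kappa> * (\<integral>\<^sup>+ z. ennreal (bweight lam z) * f z \<partial>lborel)"
    using nn_integral_bmeas_exists[OF lam] by blast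
  have "AE z in lborel. z \<notin> X" using X by (intro AE_I[of _ _ X]) auto
  then have "AE z in lborel. ennreal (bweight lam z) * indicator X z = 0"
    by eventually_elim simp
  then have "(\<integral>\<^sup>+ z. ennreal (bweight lam z) * indicator X z \<partial>lborel) = 0"
    by (subst nn_integral_0_iff_AE) auto
  then show ?thesis using \<kappa>[of "indicator X"] by simp
qed

text \<open>Quasi-invariance applied to the indicator of \<open>X\<close>; the automorphy factor is
  positive on the ball, so the vanishing integral forces the indicator to vanish almost
  everywhere.\<close>

lemma AE_bmeas_ball_action:
  fixes X :: "(complex^'n) set"
  assumes A: "form_unitary A" and [measurable]: "X \<in> sets borel" and X: "emeasure lborel X = 0"
  shows "AE z in bmeas lam. ball_action A z \<notin> X"
proof -
  have "(\<integral>\<^sup>+ z. indicator X (ball_action A z) * ennreal (cmod (aut_denom A z) powr (- 2 * lam)) \<partial>bmeas lam) =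
    (\<integral>\<^sup>+ z. indicator X z \<partial>bmeas lam)"
    by (rule nn_integral_ball_action[OF lam A]) measurable
  also have "\<dots> = 0" using AE_bmeas_null[OF assms(2) X] by simp
  finally have "AE z in bmeas lam. indicator X (ball_action A z) * ennreal (cmod (aut_denom A z) powr (- 2 * lam)) = 0"
    by (subst (asm) nn_integral_0_iff_AE) auto
  with AE_bmeas_ball show ?thesis
  proof eventually_elim
    case (elim z)
    have "cmod (aut_denom A z) powr (- 2 * lam) > 0" using aut_denom_nonzero[OF A elim(1)] by simp
    then have "ennreal (cmod (aut_denom A z) powr (- 2 * lam)) \<noteq> 0"
      unfolding ennreal_eq_0_iff by linarith
    then show ?case using elim(2) by (auto simp: indicator_def split: if_splits)
  qed
qed

lemma bip_cong_AE:
  assumes "f \<in> borel_measurable borel" "f' \<in> borel_measurable borel" "g \<in> borel_measurable borel"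
    and "AE z in bmeas lam. f z = f' z"
  shows "bip lam f g = bip lam f' g"
proof -
  note [measurable] = assms(1-3)
  have "AE z in bmeas lam. f z * cnj (g z) = f' z * cnj (g z)" using assms(4) by eventually_elim simp
  then show ?thesis unfolding bip_def by (intro integral_cong_AE) measurable
qed

context
  fixes \<phi> \<psi> :: "complex^'n \<Rightarrow> complex" and C :: real
  assumes phi_measurable: "\<phi> \<in> borel_measurable ball_volume"
    and psi_measurable: "\<psi> \<in> borel_measurable borel"
    and phi_psi: "AE z in bergman_measure lam. \<phi> z = \<psi> z"
    and psi_bound: "AE z in bmeas lam. cmod (\<psi> z) \<le> C" and C0: "C \<ge> 0"
begin

lemma symbol_mult:
  assumes f: "f \<in> bL2 lam"
  shows "(\<lambda>z. \<psi> z * f z) \<in> bL2 lam" "bsq lam (\<lambda>z. \<psi> z * f z) \<le> C\<^sup>2 * bsq lam f"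
proof -
  note [measurable] = psi_measurable bL2_measurable[OF f]
  have int: "integrable (bmeas lam) (\<lambda>z. C\<^sup>2 * (cmod (f z))\<^sup>2)" using f by (simp add: bL2_def)
  have AE: "AE z in bmeas lam. (cmod (\<psi> z * f z))\<^sup>2 \<le> C\<^sup>2 * (cmod (f z))\<^sup>2"
    using psi_bound
    by eventually_elim (auto simp: norm_mult power_mult_distrib intro!: mult_right_mono power_mono)
  have int': "integrable (bmeas lam) (\<lambda>z. (cmod (\<psi> z * f z))\<^sup>2)"
  proof (rule Bochner_Integration.integrable_bound[OF int])
    show "AE z in bmeas lam. norm ((cmod (\<psi> z * f z))\<^sup>2) \<le> norm (C\<^sup>2 * (cmod (f z))\<^sup>2)"
      using AE by eventually_elim simp
  qed measurable
  then show "(\<lambda>z. \<psi> z * f z) \<in> bL2 lam" by (simp add: bL2_def)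
  have "bsq lam (\<lambda>z. \<psi> z * f z) \<le> (\<integral>z. C\<^sup>2 * (cmod (f z))\<^sup>2 \<partial>bmeas lam)"
    unfolding bsq_def by (rule integral_mono_AE[OF int' int AE])
  then show "bsq lam (\<lambda>z. \<psi> z * f z) \<le> C\<^sup>2 * bsq lam f" by (simp add: bsq_def)
qed

text \<open>This resolves the definite description in \<open>bergman_projection\<close>: the
  difference of two candidates is orthogonal to itself. Afterwards Toeplitz operators are handled
  through their weak form, with \<open>\<psi>\<close> in place of \<open>\<phi>\<close>.\<close>

lemma toeplitz_eqI:
  assumes f: "f \<in> A2" and h: "h \<in> A2" and eq: "\<And>g. g \<in> A2 \<Longrightarrow> bip lam (\<lambda>z. \<psi> z * f z) g = bip lam h g"
  shows "toeplitz lam \<phi> f = h"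
proof -
  note L2 = symbol_mult(1)[OF bergman_L2[OF f]]
  have inner: "bergman_inner lam (\<lambda>z. \<phi> z * f z - k z) g = bip lam (\<lambda>z. \<psi> z * f z) g - bip lam k g"
    if k: "k \<in> A2" and g: "g \<in> A2" for k g
  proof -
    note meas = bL2_measurable[OF bergman_L2]
    have sets: "sets (bergman_measure lam) = sets (ball_volume :: (complex^'n) measure)"
      by (simp add: bergman_measure_def)
    have pm: "\<phi> \<in> borel_measurable (bergman_measure lam)"
      using phi_measurable unfolding measurable_cong_sets[OF sets refl] .
    have [measurable]: "\<psi> \<in> borel_measurable borel" "f \<in> borel_measurable borel" "k \<in> borel_measurable borel" "g \<in> borel_measurable borel"
      using psi_measurable meas f k g by auto
    note mb = pm borel_measurable_bergman[OF meas[OF f], of lam] borel_measurable_bergman[OF meas[OF k], of lam]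
    have "(\<lambda>z. cnj (g z)) \<in> borel_measurable borel" by measurable
    note mg = borel_measurable_bergman[OF this, of lam]
    have mp: "\<psi> \<in> borel_measurable (bergman_measure lam)" by (rule borel_measurable_bergman[OF psi_measurable])
    have "bergman_inner lam (\<lambda>z. \<phi> z * f z - k z) g = bergman_inner lam (\<lambda>z. \<psi> z * f z - k z) g"
      unfolding bergman_inner_def
    proof (rule integral_cong_AE)
      show "(\<lambda>z. (\<phi> z * f z - k z) * cnj (g z)) \<in> borel_measurable (bergman_measure lam)"
        by (intro borel_measurable_times borel_measurable_diff mb mg)
      show "(\<lambda>z. (\<psi> z * f z - k z) * cnj (g z)) \<in> borel_measurable (bergman_measure lam)"
        by (intro borel_measurable_times borel_measurable_diff mb mg mp)
      show "AE z in bergman_measure lam. (\<phi> z * f z - k z) * cnj (g z) = (\<psi> z * f z - k z) * cnj (g z)"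
        using phi_psi by eventually_elim simp
    qed
    also have "\<dots> = bip lam (\<lambda>z. \<psi> z * f z - k z) g"
      by (rule bergman_inner_eq) measurable
    finally show ?thesis using bip_diff_left[OF L2 bergman_L2[OF k] bergman_L2[OF g]] by simp
  qed
  show ?thesis
    unfolding toeplitz_def bergman_projection_def
  proof (rule the_equality)
    show "h \<in> A2 \<and> (\<forall>g\<in>A2. bergman_inner lam (\<lambda>z. \<phi> z * f z - h z) g = 0)"
      using h eq by (auto simp: inner)
    fix k assume k: "k \<in> A2 \<and> (\<forall>g\<in>A2. bergman_inner lam (\<lambda>z. \<phi> z * f z - k z) g = 0)"
    then have "bip lam h g = bip lam k g" if "g \<in> A2" for g
      using that eq[OF that] by (auto simp: inner)
    moreover have "(\<lambda>z. k z - h z) \<in> A2" using k h by (intro bergman_diff) auto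
    ultimately have "bip lam (\<lambda>z. k z - h z) (\<lambda>z. k z - h z) = 0"
      using k h by (simp add: bip_diff_left bergman_L2)
    then have "bsq lam (\<lambda>z. k z - h z) = 0" by (simp add: bip_self)
    then have "k z - h z = 0" for z using k h by (intro bergman_bsq_zero[OF bergman_diff]) auto
    then show "k = h" by (simp add: fun_eq_iff)
  qed
qed

text \<open>Existence of the projection: it is the Riesz vector of pairing with
  \<open>\<psi> f\<close>, a bounded functional because \<open>\<psi>\<close> is essentially
  bounded.\<close>

lemma
  assumes f: "f \<in> A2"
  shows toeplitz_in: "toeplitz lam \<phi> f \<in> A2"
    and toeplitz_bip: "g \<in> A2 \<Longrightarrow> bip lam (toeplitz lam \<phi> f) g = bip lam (\<lambda>z. \<psi> z * f z) g"
proof -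
  note L2 = symbol_mult(1)[OF bergman_L2[OF f]]
  obtain h where h: "h \<in> A2" "\<And>g. g \<in> A2 \<Longrightarrow> bip lam g (\<lambda>z. \<psi> z * f z) = bip lam g h"
  proof (rule riesz_representation[of "\<lambda>g. bip lam g (\<lambda>z. \<psi> z * f z)" "sqrt (bsq lam (\<lambda>z. \<psi> z * f z))"])
    show "cmod (bip lam g (\<lambda>z. \<psi> z * f z)) \<le> sqrt (bsq lam (\<lambda>z. \<psi> z * f z)) * sqrt (bsq lam g)" if "g \<in> A2" for g
      using bip_Cauchy_Schwarz[OF bergman_L2[OF that] L2] by (simp add: mult.commute)
  qed (auto simp: bip_add_left bip_cmult_left bergman_L2 L2 intro: that)
  have h': "bip lam (\<lambda>z. \<psi> z * f z) g = bip lam h g" if "g \<in> A2" for g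
    using h(2)[OF that] by (metis bip_cnj)
  have eq: "toeplitz lam \<phi> f = h" by (rule toeplitz_eqI[OF f h(1) h'])
  show "toeplitz lam \<phi> f \<in> A2" unfolding eq by (rule h(1))
  show "g \<in> A2 \<Longrightarrow> bip lam (toeplitz lam \<phi> f) g = bip lam (\<lambda>z. \<psi> z * f z) g" unfolding eq by (simp add: h')
qed

lemma bounded_op_toeplitz: "bounded_op (toeplitz lam \<phi>) C"
  unfolding bounded_op_def
proof (intro conjI ballI allI)
  fix f c assume f: "f \<in> A2"
  note Tf = toeplitz_in[OF f]
  show "toeplitz lam \<phi> f \<in> A2" by (rule Tf)
  show "toeplitz lam \<phi> (\<lambda>z. c * f z) = (\<lambda>z. c * toeplitz lam \<phi> f z)"
  proof (rule toeplitz_eqI[OF bergman_cmult[OF f] bergman_cmult[OF Tf]])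
    fix g assume g: "g \<in> A2"
    have "(\<lambda>z. \<psi> z * (c * f z)) = (\<lambda>z. c * (\<psi> z * f z))" by (simp add: fun_eq_iff)
    then show "bip lam (\<lambda>z. \<psi> z * (c * f z)) g = bip lam (\<lambda>z. c * toeplitz lam \<phi> f z) g"
      by (simp only: bip_cmult_left toeplitz_bip[OF f g])
  qed
  define s where "s = sqrt (bsq lam (toeplitz lam \<phi> f))"
  have "s\<^sup>2 = cmod (bip lam (toeplitz lam \<phi> f) (toeplitz lam \<phi> f))" by (simp add: s_def bip_self)
  also have "\<dots> = cmod (bip lam (\<lambda>z. \<psi> z * f z) (toeplitz lam \<phi> f))" by (simp only: toeplitz_bip[OF f Tf])
  also have "\<dots> \<le> sqrt (bsq lam (\<lambda>z. \<psi> z * f z)) * s"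
    unfolding s_def by (rule bip_Cauchy_Schwarz[OF symbol_mult(1)[OF bergman_L2[OF f]] bergman_L2[OF Tf]])
  also have "\<dots> \<le> sqrt (C\<^sup>2 * bsq lam f) * s"
    by (intro mult_right_mono real_sqrt_le_mono symbol_mult(2) bergman_L2[OF f]) (simp add: s_def)
  finally have "s * s \<le> C * sqrt (bsq lam f) * s" using C0 by (simp add: real_sqrt_mult power2_eq_square)
  moreover have "s \<ge> 0" by (simp add: s_def)
  ultimately show "sqrt (bsq lam (toeplitz lam \<phi> f)) \<le> C * sqrt (bsq lam f)"
    unfolding s_def[symmetric] using C0 by (cases "s = 0") (auto simp: mult_le_cancel_right)
next
  fix f g assume f: "f \<in> A2" and g: "g \<in> A2"
  note T = toeplitz_in[OF f] toeplitz_in[OF g]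
  show "toeplitz lam \<phi> (\<lambda>z. f z + g z) = (\<lambda>z. toeplitz lam \<phi> f z + toeplitz lam \<phi> g z)"
  proof (rule toeplitz_eqI[OF bergman_add[OF f g] bergman_add[OF T]])
    fix k assume k: "k \<in> A2"
    show "bip lam (\<lambda>z. \<psi> z * (f z + g z)) k = bip lam (\<lambda>z. toeplitz lam \<phi> f z + toeplitz lam \<phi> g z) k"
      unfolding bip_add_left[OF bergman_L2[OF T(1)] bergman_L2[OF T(2)] bergman_L2[OF k]]
      by (simp add: distrib_left bip_add_left symbol_mult(1) bergman_L2 f g k toeplitz_bip)
  qed
qed

text \<open>Every test function is of the form \<open>wcomp u m k\<close>, invariance lets
  \<open>\<psi>\<close> pass through the weighted composition, and unitarity then removes the
  composition from both arguments.\<close>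

lemma toeplitz_wcomp:
  assumes um: "multiplier u m" and inv: "AE z in bmeas lam. \<psi> (ball_action u z) = \<psi> z" and f: "f \<in> A2"
  shows "toeplitz lam \<phi> (wcomp u m f) = wcomp u m (toeplitz lam \<phi> f)"
proof (rule toeplitz_eqI[OF wcomp_bergman[OF um f] wcomp_bergman[OF um toeplitz_in[OF f]]])
  fix g assume g: "g \<in> A2"
  obtain v m' where v: "multiplier v m'"
    "\<And>f. (\<And>z. z \<notin> ball 0 1 \<Longrightarrow> f z = 0) \<Longrightarrow> wcomp u m (wcomp v m' f) = f"
    using wcomp_inverse[OF um] by metis
  define k where "k = wcomp v m' g"
  have k: "k \<in> A2" unfolding k_def by (rule wcomp_bergman[OF v(1) g])
  have gk: "g = wcomp u m k" unfolding k_def by (rule v(2)[symmetric]) (rule bergman_outside[OF g])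
  note meas = bL2_measurable[OF bergman_L2]
  note W = wcomp_bergman[OF um f]
  have [measurable]: "\<psi> \<in> borel_measurable borel" "f \<in> borel_measurable borel" "wcomp u m f \<in> borel_measurable borel" "g \<in> borel_measurable borel"
    using psi_measurable meas[OF f] meas[OF W] meas[OF g] by auto
  have mW: "wcomp u m (\<lambda>z. \<psi> z * f z) \<in> borel_measurable borel"
    by (rule wcomp_measurable[OF um]) measurable
  have "bip lam (\<lambda>z. \<psi> z * wcomp u m f z) g = bip lam (wcomp u m (\<lambda>z. \<psi> z * f z)) g"
  proof (rule bip_cong_AE[OF _ mW])
    show "AE z in bmeas lam. \<psi> z * wcomp u m f z = wcomp u m (\<lambda>z. \<psi> z * f z) z"
      using inv by eventually_elim (simp add: wcomp_def)
  qed measurable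
  also have "\<dots> = bip lam (\<lambda>z. \<psi> z * f z) k"
    unfolding gk by (rule wcomp_bip[OF um symbol_mult(1)[OF bergman_L2[OF f]] bergman_L2[OF k]])
  also have "\<dots> = bip lam (toeplitz lam \<phi> f) k" by (rule toeplitz_bip[OF f k, symmetric])
  also have "\<dots> = bip lam (wcomp u m (toeplitz lam \<phi> f)) g"
    unfolding gk by (rule wcomp_bip[OF um bergman_L2[OF toeplitz_in[OF f]] bergman_L2[OF k], symmetric])
  finally show "bip lam (\<lambda>z. \<psi> z * wcomp u m f z) g = bip lam (wcomp u m (toeplitz lam \<phi> f)) g" .
qed

end

lemma toeplitz_invariant:
  assumes \<phi>: "\<phi> \<in> Linfty_ball"
  obtains C where "C \<ge> 0" "bounded_op (toeplitz lam \<phi>) C"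
    "\<And>u m f. multiplier u m \<Longrightarrow> AE z in ball_volume. \<phi> (ball_action u z) = \<phi> z \<Longrightarrow> f \<in> A2 \<Longrightarrow>
      toeplitz lam \<phi> (wcomp u m f) = wcomp u m (toeplitz lam \<phi> f)"
proof -
  have pm: "\<phi> \<in> borel_measurable ball_volume" using \<phi> by (simp add: Linfty_ball_def)
  obtain C where C: "AE z in ball_volume. cmod (\<phi> z) \<le> C" using \<phi> by (auto simp: Linfty_ball_def)
  obtain \<psi> X where \<psi>[measurable]: "\<psi> \<in> borel_measurable borel" and X[measurable]: "X \<in> sets borel" and X0: "emeasure lborel X = 0"
    and eq: "\<And>z. z \<in> ball 0 1 \<Longrightarrow> z \<notin> X \<Longrightarrow> \<phi> z = \<psi> z"
    by (rule ball_volume_borel_version[OF pm]) blast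
  have AE_bergman: "AE z in bergman_measure lam. P z" if "AE z in bmeas lam. P z" for P :: "complex^'n \<Rightarrow> bool"
    by (rule AE_distrD[OF id_measurable_bergman]) (use that in \<open>simp only: bmeas_def\<close>)
  have "AE z in bmeas lam. z \<notin> X" using AE_bmeas_null[OF X X0] by (intro AE_I[of _ _ X]) auto
  with AE_bmeas_ball have "AE z in bmeas lam. \<phi> z = \<psi> z"
    by eventually_elim (rule eq)
  then have AE_eq: "AE z in bergman_measure lam. \<phi> z = \<psi> z" by (rule AE_bergman)
  define C' where "C' = max C 0"
  have "AE z in bergman_measure lam. cmod (\<psi> z) \<le> C'"
    using AE_ball_volume_imp_bergman[OF C, where lam=lam] AE_eq by eventually_elim (simp add: C'_def)
  then have bound: "AE z in bmeas lam. cmod (\<psi> z) \<le> C'" by (subst AE_bmeas_iff) auto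
  have C'0: "C' \<ge> 0" by (simp add: C'_def)
  show thesis
  proof (rule that[OF C'0 bounded_op_toeplitz[OF pm \<psi> AE_eq bound C'0]])
    fix u m f assume um: "multiplier u m" and inv: "AE z in ball_volume. \<phi> (ball_action u z) = \<phi> z" and f: "f \<in> A2"
    have u: "form_unitary u" using um by (simp add: multiplier_def)
    \<comment> \<open>Invariance is assumed for \<open>\<phi>\<close>; it passes to
      \<open>\<psi>\<close> because the points which the action sends into \<open>X\<close> form a
      null set.\<close>
    have "AE z in bmeas lam. \<phi> (ball_action u z) = \<psi> (ball_action u z)"
      using AE_bmeas_ball AE_bmeas_ball_action[OF u X X0]
      by eventually_elim (rule eq[OF ball_action_in_ball[OF u]])
    then have "AE z in bergman_measure lam. \<phi> (ball_action u z) = \<psi> (ball_action u z)" by (rule AE_bergman)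
    with AE_ball_volume_imp_bergman[OF inv, where lam=lam] AE_eq
    have "AE z in bergman_measure lam. \<psi> (ball_action u z) = \<psi> z" by eventually_elim simp
    then have "AE z in bmeas lam. \<psi> (ball_action u z) = \<psi> z" by (subst AE_bmeas_iff) auto
    then show "toeplitz lam \<phi> (wcomp u m f) = wcomp u m (toeplitz lam \<phi> f)"
      by (rule toeplitz_wcomp[OF pm \<psi> AE_eq bound C'0 um _ f])
  qed
qed

text \<open>Two continuous logarithms of the same function differ by a constant, so the lift \<open>j\<close> is
  holomorphic.\<close>

lemma automorphy_multiplier:
  fixes p :: "'g::topological_space \<Rightarrow> complex^('n option)^('n option)" and j :: "'g \<Rightarrow> complex^'n \<Rightarrow> complex"
  assumes j: "is_automorphy_lift lam G p j" and g: "g \<in> carrier G" and u: "form_unitary (p g)"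
  shows "multiplier (p g) (j g)"
proof -
  obtain M :: "'g \<times> (complex^'n) \<Rightarrow> complex" where M: "continuous_on (carrier G \<times> ball 0 1) M"
    "\<And>z. z \<in> ball 0 1 \<Longrightarrow> exp (M (g, z)) = aut_denom (p g) z"
    "\<And>z. z \<in> ball 0 1 \<Longrightarrow> j g z = exp (- of_real lam * M (g, z))"
    using j g unfolding is_automorphy_lift_def by blast
  obtain L where L: "holomorphic_in L (ball 0 1)" "\<And>z. z \<in> ball 0 1 \<Longrightarrow> exp (L z) = aut_denom (p g) z"
    by (rule aut_denom_log[OF u]) blast
  have cM: "continuous_on (ball 0 1) (\<lambda>z. M (g, z))"
    by (rule continuous_on_compose2[OF M(1)]) (use g in \<open>auto intro!: continuous_intros\<close>)
  define c where "c = M (g, 0) - L 0"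
  have "M (g, z) = L z + c" if z: "z \<in> ball 0 1" for z
  proof -
    have "M (g, z) - L z = M (g, 0) - L 0"
    proof (rule exp_one_imp_constant[where f="\<lambda>z. M (g, z) - L z" and S="ball 0 1"])
      show "continuous_on (ball 0 1) (\<lambda>z. M (g, z) - L z)"
        by (intro continuous_on_diff cM holomorphic_in_continuous_on L)
      show "exp (M (g, w) - L w) = 1" if "w \<in> ball 0 1" for w
        using M(2)[OF that] L(2)[OF that] aut_denom_nonzero[OF u that] by (simp add: exp_diff)
    qed (use z in auto)
    then show ?thesis by (simp add: c_def algebra_simps)
  qed
  then have jL: "j g z = exp (- of_real lam * (L z + c))" if "z \<in> ball 0 1" for z using M(3)[OF that] that by simp
  have "holomorphic_in (\<lambda>z. exp (- of_real lam * (L z + c))) (ball 0 1)"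
    by (intro holomorphic_in_exp holomorphic_in_mult holomorphic_in_const holomorphic_in_add L)
  then have "holomorphic_in (j g) (ball 0 1)" by (rule holomorphic_in_cong) (simp_all add: jL)
  moreover have "cmod (j g z) = cmod (aut_denom (p g) z) powr (- lam)" if "z \<in> ball 0 1" for z
    using exp_log_multiplier[OF M(2)[OF that], of lam] by (simp add: M(3)[OF that])
  ultimately show ?thesis using u by (simp add: multiplier_def)
qed

end

theorem mainTheorem3:
  fixes lam :: real
    and H :: "(complex^('n::finite option)^('n option)) set"
    and G :: "('g::topological_space) monoid"
    and p :: "'g \<Rightarrow> complex^('n option)^('n option)"
    and j :: "'g \<Rightarrow> complex^'n \<Rightarrow> complex"
  assumes "lam > real CARD('n)"
    and "maximal_abelian_subgroup H SU_n1"
    and "universal_covering_group G p SU_n1"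
    and "is_automorphy_lift lam G p j"
  shows "bergman_multiplicity_free lam (covering_preimage G p H) (hol_discrete_series G p j)
    \<and> (\<forall>\<phi>\<in>Linfty_ball. \<forall>\<psi>\<in>Linfty_ball.
         invariant_symbol H \<phi> \<and> invariant_symbol H \<psi> \<longrightarrow>
         (\<forall>f\<in>bergman_space lam.
            toeplitz lam \<phi> (toeplitz lam \<psi> f) = toeplitz lam \<psi> (toeplitz lam \<phi> f)))"
proof -
  interpret bergman lam "TYPE('n)" by unfold_locales (rule assms(1))
  have G: "group G" and p_hom: "p \<in> hom G SU_n1" and p_surj: "p ` carrier G = carrier SU_n1"
    using assms(3) by (auto simp: universal_covering_group_def topological_group_on_def covering_space_def)
  interpret p: group_hom G SU_n1 p
    using G p_hom group_SU_n1 by (simp add: group_hom_def group_hom_axioms_def)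
  note Hsub = H_subgroup[OF assms(2)]
  have "\<forall>h\<in>H. \<exists>g\<in>carrier G. p g = h"
  proof
    fix h assume "h \<in> H"
    then have "h \<in> p ` carrier G" unfolding p_surj by (rule subgroup.mem_carrier[OF Hsub])
    then show "\<exists>g\<in>carrier G. p g = h" by auto
  qed
  \<comment> \<open>One lift for each element of \<open>H\<close> suffices: an operator commuting
    with the whole preimage of \<open>H\<close> commutes in particular with the chosen
    operators.\<close>
  then obtain lift where lift: "\<And>h. h \<in> H \<Longrightarrow> lift h \<in> carrier G" "\<And>h. h \<in> H \<Longrightarrow> p (lift h) = h" by metis
  have mult: "multiplier h (j (lift h))" if "h \<in> H" for h
    using automorphy_multiplier[OF assms(4) lift(1)[OF that]] lift(2)[OF that] H_unitary[OF assms(2) that] by simp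
  obtain A z0 r where A: "form_unitary A" "z0 \<in> ball 0 1" "r > 0"
    "\<And>x. A *v cnjv (A *v cnjv x) = x" "A *v cnjv (hlift z0) = hlift z0"
    "\<And>z. z \<in> ball z0 r \<Longrightarrow> \<exists>h\<in>H. \<exists>s. cmod s = 1 \<and> A *v cnjv (hlift z) = s *s (h *v hlift z)"
    by (rule conjugation_exists[OF assms(2)]) blast
  obtain L where L: "holomorphic_in L (ball 0 1)" "\<And>z. z \<in> ball 0 1 \<Longrightarrow> exp (L z) = aut_denom A z"
    by (rule aut_denom_log[OF A(1)]) blast
  interpret conjugated_bergman lam "TYPE('n)" H "\<lambda>h. j (lift h)" A z0 r L
    by unfold_locales (use mult A L in blast)+
  \<comment> \<open>The representation at \<open>g\<close> composes with the inverse of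
    \<open>g\<close>, so composition with \<open>h\<close> itself comes from the inverse of a lift,
    which again lies over \<open>H\<close>.\<close>
  have series: "hol_discrete_series G p j (inv\<^bsub>G\<^esub> (lift h)) = wcomp h (j (lift h))" if "h \<in> H" for h
    using lift[OF that] by (auto simp: hol_discrete_series_def wcomp_def fun_eq_iff)
  have comm: "\<exists>C. commuting_op S C"
    if S: "S \<in> bergman_commutant lam (covering_preimage G p H) (hol_discrete_series G p j)" for S
  proof -
    obtain C0 where "bounded_op S C0"
      using S bergman_bounded_operator_iff by (auto simp: bergman_commutant_def)
    then obtain C where C: "C \<ge> 0" "bounded_op S C" by (rule bounded_op_nonneg)
    have "S (wcomp h (j (lift h)) f) = wcomp h (j (lift h)) (S f)" if h: "h \<in> H" and f: "f \<in> A2" for h f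
    proof -
      have "p (inv\<^bsub>G\<^esub> (lift h)) \<in> H"
        using lift[OF h] subgroup.m_inv_closed[OF Hsub h] by simp
      then have "inv\<^bsub>G\<^esub> (lift h) \<in> covering_preimage G p H" using lift(1)[OF h] by (simp add: covering_preimage_def)
      then have "S (hol_discrete_series G p j (inv\<^bsub>G\<^esub> (lift h)) f) = hol_discrete_series G p j (inv\<^bsub>G\<^esub> (lift h)) (S f)"
        using S f by (auto simp: bergman_commutant_def)
      then show ?thesis by (simp only: series[OF h])
    qed
    then show ?thesis using C by (auto simp: commuting_op_def)
  qed
  have "bergman_multiplicity_free lam (covering_preimage G p H) (hol_discrete_series G p j)"
    unfolding bergman_multiplicity_free_def using comm commutant_commutative by blast
  moreover have "\<exists>C. commuting_op (toeplitz lam \<phi>) C" if \<phi>: "\<phi> \<in> Linfty_ball" "invariant_symbol H \<phi>" for \<phi>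
  proof -
    obtain C where C: "C \<ge> 0" "bounded_op (toeplitz lam \<phi>) C"
      "\<And>u m f. multiplier u m \<Longrightarrow> AE z in ball_volume. \<phi> (ball_action u z) = \<phi> z \<Longrightarrow> f \<in> A2 \<Longrightarrow>
        toeplitz lam \<phi> (wcomp u m f) = wcomp u m (toeplitz lam \<phi> f)"
      by (rule toeplitz_invariant[OF \<phi>(1)]) blast
    then show ?thesis using \<phi>(2) mult by (auto simp: commuting_op_def invariant_symbol_def)
  qed
  ultimately show ?thesis using commutant_commutative by blast
qed

end
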